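(* Let $m\geqslant 1$ be an integer and let $G$ be the symmetric group $S_m$ or the alternating group $A_m$. Let $p_1,\ldots,p_n$ be distinct primes and, for each $i$, let $P_i$ be a Sylow $p_i$-subgroup of $G$. Then there exists $x\in G$ such that, for all $i=1,\ldots,n$, the subgroup $P_i\cap P_i^x$ is inclusion-minimal in the set $\{P_i\cap P_i^g : g\in G\}$.
   Context: For a subgroup $P\le G$ and $g\in G$, $P^g=g^{-1}Pg$. *)

theory Defs
  imports "HOL-Algebra.Algebra"
begin

definition sylow_subgroup :: "nat \<Rightarrow> 'a set \<Rightarrow> ('a, 'b) monoid_scheme \<Rightarrow> bool"
  where "sylow_subgroup p P G \<longleftrightarrow> subgroup P G \<and> card P = p ^ multiplicity p (order G)"

definition conj_subgroup :: "('a, 'b) monoid_scheme \<Rightarrow> 'a set \<Rightarrow> 'a \<Rightarrow> 'a set"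
  where "conj_subgroup G P g = inv\<^bsub>G\<^esub> g <#\<^bsub>G\<^esub> (P #>\<^bsub>G\<^esub> g)"

definition inclusion_minimal :: "'a set \<Rightarrow> 'a set set \<Rightarrow> bool"
  where "inclusion_minimal A \<A> \<longleftrightarrow> A \<in> \<A> \<and> (\<forall>B\<in>\<A>. B \<subseteq> A \<longrightarrow> B = A)"

end

theory Submission
  imports Defs "HOL-Library.Code_Binary_Nat"
begin

text \<open>A \<open>p\<close>-subgroup of the symmetric group is conjugate into any subgroup \<open>W\<close> of index prime to \<open>p\<close>, and if
  \<open>W\<close> and its conjugate share no element of order \<open>p\<close>, then the \<open>p\<close>-subgroup meets its conjugate trivially. For odd \<open>p\<close> take for
  \<open>W\<close> the centralizer of a product of \<open>m div p\<close> disjoint \<open>p\<close>-cycles: the \<open>x\<close> for which \<open>W\<close> and its conjugate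
  share an element of order \<open>p\<close> are few, since such an element has invariant support or no fixed
  points. For \<open>p = 2\<close> take a stabilizer of a matching (for even \<open>m\<close>, with restricted action on its
  edges): the double coset of an \<open>m\<close>-cycle, which makes two matchings into a Hamiltonian path or cycle,
  provides many \<open>x\<close> with trivial intersection. Their number exceeds the sum of the bad \<open>x\<close> over all odd
  primes, asymptotically for \<open>m \<ge> 44\<close> and by computation below. All these sets, except the bad sets for
  \<open>p \<ge> 5\<close>, split evenly into even and odd permutations, which gives the alternating group. For \<open>m = 8\<close> and
  \<open>m \<le> 4\<close> the intersection for \<open>p = 2\<close> need not be trivial and is treated separately.\<close>

text \<open>The proof compares densities. For \<open>m \<ge> 44\<close> the bad permutations of all
  odd primes, those for \<open>p \<ge> 5\<close> counted twice, make up at most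
  \<open>6.5 / m\<close> of the symmetric group, while the elements provided for
  \<open>p = 2\<close> have density of order \<open>1 / sqrt m\<close>; the bound proved for them
  has just passed \<open>6.5 / m\<close> at \<open>m = 44\<close>. A double coset of a Sylow
  2-subgroup has fewer than \<open>4 ^ m\<close> elements and could never reach such a density,
  hence the large overgroups of odd index. For even \<open>m\<close> the full stabilizer of a
  perfect matching is too large, because two perfect matchings always have a nontrivial common
  symmetry. The elements are still taken from its double coset, but only the smaller group, whose
  action on the edges lies in \<open>H\<close>, has to meet its conjugate trivially; the loss
  consists of the elements for which a dihedral involution survives in \<open>H\<close>. Each prime
  brings its own conjugator into the standard group, while \<open>x\<close> is common to all primes;
  this is harmless, since conjugation preserves both the sizes of the sets of \<open>x\<close> and
  parity.\<close>

section \<open>Conjugating p-subgroups into subgroups of index prime to p\<close>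

text \<open>Orbit sizes are powers of \<open>p\<close>. Without a fixed point each would be a
  positive power, and \<open>p\<close> would divide \<open>card E\<close>.\<close>

lemma (in group_action) p_group_fixed_point:
  assumes "Factorial_Ring.prime (p::nat)" "order G = p ^ a" "finite E" "\<not> p dvd card E"
  shows "\<exists>x\<in>E. \<forall>g\<in>carrier G. \<phi> g x = x"
proof (rule ccontr)
  assume neg: "\<not> ?thesis"
  have fin: "finite (carrier G)"
    using assms(1,2) unfolding order_def by (metis card.infinite not_prime_0 power_not_zero)
  have "p dvd card orb" if orb: "orb \<in> orbits G E \<phi>" for orb
  proof -
    obtain x where x: "x \<in> E" "orb = orbit G \<phi> x" using orb unfolding orbits_def by blast
    from neg x(1) obtain g where g: "g \<in> carrier G" "\<phi> g x \<noteq> x" by auto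
    have *: "card orb * card (stabilizer G \<phi> x) = p ^ a"
      using orbit_stabilizer_theorem[OF x(1)] x(2) assms(2) by simp
    then have "card orb dvd p ^ a" by (metis dvd_triv_left)
    then obtain i where i: "card orb = p ^ i"
      using divides_primepow_nat assms(1) by blast
    have "x \<in> orb" "\<phi> g x \<in> orb"
      using x orbit_refl g(1) by (auto simp: orbit_def)
    moreover have "finite orb" using fin x(2) unfolding orbit_def by simp
    ultimately have "card orb \<noteq> 1" using g(2)
      by (metis card_1_singletonE singletonD)
    then show ?thesis using i by (cases i) auto
  qed
  moreover have "card E = (\<Sum>orb\<in>orbits G E \<phi>. card orb)"
    using disjoint_sum[OF assms(3), of "\<lambda>_. 1::nat"] by simp
  ultimately show False using assms(4) by (metis dvd_sum)
qed

text \<open>\<open>P\<close> acts by right multiplication on the right cosets of \<open>W\<close>,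
  whose number is prime to \<open>p\<close>, so it fixes some coset \<open>W #> z\<close>; and
  \<open>W #> (z \<otimes> g) = W #> z\<close> means that
  \<open>z \<otimes> g \<otimes> inv z\<close> lies in \<open>W\<close>.\<close>

lemma (in group) p_subgroup_conj_into:
  assumes "Factorial_Ring.prime (p::nat)" "finite (carrier G)" "subgroup P G" "card P = p ^ a"
    and W: "subgroup W G" and ndvd: "\<not> p dvd order G div card W"
  shows "\<exists>z\<in>carrier G. \<forall>g\<in>P. z \<otimes> g \<otimes> inv z \<in> W"
proof -
  interpret W: subgroup W G by fact
  interpret P: subgroup P G by fact
  let ?E = "rcosets W" and ?GP = "G\<lparr>carrier := P\<rparr>"
  \<comment> \<open>The inverse turns right multiplication into a left action;
    \<open>restrict\<close> is required by the extensional functions of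
    \<open>BijGroup\<close>.\<close>
  define \<phi> where "\<phi> = (\<lambda>g. \<lambda>C\<in>?E. C #> inv g)"
  have gP: "group ?GP" using assms(3) by (rule subgroup_imp_group)
  have clos: "C #> g \<in> ?E" if "C \<in> ?E" "g \<in> carrier G" for C g
    using that W.subset by (auto simp: RCOSETS_def coset_mult_assoc)
  have sub: "C \<subseteq> carrier G" if "C \<in> ?E" for C
    using that W.rcosets_carrier[OF is_group] by blast
  have act: "group_action ?GP ?E \<phi>"
    unfolding group_action_def group_hom_def group_hom_axioms_def hom_def
  proof (intro conjI CollectI ballI gP group_BijGroup Pi_I)
    fix g assume g: "g \<in> carrier ?GP"
    then have gc: "g \<in> carrier G" "inv g \<in> carrier G" by auto
    have "bij_betw (\<phi> g) ?E ?E"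
    proof (rule bij_betw_byWitness[where f' = "\<lambda>C. C #> g"])
      show "\<forall>C\<in>?E. \<phi> g C #> g = C"
        using sub gc by (auto simp: \<phi>_def coset_mult_assoc coset_mult_one)
      show "\<forall>C\<in>?E. \<phi> g (C #> g) = C"
        using sub gc clos by (auto simp: \<phi>_def coset_mult_assoc coset_mult_one)
    qed (use clos gc in \<open>auto simp: \<phi>_def\<close>)
    then show "\<phi> g \<in> carrier (BijGroup ?E)"
      by (auto simp: BijGroup_def Bij_def \<phi>_def)
    fix h assume h: "h \<in> carrier ?GP"
    then have hc: "h \<in> carrier G" "inv h \<in> carrier G" by auto
    have "bij_betw (\<phi> h) ?E ?E"
    proof (rule bij_betw_byWitness[where f' = "\<lambda>C. C #> h"])
      show "\<forall>C\<in>?E. \<phi> h C #> h = C"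
        using sub hc by (auto simp: \<phi>_def coset_mult_assoc coset_mult_one)
      show "\<forall>C\<in>?E. \<phi> h (C #> h) = C"
        using sub hc clos by (auto simp: \<phi>_def coset_mult_assoc coset_mult_one)
    qed (use clos hc in \<open>auto simp: \<phi>_def\<close>)
    with \<open>bij_betw (\<phi> g) ?E ?E\<close> show "\<phi> (g \<otimes>\<^bsub>?GP\<^esub> h) = \<phi> g \<otimes>\<^bsub>BijGroup ?E\<^esub> \<phi> h"
      using gc hc sub clos
      by (auto simp: BijGroup_def Bij_def \<phi>_def compose_def coset_mult_assoc inv_mult_group
          intro!: restrict_ext)
  qed
  have finE: "finite ?E" using assms(2) W.subset rcosets_part_G[OF W] by (metis finite_UnionD)
  have "card ?E * card W = order G" using lagrange[OF W] .
  moreover have "card W \<noteq> 0"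
    using assms(2) W.subset W.one_closed by (metis card_0_eq empty_iff finite_subset)
  ultimately have "\<not> p dvd card ?E" using ndvd by (metis nonzero_mult_div_cancel_right)
  then obtain C where C: "C \<in> ?E" "\<forall>g\<in>P. \<phi> g C = C"
    using group_action.p_group_fixed_point[OF act assms(1) _ finE, where a = a] assms(4)
    by (auto simp: order_def)
  then obtain z where z: "z \<in> carrier G" "C = W #> z" by (auto simp: RCOSETS_def)
  have "z \<otimes> g \<otimes> inv z \<in> W" if g: "g \<in> P" for g
  proof -
    have gc: "g \<in> carrier G" "inv g \<in> P" using g by auto
    have "C #> g = C" using C gc \<open>inv g \<in> P\<close> P.subset by (auto simp: \<phi>_def dest!: bspec[of P _ "inv g"])
    then have "W #> (z \<otimes> g) = W #> z" using z gc W.subset by (simp add: coset_mult_assoc)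
    then have "W #> (z \<otimes> g \<otimes> inv z) = W"
      using z gc W.subset by (intro coset_mult_inv2) auto
    then show ?thesis using z gc W coset_join1 by blast
  qed
  then show ?thesis using z by blast
qed

lemma order_sym_group: "order (sym_group m) = fact m"
  unfolding order_def sym_group_def by (simp add: card_permutations)

lemma subgroup_sym_groupI:
  assumes "\<And>w. w \<in> W \<Longrightarrow> w permutes {1..m}" "id \<in> W"
    "\<And>v w. v \<in> W \<Longrightarrow> w \<in> W \<Longrightarrow> v \<circ> w \<in> W" "\<And>w. w \<in> W \<Longrightarrow> inv' w \<in> W"
  shows "subgroup W (sym_group m)"
  by (rule group.subgroupI[OF sym_group_is_group])
    (use assms in \<open>auto simp: sym_group_carrier sym_group_mult\<close>)

lemma subgroup_sym_groupD:
  assumes "subgroup W (sym_group m)"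
  shows "w \<in> W \<Longrightarrow> w permutes {1..m}" "id \<in> W"
    "v \<in> W \<Longrightarrow> w \<in> W \<Longrightarrow> v \<circ> w \<in> W" "w \<in> W \<Longrightarrow> inv' w \<in> W"
proof -
  show 1: "w \<in> W \<Longrightarrow> w permutes {1..m}" for w
    using subgroup.subset[OF assms] by (auto simp: sym_group_carrier)
  show "id \<in> W" using subgroup.one_closed[OF assms] by (simp add: sym_group_one)
  show "v \<in> W \<Longrightarrow> w \<in> W \<Longrightarrow> v \<circ> w \<in> W"
    using subgroup.m_closed[OF assms] by (simp add: sym_group_mult)
  show "w \<in> W \<Longrightarrow> inv' w \<in> W"
    using subgroup.m_inv_closed[OF assms] 1 by (simp add: sym_group_carrier)
qed

lemma p_subgroup_sym_conj_into:
  assumes "Factorial_Ring.prime (p::nat)" "subgroup P (sym_group m)" "card P = p ^ a"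
    and "subgroup W (sym_group m)" "\<not> p dvd fact m div card W"
  shows "\<exists>z. z permutes {1..m} \<and> (\<forall>g\<in>P. z \<circ> g \<circ> inv' z \<in> W)"
proof -
  have "finite (carrier (sym_group m))" by (simp add: sym_group_def finite_permutations)
  from group.p_subgroup_conj_into[OF sym_group_is_group assms(1) this assms(2-4)] assms(5)
  show ?thesis by (auto simp: order_sym_group sym_group_carrier sym_group_mult)
qed

text \<open>The multiples of \<open>p\<close> up to \<open>m\<close> contribute
  \<open>p ^ (m div p) * fact (m div p)\<close>, the other factors are prime to \<open>p\<close>.
  This product is the order of the centralizers below, whose index is therefore prime to
  \<open>p\<close>.\<close>

lemma fact_prime_part:
  assumes "Factorial_Ring.prime (p::nat)"
  shows "\<exists>q. fact m = p ^ (m div p) * fact (m div p) * q \<and> \<not> p dvd q"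
proof (induction m)
  case 0
  show ?case using assms by (intro exI[of _ 1]) (auto simp: prime_nat_iff)
next
  case (Suc m)
  then obtain q where q: "fact m = p ^ (m div p) * fact (m div p) * q" "\<not> p dvd q" by auto
  show ?case
  proof (cases "p dvd Suc m")
    case True
    then obtain j where j: "Suc m = p * j" by auto
    then have j0: "j > 0" by (cases j) auto
    have p0: "p > 0" using assms prime_gt_0_nat by blast
    have "m = p * (j - 1) + (p - 1)" using j j0 p0 by (cases j; cases p) (auto simp: algebra_simps)
    then have d: "m div p = j - 1"
      using p0 j0 by (intro div_nat_eqI) (auto simp: algebra_simps)
    have d': "Suc m div p = j" using j p0 by simp
    have "fact (Suc m) = p * j * fact m" using j by (metis fact_Suc of_nat_id)
    also have "\<dots> = p ^ j * fact j * q"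
      using j0 q(1) d by (cases j) (simp_all add: algebra_simps)
    finally show ?thesis using d' q(2) by auto
  next
    case False
    then have d: "Suc m div p = m div p" by (simp add: div_Suc dvd_eq_mod_eq_0)
    have "fact (Suc m) = p ^ (m div p) * fact (m div p) * (q * Suc m)"
      using q(1) by (simp add: algebra_simps)
    moreover have "\<not> p dvd q * Suc m" using q(2) False assms prime_dvd_multD by blast
    ultimately show ?thesis using d by auto
  qed
qed

section \<open>Centralizers of permutations with cycles of equal length\<close>

text \<open>Says that \<open>U\<close> is a union of cycles of \<open>g\<close> of length exactly
  \<open>p\<close>, without asking \<open>g\<close> to be a permutation. Thus one function,
  \<open>std_cyc p\<close>, can serve every set consisting of whole blocks.\<close>

definition free_cyc :: "nat \<Rightarrow> 'a set \<Rightarrow> ('a \<Rightarrow> 'a) \<Rightarrow> bool"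
  where "free_cyc p U g \<longleftrightarrow>
    (\<forall>u\<in>U. g u \<in> U \<and> (g ^^ p) u = u \<and> (\<forall>i\<in>{1..<p}. (g ^^ i) u \<noteq> u))"

definition cent :: "'a set \<Rightarrow> ('a \<Rightarrow> 'a) \<Rightarrow> ('a \<Rightarrow> 'a) set"
  where "cent U g = {c. c permutes U \<and> (\<forall>u\<in>U. c (g u) = g (c u))}"

definition orb :: "('a \<Rightarrow> 'a) \<Rightarrow> 'a \<Rightarrow> 'a set"
  where "orb g a = range (\<lambda>i. (g ^^ i) a)"

lemma funpow_funpow: "(g ^^ i) ((g ^^ j) x) = (g ^^ (i + j)) x"
  by (simp add: funpow_add)

lemma centD:
  assumes "c \<in> cent U g"
  shows "c permutes U" "u \<in> U \<Longrightarrow> c (g u) = g (c u)"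
  using assms by (auto simp: cent_def)

lemma free_cyc_funpow:
  assumes "free_cyc p U g" "u \<in> U"
  shows "(g ^^ i) u \<in> U"
  using assms by (induction i) (auto simp: free_cyc_def)

lemma cent_funpow:
  assumes "c \<in> cent U g" "\<And>u. u \<in> U \<Longrightarrow> g u \<in> U" "u \<in> U"
  shows "c ((g ^^ i) u) = (g ^^ i) (c u)"
proof (induction i)
  case (Suc i)
  have "(g ^^ i) u \<in> U" using assms(2,3) by (induction i) auto
  with Suc assms(1) show ?case by (simp add: cent_def)
qed simp

lemma free_cyc_mod:
  assumes "free_cyc p U g" "u \<in> U"
  shows "(g ^^ i) u = (g ^^ (i mod p)) u"
proof -
  have "(g ^^ p) v = v" if "v \<in> U" for v using assms(1) that by (auto simp: free_cyc_def)
  then have "(g ^^ (p * j)) u = u" for j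
    using assms(2) by (induction j) (simp_all add: funpow_add)
  moreover have "(g ^^ i) u = (g ^^ (i mod p + p * (i div p))) u" by simp
  ultimately show ?thesis by (simp only: funpow_add comp_apply)
qed

lemma free_cyc_eq_iff:
  assumes "free_cyc p U g" "u \<in> U" "p > 0"
  shows "(g ^^ i) u = (g ^^ j) u \<longleftrightarrow> i mod p = j mod p"
proof
  have *: "i = j" if "i \<le> j" "j < p" "(g ^^ i) u = (g ^^ j) u" for i j
  proof (rule ccontr)
    assume "i \<noteq> j"
    \<comment> \<open>Applying \<open>g ^^ (p - j)\<close> turns the coincidence into a period
      \<open>p - j + i\<close> strictly between 0 and \<open>p\<close>.\<close>
    have "(g ^^ (p - j + i)) u = (g ^^ (p - j)) ((g ^^ j) u)"
      using that(3) by (simp add: funpow_add)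
    also have "\<dots> = (g ^^ p) u" using that(2) by (simp add: funpow_funpow)
    also have "\<dots> = u" using assms by (auto simp: free_cyc_def)
    finally have "(g ^^ (p - j + i)) u = u" .
    moreover have "p - j + i \<in> {1..<p}" using that \<open>i \<noteq> j\<close> by auto
    ultimately show False using assms by (auto simp: free_cyc_def)
  qed
  assume "(g ^^ i) u = (g ^^ j) u"
  then have "(g ^^ (i mod p)) u = (g ^^ (j mod p)) u"
    using free_cyc_mod[OF assms(1,2)] by metis
  then show "i mod p = j mod p"
    using *[of "i mod p" "j mod p"] *[of "j mod p" "i mod p"] assms(3)
    by (metis mod_less_divisor nle_le)
next
  assume "i mod p = j mod p"
  then show "(g ^^ i) u = (g ^^ j) u" using free_cyc_mod[OF assms(1,2)] by metis
qed

lemma orb_facts: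
  assumes "free_cyc p U g" "a \<in> U" "p > 0"
  shows "orb g a \<subseteq> U" "a \<in> orb g a" "card (orb g a) = p"
    "x \<in> orb g a \<Longrightarrow> g x \<in> orb g a" "x \<in> U \<Longrightarrow> g x \<in> orb g a \<Longrightarrow> x \<in> orb g a"
proof -
  show "orb g a \<subseteq> U" using free_cyc_funpow[OF assms(1,2)] by (auto simp: orb_def)
  show "a \<in> orb g a" unfolding orb_def by (rule image_eqI[of _ _ 0]) auto
  have "orb g a = (\<lambda>i. (g ^^ i) a) ` {..<p}"
  proof (intro equalityI subsetI)
    fix x assume "x \<in> orb g a"
    then obtain i where "x = (g ^^ i) a" by (auto simp: orb_def)
    then have "x = (g ^^ (i mod p)) a" using free_cyc_mod[OF assms(1,2)] by metis
    then show "x \<in> (\<lambda>i. (g ^^ i) a) ` {..<p}" using assms(3) by auto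
  qed (auto simp: orb_def)
  moreover have "inj_on (\<lambda>i. (g ^^ i) a) {..<p}"
    using free_cyc_eq_iff[OF assms] by (auto intro!: inj_onI)
  ultimately show "card (orb g a) = p" by (simp add: card_image)
  show *: "x \<in> orb g a \<Longrightarrow> g x \<in> orb g a" for x
    unfolding orb_def by (auto intro!: image_eqI[of _ _ "Suc _"])
  assume x: "x \<in> U" and "g x \<in> orb g a"
  then have "(g ^^ i) (g x) \<in> orb g a" for i by (induction i) (auto intro: *)
  then have "(g ^^ (p - 1)) (g x) \<in> orb g a" .
  moreover have "(g ^^ (p - 1)) (g x) = (g ^^ p) x"
    using assms(3) by (cases p) (auto simp: funpow_swap1)
  ultimately show "x \<in> orb g a" using assms(1) x by (auto simp: free_cyc_def)
qed

lemma free_cyc_subset: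
  assumes "free_cyc p U g" "T \<subseteq> U" "\<And>x. x \<in> T \<Longrightarrow> g x \<in> T"
  shows "free_cyc p T g"
  using assms unfolding free_cyc_def by blast

lemma free_cyc_Diff:
  assumes "free_cyc p U g" "p > 0" "T \<subseteq> U" "\<And>x. x \<in> T \<Longrightarrow> g x \<in> T"
  shows "free_cyc p (U - T) g"
proof (rule free_cyc_subset[OF assms(1)])
  fix x assume x: "x \<in> U - T"
  have "g x \<notin> T"
  proof
    assume "g x \<in> T"
    then have "(g ^^ i) (g x) \<in> T" for i by (induction i) (auto intro: assms(4))
    then have "(g ^^ (p - 1)) (g x) \<in> T" .
    moreover have "(g ^^ (p - 1)) (g x) = (g ^^ p) x"
      using assms(2) by (cases p) (auto simp: funpow_swap1)
    ultimately show False using assms(1) x by (auto simp: free_cyc_def)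
  qed
  then show "g x \<in> U - T" using assms(1) x by (auto simp: free_cyc_def)
qed auto

lemma free_cyc_dvd_card:
  assumes "free_cyc p U g" "p > 0" "finite U"
  shows "p dvd card U"
  using assms
proof (induction "card U" arbitrary: U rule: less_induct)
  case less
  show ?case
  proof (cases "U = {}")
    case False
    then obtain a where a: "a \<in> U" by auto
    note o = orb_facts[OF less.prems(1) a less.prems(2)]
    have fc: "free_cyc p (U - orb g a) g"
      using free_cyc_Diff[OF less.prems(1,2)] o by auto
    have c: "card (U - orb g a) = card U - p" "p \<le> card U"
      using o less.prems(3) by (simp_all add: card_Diff_subset finite_subset)
        (metis card_mono)
    have "p dvd card (U - orb g a)"
      using less.hyps[OF _ fc] less.prems c by auto
    then show ?thesis using c by (metis dvd_add_triv_right_iff le_add_diff_inverse2)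
  qed auto
qed

text \<open>On the cycle of \<open>a\<close> a power of \<open>g\<close> does it; otherwise exchange
  the cycles of \<open>a\<close> and \<open>u\<close> compatibly with \<open>g\<close>.\<close>

lemma cent_transitive:
  assumes fc: "free_cyc p U g" and p: "p > 0" and a: "a \<in> U" and u: "u \<in> U"
    and perm: "\<And>v. v \<in> U \<Longrightarrow> g v \<in> U"
  shows "\<exists>c\<in>cent U g. c a = u"
proof (cases "u \<in> orb g a")
  case True
  then obtain i where i: "u = (g ^^ i) a" by (auto simp: orb_def)
  define c where "c = restrict_id (g ^^ i) U"
  have "inj_on (g ^^ i) U"
  proof (rule inj_onI)
    fix x y assume xy: "x \<in> U" "y \<in> U" "(g ^^ i) x = (g ^^ i) y"
    \<comment> \<open>\<open>j\<close> completes \<open>i\<close> to the multiple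
      \<open>p * i\<close> of \<open>p\<close>, so \<open>g ^^ j\<close> undoes
      \<open>g ^^ i\<close> on \<open>U\<close>.\<close>
    define j where "j = p * i - i"
    have j: "(i + j) mod p = 0" using p by (simp add: j_def)
    have "(g ^^ (j + i)) x = (g ^^ (j + i)) y" using xy(3) by (simp add: funpow_add)
    then show "x = y"
      using free_cyc_eq_iff[OF fc _ p, of _ "j + i" 0] xy j by (simp add: add.commute)
  qed
  moreover have "(g ^^ i) ` U \<subseteq> U" using free_cyc_funpow[OF fc] by auto
  ultimately have "bij_betw (g ^^ i) U U"
  proof -
    have "(g ^^ i) ` U = U"
    proof (intro equalityI subsetI)
      fix x assume x: "x \<in> U"
      have "(g ^^ i) ((g ^^ (p * i - i)) x) = (g ^^ (p * i)) x"
        using p by (simp add: funpow_funpow)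
      also have "\<dots> = x" using free_cyc_mod[OF fc x, of "p * i"] by simp
      finally show "x \<in> (g ^^ i) ` U" using free_cyc_funpow[OF fc x] by (metis image_eqI)
    qed (use \<open>(g ^^ i) ` U \<subseteq> U\<close> in auto)
    then show ?thesis using \<open>inj_on (g ^^ i) U\<close> by (simp add: bij_betw_def)
  qed
  then have "c permutes U" unfolding c_def by (rule permutes_restrict_id)
  then have "c \<in> cent U g"
    using perm by (auto simp: cent_def c_def funpow_swap1)
  moreover have "c a = u" using a i by (simp add: c_def)
  ultimately show ?thesis by blast
next
  case False
  \<comment> \<open>\<open>s\<close> exchanges \<open>(g ^^ i) a\<close> and
    \<open>(g ^^ i) u\<close>. The exponent picked by \<open>SOME\<close> is determined only modulo
    \<open>p\<close>, which is enough because both cycles have length \<open>p\<close>.\<close>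
  define s where "s x = (if x \<in> orb g a then (g ^^ (SOME i. x = (g ^^ i) a)) u
     else if x \<in> orb g u then (g ^^ (SOME i. x = (g ^^ i) u)) a else x)" for x
  have sa: "s ((g ^^ i) a) = (g ^^ i) u" for i
  proof -
    have "(g ^^ i) a \<in> orb g a" by (auto simp: orb_def)
    moreover have "(g ^^ i) a = (g ^^ (SOME j. (g ^^ i) a = (g ^^ j) a)) a"
      by (rule someI[of _ i]) simp
    ultimately show ?thesis
      using free_cyc_eq_iff[OF fc a p] free_cyc_eq_iff[OF fc u p] by (simp add: s_def)
  qed
  have dis: "(g ^^ i) u \<notin> orb g a" for i
  proof
    assume "(g ^^ i) u \<in> orb g a"
    then obtain j where "(g ^^ i) u = (g ^^ j) a" by (auto simp: orb_def)
    then have "(g ^^ (p * i - i)) ((g ^^ i) u) = (g ^^ (p * i - i + j)) a"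
      by (simp add: funpow_add)
    moreover have "(g ^^ (p * i - i)) ((g ^^ i) u) = (g ^^ (p * i)) u"
      using p by (simp add: funpow_funpow)
    ultimately have "u = (g ^^ (p * i - i + j)) a" using free_cyc_mod[OF fc u, of "p * i"] by simp
    then show False using False by (auto simp: orb_def)
  qed
  have su: "s ((g ^^ i) u) = (g ^^ i) a" for i
  proof -
    have "(g ^^ i) u \<in> orb g u" by (auto simp: orb_def)
    moreover have "(g ^^ i) u = (g ^^ (SOME j. (g ^^ i) u = (g ^^ j) u)) u"
      by (rule someI[of _ i]) simp
    ultimately show ?thesis
      using dis free_cyc_eq_iff[OF fc a p] free_cyc_eq_iff[OF fc u p] by (simp add: s_def)
  qed
  have sx: "s x = x" if "x \<notin> orb g a" "x \<notin> orb g u" for x using that by (simp add: s_def)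
  have ss: "s (s x) = x" for x
    using sa su sx by (cases "x \<in> orb g a"; cases "x \<in> orb g u") (auto simp: orb_def)
  have "s permutes U"
  proof (rule bij_imp_permutes)
    have "s x \<in> U" if "x \<in> U" for x
      using that sa su sx free_cyc_funpow[OF fc a] free_cyc_funpow[OF fc u]
      by (cases "x \<in> orb g a"; cases "x \<in> orb g u") (auto simp: orb_def)
    then show "bij_betw s U U" using ss by (intro bij_betw_byWitness[of _ s]) auto
    show "s x = x" if "x \<notin> U" for x
      using that sx orb_facts(1)[OF fc a p] orb_facts(1)[OF fc u p] by blast
  qed
  moreover have "s (g x) = g (s x)" if x: "x \<in> U" for x
  proof -
    consider i where "x = (g ^^ i) a" | i where "x = (g ^^ i) u" | "x \<notin> orb g a" "x \<notin> orb g u"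
      by (auto simp: orb_def)
    then show ?thesis
    proof cases
      case 1 then show ?thesis using sa[of "Suc i"] sa[of i] by simp
    next
      case 2 then show ?thesis using su[of "Suc i"] su[of i] by simp
    next
      case 3
      then have "g x \<notin> orb g a" "g x \<notin> orb g u"
        using orb_facts(5)[OF fc a p x] orb_facts(5)[OF fc u p x] by auto
      then show ?thesis using 3 sx by simp
    qed
  qed
  ultimately have "s \<in> cent U g" by (auto simp: cent_def)
  moreover have "s a = u" using sa[of 0] by simp
  ultimately show ?thesis by blast
qed

lemma finite_cent: "finite U \<Longrightarrow> finite (cent U g)"
  unfolding cent_def by (rule finite_subset[OF _ finite_permutations]) auto

lemma cent_comp: "c \<in> cent U g \<Longrightarrow> d \<in> cent U g \<Longrightarrow> c \<circ> d \<in> cent U g"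
  by (auto simp: cent_def permutes_compose permutes_in_image)

lemma cent_inv:
  assumes "c \<in> cent U g" "\<And>v. v \<in> U \<Longrightarrow> g v \<in> U"
  shows "inv' c \<in> cent U g"
proof -
  have c: "c permutes U" using assms(1) centD by blast
  have "inv' c (g u) = g (inv' c u)" if "u \<in> U" for u
  proof -
    have v: "inv' c u \<in> U" using c that permutes_inv permutes_in_image by metis
    then have "c (g (inv' c u)) = g u"
      using assms(1) c by (simp add: cent_def permutes_inverses)
    then show ?thesis by (metis c permutes_inverses(2))
  qed
  then show ?thesis using c by (auto simp: cent_def permutes_inv)
qed

text \<open>A permutation that commutes with \<open>g\<close> and fixes \<open>a\<close> fixes the
  whole cycle of \<open>a\<close>, so what remains is the same problem with one cycle less.\<close>

lemma cent_stabilizer: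
  assumes fc: "free_cyc p U g" and p: "p > 0" and a: "a \<in> U"
  shows "{c \<in> cent U g. c a = a} = cent (U - orb g a) g"
proof (intro equalityI subsetI)
  note o = orb_facts[OF fc a p]
  have cl: "\<And>v. v \<in> U \<Longrightarrow> g v \<in> U" using fc by (auto simp: free_cyc_def)
  fix c assume "c \<in> {c \<in> cent U g. c a = a}"
  then have c: "c \<in> cent U g" "c a = a" by auto
  then have fix_orb: "c x = x" if "x \<in> orb g a" for x
    using that cent_funpow[OF c(1) cl a] by (auto simp: orb_def)
  have "c permutes (U - orb g a)"
    by (rule permutes_superset[OF centD(1)[OF c(1)]]) (use fix_orb in auto)
  then show "c \<in> cent (U - orb g a) g" using c by (auto simp: cent_def)
next
  note o = orb_facts[OF fc a p]
  fix c assume c: "c \<in> cent (U - orb g a) g"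
  then have "c permutes U" using permutes_subset[of c "U - orb g a" U] by (auto simp: cent_def)
  moreover have "c (g u) = g (c u)" if "u \<in> U" for u
    using c that o(4) by (cases "u \<in> orb g a") (auto simp: cent_def permutes_not_in)
  moreover have "c a = a" using c o(2) by (auto simp: cent_def permutes_not_in)
  ultimately show "c \<in> {c \<in> cent U g. c a = a}" by (auto simp: cent_def)
qed

text \<open>Orbit counting: each fibre \<open>c a = u\<close> is a coset of the stabilizer of
  \<open>a\<close>, which is the centralizer on one cycle less, and all \<open>p * Suc k\<close>
  values of \<open>u\<close> occur.\<close>

lemma card_cent:
  assumes "free_cyc p U g" "p > 0" "finite U" "card U = p * k"
  shows "card (cent U g) = p ^ k * fact k"
  using assms
proof (induction k arbitrary: U)
  case 0
  then have "cent U g = {id}" by (auto simp: cent_def)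
  then show ?case by simp
next
  case (Suc k)
  then obtain a where a: "a \<in> U" by fastforce
  note fc = Suc.prems(1) and p = Suc.prems(2)
  note o = orb_facts[OF fc a p]
  have cl: "\<And>v. v \<in> U \<Longrightarrow> g v \<in> U" using fc by (auto simp: free_cyc_def)
  have fc': "free_cyc p (U - orb g a) g" using free_cyc_Diff[OF fc p o(1)] o(4) by auto
  have "card (U - orb g a) = p * k"
    using Suc.prems(3,4) o by (simp add: card_Diff_subset finite_subset)
  then have IH: "card {c \<in> cent U g. c a = a} = p ^ k * fact k"
    using Suc.IH[OF fc' p] Suc.prems(3) cent_stabilizer[OF fc p a] by simp
  have "card {c \<in> cent U g. c a = u} = p ^ k * fact k" if u: "u \<in> U" for u
  proof -
    obtain d where d: "d \<in> cent U g" "d a = u" using cent_transitive[OF fc p a u cl] by auto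
    note dp = centD(1)[OF d(1)]
    have "bij_betw ((\<circ>) d) {c \<in> cent U g. c a = a} {c \<in> cent U g. c a = u}"
    proof (rule bij_betw_byWitness[where f' = "(\<circ>) (inv' d)"])
      show "(\<circ>) d ` {c \<in> cent U g. c a = a} \<subseteq> {c \<in> cent U g. c a = u}"
        using d cent_comp by auto
      show "(\<circ>) (inv' d) ` {c \<in> cent U g. c a = u} \<subseteq> {c \<in> cent U g. c a = a}"
      proof (rule image_subsetI)
        fix c assume c: "c \<in> {c \<in> cent U g. c a = u}"
        then have "inv' d \<circ> c \<in> cent U g" using cent_comp[OF cent_inv[OF d(1) cl]] by blast
        moreover have "(inv' d \<circ> c) a = a" using c d(2) permutes_inverses(2)[OF dp, of a] by simp
        ultimately show "inv' d \<circ> c \<in> {c \<in> cent U g. c a = a}" by blast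
      qed
      show "\<forall>c\<in>{c \<in> cent U g. c a = a}. inv' d \<circ> (d \<circ> c) = c"
        using permutes_inv_o(2)[OF dp] by (metis comp_assoc id_comp)
      show "\<forall>c\<in>{c \<in> cent U g. c a = u}. d \<circ> (inv' d \<circ> c) = c"
        using permutes_inv_o(1)[OF dp] by (metis comp_assoc id_comp)
    qed
    from bij_betw_same_card[OF this] show ?thesis using IH by simp
  qed
  moreover have "cent U g = (\<Union>u\<in>U. {c \<in> cent U g. c a = u})"
    using a by (auto simp: cent_def permutes_in_image)
  moreover have "card (\<Union>u\<in>U. {c \<in> cent U g. c a = u}) = (\<Sum>u\<in>U. card {c \<in> cent U g. c a = u})"
    using Suc.prems(3) finite_cent[OF Suc.prems(3)] by (intro card_UN_disjoint) auto
  ultimately show ?case using Suc.prems(4) by (simp add: algebra_simps)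
qed

text \<open>Invariant sets are unions of cycles. Splitting them by whether they contain the cycle of
  \<open>a\<close> reproduces Pascal's rule.\<close>

lemma card_invariant_subsets:
  assumes "free_cyc p U g" "p > 0" "finite U" "card U = p * k"
  shows "card {S. S \<subseteq> U \<and> (\<forall>x\<in>S. g x \<in> S) \<and> card S = p * l} \<le> k choose l"
  using assms
proof (induction k arbitrary: U l)
  case 0
  then have "U = {}" by simp
  then have "{S. S \<subseteq> U \<and> (\<forall>x\<in>S. g x \<in> S) \<and> card S = p * l} \<subseteq> (if l = 0 then {{}} else {})"
    using 0 by auto
  then have "card {S. S \<subseteq> U \<and> (\<forall>x\<in>S. g x \<in> S) \<and> card S = p * l} \<le> card (if l = 0 then {{}::'a set} else {})"
    by (intro card_mono) auto
  then show ?case by (cases l) auto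
next
  case (Suc k)
  then obtain a where a: "a \<in> U" by fastforce
  note fc = Suc.prems(1) and p = Suc.prems(2)
  note o = orb_facts[OF fc a p]
  define Inv where "Inv V l = {S. S \<subseteq> V \<and> (\<forall>x\<in>S. g x \<in> S) \<and> card S = p * l}" for V l
  have finI: "finite (Inv V l)" if "finite V" for V l
    using that by (auto simp: Inv_def intro: finite_subset[of _ "Pow V"])
  let ?V = "U - orb g a"
  have fc': "free_cyc p ?V g" using free_cyc_Diff[OF fc p o(1)] o(4) by auto
  have cV: "card ?V = p * k"
    using Suc.prems(3,4) o by (simp add: card_Diff_subset finite_subset)
  have IH: "card (Inv ?V l) \<le> k choose l" for l
    using Suc.IH[OF fc' p _ cV] Suc.prems(3) by (simp add: Inv_def)
  have in_orb: "orb g a \<subseteq> S" if "\<forall>x\<in>S. g x \<in> S" "a \<in> S" for S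
  proof
    fix x assume "x \<in> orb g a"
    then obtain i where "x = (g ^^ i) a" by (auto simp: orb_def)
    moreover have "(g ^^ i) a \<in> S" using that by (induction i) auto
    ultimately show "x \<in> S" by simp
  qed
  have notin: "S \<inter> orb g a = {}" if S: "S \<subseteq> U" "\<forall>x\<in>S. g x \<in> S" "a \<notin> S" for S
  proof (rule ccontr)
    assume "S \<inter> orb g a \<noteq> {}"
    then obtain i where i: "(g ^^ i) a \<in> S" by (auto simp: orb_def)
    have "(g ^^ j) ((g ^^ i) a) \<in> S" for j using S(2) i by (induction j) auto
    then have "(g ^^ (p * i - i)) ((g ^^ i) a) \<in> S" .
    moreover have "(g ^^ (p * i - i)) ((g ^^ i) a) = (g ^^ (p * i)) a"
      using p by (simp add: funpow_funpow)
    ultimately show False using S(3) free_cyc_mod[OF fc a, of "p * i"] by simp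
  qed
  have cov: "Inv U l \<subseteq> Inv ?V l \<union> (if l = 0 then {} else (\<lambda>S. S \<union> orb g a) ` Inv ?V (l - 1))"
  proof
    fix S assume S: "S \<in> Inv U l"
    then have fS: "finite S" using Suc.prems(3) finite_subset by (auto simp: Inv_def)
    show "S \<in> Inv ?V l \<union> (if l = 0 then {} else (\<lambda>S. S \<union> orb g a) ` Inv ?V (l - 1))"
    proof (cases "a \<in> S")
      case False
      then have "S \<in> Inv ?V l" using S notin[of S] by (auto simp: Inv_def)
      then show ?thesis by blast
    next
      case True
      then have oS: "orb g a \<subseteq> S" using in_orb S by (auto simp: Inv_def)
      then have "p \<le> card S" using card_mono[OF fS oS] o(3) by simp
      moreover have cS: "card S = p * l" using S by (auto simp: Inv_def)
      ultimately have l: "l > 0" using p by (cases l) auto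
      have c: "card (S - orb g a) = p * (l - 1)"
        using cS o(3) card_Diff_subset[OF finite_subset[OF oS fS] oS] by (simp add: algebra_simps)
      have "S - orb g a \<in> Inv ?V (l - 1)"
        using S c o(5) by (auto simp: Inv_def)
      then have "S \<in> (\<lambda>S. S \<union> orb g a) ` Inv ?V (l - 1)"
        using oS by (auto intro!: image_eqI[of _ _ "S - orb g a"])
      then show ?thesis using l by simp
    qed
  qed
  have "card (Inv U l) \<le> Suc k choose l"
  proof (cases l)
    case 0
    then have "card (Inv U l) \<le> card (Inv ?V l)"
      using cov finI Suc.prems(3) by (intro card_mono) auto
    then show ?thesis using IH[of l] 0 by simp
  next
    case (Suc l')
    then have "card (Inv U l) \<le> card (Inv ?V l \<union> (\<lambda>S. S \<union> orb g a) ` Inv ?V l')"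
      using cov finI Suc.prems(3) by (intro card_mono) auto
    also have "\<dots> \<le> card (Inv ?V l) + card (Inv ?V l')"
      using card_image_le[OF finI, of ?V "\<lambda>S. S \<union> orb g a" l'] Suc.prems(3)
        card_Un_le[of "Inv ?V l" "(\<lambda>S. S \<union> orb g a) ` Inv ?V l'"] by simp
    also have "\<dots> \<le> Suc k choose l" using IH[of l] IH[of l'] Suc by simp
    finally show ?thesis .
  qed
  then show ?case by (simp add: Inv_def)
qed

section \<open>Counting nontrivial common elements of order p\<close>

text \<open>It suffices to test elements of order \<open>p\<close>: a nontrivial common element of
  \<open>p\<close>-power order has a power of order \<open>p\<close>, which is common as
  well.\<close>

definition bad :: "nat \<Rightarrow> 'a set \<Rightarrow> ('a \<Rightarrow> 'a) set \<Rightarrow> ('a \<Rightarrow> 'a) set"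
  where "bad p U W = {x. x permutes U \<and> (\<exists>g\<in>W. g \<noteq> id \<and> g ^^ p = id \<and> x \<circ> g \<circ> inv' x \<in> W)}"

definition cent_free :: "nat \<Rightarrow> 'a set \<Rightarrow> ('a \<Rightarrow> 'a) \<Rightarrow> ('a \<Rightarrow> 'a) set"
  where "cent_free p U g = {h \<in> cent U g. free_cyc p U h}"

text \<open>\<open>i\<close> and \<open>p\<close> are coprime, so by Bezout \<open>g\<close> is, at
  \<open>u\<close>, a combination of the periods \<open>i\<close> and \<open>p\<close>.\<close>

lemma prime_period_fixed:
  assumes "Factorial_Ring.prime (p::nat)" "(g ^^ p) u = u" "(g ^^ i) u = u" "0 < i" "i < p"
  shows "g u = u"
proof -
  have "coprime i p" using assms
    by (metis coprime_commute nat_dvd_not_less prime_imp_coprime_nat)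
  then obtain a b where ab: "i * a = p * b + 1" using bezout_nat[of i p] assms(4) by auto
  have *: "(g ^^ (n * j)) u = u" if "(g ^^ n) u = u" for n j
    using that by (induction j) (simp_all add: funpow_add)
  have "(g ^^ (1 + p * b)) u = u" using *[OF assms(3), of a] ab by (simp add: add.commute)
  then have "(g ^^ 1) ((g ^^ (p * b)) u) = u" by (simp only: funpow_funpow)
  then show ?thesis using *[OF assms(2), of b] by simp
qed

lemma free_cyc_support:
  assumes "Factorial_Ring.prime (p::nat)" "g ^^ p = id"
  shows "free_cyc p {u. g u \<noteq> u} g"
  unfolding free_cyc_def
proof (intro ballI conjI)
  fix u assume u: "u \<in> {u. g u \<noteq> u}"
  show "(g ^^ p) u = u" using assms by simp
  have "g (g u) \<noteq> g u"
  proof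
    assume f: "g (g u) = g u"
    then have "(g ^^ i) (g u) = g u" for i by (induction i) auto
    then have "(g ^^ (p - 1)) (g u) = g u" .
    moreover have "(g ^^ (p - 1)) (g u) = (g ^^ p) u"
      using prime_gt_0_nat[OF assms(1)] by (cases p) (auto simp: funpow_swap1)
    ultimately show False using assms(2) u by simp
  qed
  then show "g u \<in> {u. g u \<noteq> u}" by simp
  fix i assume "i \<in> {1..<p}"
  then show "(g ^^ i) u \<noteq> u" using prime_period_fixed[OF assms(1), of g u i] assms(2) u by auto
qed

lemma inj_on_restrict_id_pair:
  assumes "\<And>x. x \<in> Q \<Longrightarrow> x permutes U"
  shows "inj_on (\<lambda>x. (restrict_id x S, restrict_id x (U - S))) Q"
proof (rule inj_onI)
  fix x y assume xy: "x \<in> Q" "y \<in> Q"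
    "(restrict_id x S, restrict_id x (U - S)) = (restrict_id y S, restrict_id y (U - S))"
  show "x = y"
  proof
    fix u
    have "restrict_id x S u = restrict_id y S u" "restrict_id x (U - S) u = restrict_id y (U - S) u"
      using xy(3) by (auto simp: fun_eq_iff)
    then show "x u = y u"
      using assms[OF xy(1)] assms[OF xy(2)]
      by (auto simp: restrict_id_def permutes_not_in split: if_splits)
  qed
qed

lemma restrict_id_permutes:
  assumes "x permutes U" "x ` S = S"
  shows "restrict_id x S permutes S"
  using assms permutes_inj_on by (intro permutes_restrict_id) (auto simp: bij_betw_def)

lemma permutes_Diff_image:
  assumes "x permutes U" "x ` S = S"
  shows "x ` (U - S) = U - S"
  using assms by (metis image_set_diff permutes_image permutes_inj)

text \<open>Translation by the inverse of one element of \<open>Q\<close> embeds \<open>Q\<close>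
  into \<open>Y\<close>. This bounds sets of solutions, which are cosets, by the stabilizer or
  centralizer concerned.\<close>

lemma coset_card_le:
  assumes "finite U" "Q \<subseteq> {x. x permutes U}" "\<And>x y. x \<in> Q \<Longrightarrow> y \<in> Q \<Longrightarrow> inv' x \<circ> y \<in> Y" "finite Y"
  shows "card Q \<le> card Y"
proof (cases "Q = {}")
  case False
  then obtain x where x: "x \<in> Q" by auto
  then have "surj x" using assms(2) permutes_surj by blast
  then have "inj_on (\<lambda>y. inv' x \<circ> y) Q"
    by (auto intro!: inj_onI simp: fun_eq_iff) (metis surj_f_inv_f)
  moreover have "(\<lambda>y. inv' x \<circ> y) ` Q \<subseteq> Y" using assms(3)[OF x] by auto
  ultimately show ?thesis using assms(4) card_inj_on_le by blast
qed auto

text \<open>These permutations form at most one coset of the setwise stabilizer of \<open>S\<close>,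
  whose elements are determined by their restrictions to \<open>S\<close> and to its
  complement.\<close>

lemma card_map_set_le:
  assumes "finite U" "S \<subseteq> U"
  shows "card {x. x permutes U \<and> x ` S = S'} \<le> fact (card S) * fact (card U - card S)"
proof -
  let ?Y = "{x. x permutes U \<and> x ` S = S}"
  have "card {x. x permutes U \<and> x ` S = S'} \<le> card ?Y"
  proof (rule coset_card_le[OF assms(1)])
    fix x y assume xy: "x \<in> {x. x permutes U \<and> x ` S = S'}" "y \<in> {x. x permutes U \<and> x ` S = S'}"
    then have "(inv' x \<circ> y) ` S = inv' x ` (y ` S)" by (simp only: image_comp)
    also have "\<dots> = inv' x ` (x ` S)" using xy by simp
    also have "\<dots> = S" using xy by (simp only: image_comp) (simp add: inv_o_cancel[OF permutes_inj[of x U]])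
    finally have "(inv' x \<circ> y) ` S = S" .
    moreover have "inv' x \<circ> y permutes U" using xy by (auto intro!: permutes_compose permutes_inv)
    ultimately show "inv' x \<circ> y \<in> ?Y" by blast
  qed (use finite_permutations[OF assms(1)] in auto)
  also have "\<dots> \<le> card ({x. x permutes S} \<times> {x. x permutes (U - S)})"
  proof (rule card_inj_on_le[OF inj_on_restrict_id_pair[of _ U S]])
    show "(\<lambda>x. (restrict_id x S, restrict_id x (U - S))) ` ?Y \<subseteq> {x. x permutes S} \<times> {x. x permutes (U - S)}"
    proof (rule image_subsetI)
      fix x assume "x \<in> ?Y"
      then have x: "x permutes U" "x ` S = S" by auto
      show "(restrict_id x S, restrict_id x (U - S)) \<in> {x. x permutes S} \<times> {x. x permutes (U - S)}"
        using restrict_id_permutes[OF x] restrict_id_permutes[OF x(1) permutes_Diff_image[OF x]] by simp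
    qed
    show "finite ({x. x permutes S} \<times> {x. x permutes (U - S)})"
      using assms finite_subset by (auto intro!: finite_permutations)
  qed auto
  also have "\<dots> = fact (card S) * fact (card U - card S)"
    using assms by (simp add: card_cartesian_product card_permutations finite_subset card_Diff_subset)
  finally show ?thesis .
qed

text \<open>The solutions form at most one coset of the centralizer of \<open>g\<close>. Since
  \<open>V\<close> is the support of \<open>g\<close>, the centralizer preserves \<open>V\<close>
  and embeds into \<open>cent V g\<close> times the permutations of the remaining points.\<close>

lemma card_conjugators_le:
  assumes fin: "finite U" and sub: "V \<subseteq> U" and g: "g permutes V" "free_cyc p V g" "p \<ge> 2"
    and card: "card V = p * k"
  shows "card {x. x permutes U \<and> x \<circ> g = h \<circ> x} \<le> p ^ k * fact k * fact (card U - p * k)"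
proof -
  let ?Y = "{x. x permutes U \<and> x \<circ> g = g \<circ> x}"
  have supp: "g u \<noteq> u \<longleftrightarrow> u \<in> V" for u
    using g unfolding free_cyc_def
    by (metis One_nat_def atLeastLessThan_iff funpow_0 funpow_simps_right(2) le_refl
        less_le_trans one_less_numeral_iff permutes_not_in semiring_norm(76) comp_apply)
  have "card {x. x permutes U \<and> x \<circ> g = h \<circ> x} \<le> card ?Y"
  proof (rule coset_card_le[OF fin])
    fix x y assume x: "x \<in> {x. x permutes U \<and> x \<circ> g = h \<circ> x}"
      and y: "y \<in> {x. x permutes U \<and> x \<circ> g = h \<circ> x}"
    have "(inv' x \<circ> y \<circ> g) u = (g \<circ> (inv' x \<circ> y)) u" for u
    proof -
      have "x (g (inv' x (y u))) = h (y u)"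
        using x by (auto simp: fun_eq_iff permutes_inverses)
      also have "\<dots> = y (g u)" using y by (auto simp: fun_eq_iff)
      finally show ?thesis using x by (auto simp: permutes_inverses) (metis permutes_inverses(2))
    qed
    then show "inv' x \<circ> y \<in> ?Y" using x y by (auto simp: permutes_compose permutes_inv fun_eq_iff)
  qed (use finite_permutations[OF fin] in auto)
  also have "\<dots> \<le> card (cent V g \<times> {x. x permutes (U - V)})"
  proof (rule card_inj_on_le[OF inj_on_restrict_id_pair[of _ U V]])
    show "(\<lambda>x. (restrict_id x V, restrict_id x (U - V))) ` ?Y \<subseteq> cent V g \<times> {x. x permutes (U - V)}"
    proof (rule image_subsetI)
      fix x assume "x \<in> ?Y"
      then have x: "x permutes U" "\<And>u. x (g u) = g (x u)" by (auto simp: fun_eq_iff)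
      have iff: "x u \<in> V \<longleftrightarrow> u \<in> V" for u
        using supp[of u] supp[of "x u"] x(2)[of u] permutes_inj[OF x(1)] by (metis injD)
      have im: "x ` V = V"
      proof
        show "V \<subseteq> x ` V"
        proof
          fix v assume "v \<in> V"
          then have "inv' x v \<in> V" using iff[of "inv' x v"] permutes_inverses(1)[OF x(1)] by simp
          then show "v \<in> x ` V" using permutes_inverses(1)[OF x(1)] by (metis imageI)
        qed
      qed (use iff in auto)
      have "restrict_id x V \<in> cent V g"
        using restrict_id_permutes[OF x(1) im] x(2) permutes_in_image[OF g(1)]
        by (auto simp: cent_def)
      then show "(restrict_id x V, restrict_id x (U - V)) \<in> cent V g \<times> {x. x permutes (U - V)}"
        using restrict_id_permutes[OF x(1) permutes_Diff_image[OF x(1) im]] by auto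
    qed
    show "finite (cent V g \<times> {x. x permutes (U - V)})"
      using fin sub finite_subset by (auto intro!: finite_permutations finite_cent)
  qed auto
  also have "\<dots> = p ^ k * fact k * fact (card U - p * k)"
    using card_cent[OF g(2) _ finite_subset[OF sub fin] card] g(3) fin sub card
    by (simp add: card_cartesian_product card_permutations finite_subset card_Diff_subset)
  finally show ?thesis .
qed

lemma conj_funpow:
  assumes "x permutes U"
  shows "(x \<circ> g \<circ> inv' x) ^^ i = x \<circ> (g ^^ i) \<circ> inv' x"
proof (induction i)
  case 0
  then show ?case using permutes_inv_o(1)[OF assms] by (simp add: fun_eq_iff)
next
  case (Suc i)
  then show ?case using permutes_inverses[OF assms] by (auto simp: fun_eq_iff)
qed

lemma conj_support:
  assumes "x permutes U"
  shows "{u. (x \<circ> g \<circ> inv' x) u \<noteq> u} = x ` {u. g u \<noteq> u}"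
proof (intro equalityI subsetI)
  fix u assume "u \<in> {u. (x \<circ> g \<circ> inv' x) u \<noteq> u}"
  then have "g (inv' x u) \<noteq> inv' x u" using permutes_inverses[OF assms] by auto
  then show "u \<in> x ` {u. g u \<noteq> u}" by (auto intro!: image_eqI[of _ _ "inv' x u"] simp: permutes_inverses[OF assms])
next
  fix u assume "u \<in> x ` {u. g u \<noteq> u}"
  then show "u \<in> {u. (x \<circ> g \<circ> inv' x) u \<noteq> u}"
    using permutes_inverses[OF assms] permutes_inj[OF assms] by (auto simp: inj_eq)
qed

text \<open>Turns the study of common elements into a count of sets: the support of an element of
  the centralizer is a union of cycles of \<open>g\<close>.\<close>

lemma cent_support:
  assumes "c \<in> cent V g" "free_cyc p V g" "p > 0"
  shows "{u. c u \<noteq> u} \<subseteq> V" "\<forall>u\<in>{u. c u \<noteq> u}. g u \<in> {u. c u \<noteq> u}"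
proof -
  show sub: "{u. c u \<noteq> u} \<subseteq> V" using permutes_not_in[OF centD(1)[OF assms(1)]] by blast
  show "\<forall>u\<in>{u. c u \<noteq> u}. g u \<in> {u. c u \<noteq> u}"
  proof
    fix u assume u: "u \<in> {u. c u \<noteq> u}"
    then have uV: "u \<in> V" "c u \<in> V" using sub permutes_in_image[OF centD(1)[OF assms(1)]] by auto
    have "c (g u) = g (c u)" using centD(2)[OF assms(1) uV(1)] .
    moreover have "g (c u) \<noteq> g u"
    proof
      assume "g (c u) = g u"
      then have "(g ^^ (p - 1)) (g (c u)) = (g ^^ (p - 1)) (g u)" by simp
      moreover have "(g ^^ (p - 1)) (g v) = (g ^^ p) v" for v
        using assms(3) by (cases p) (auto simp: funpow_swap1)
      ultimately show False using assms(2) uV u by (auto simp: free_cyc_def)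
    qed
    ultimately show "g u \<in> {u. c u \<noteq> u}" by simp
  qed
qed

lemma cent_free_funpow:
  assumes p: "Factorial_Ring.prime (p::nat)" and h: "h \<in> cent_free p V g" and i: "i \<in> {1..<p}"
    and cl: "\<And>v. v \<in> V \<Longrightarrow> g v \<in> V"
  shows "h ^^ i \<in> cent_free p V g"
proof -
  have hc: "h \<in> cent V g" "free_cyc p V h" using h by (auto simp: cent_free_def)
  have "h ^^ i \<in> cent V g"
  proof (induction i)
    case 0 then show ?case using permutes_id[of V] by (simp add: cent_def id_def)
  next
    case (Suc i) then show ?case using cent_comp[OF hc(1) Suc] by (simp only: funpow.simps)
  qed
  moreover have "free_cyc p V (h ^^ i)"
    unfolding free_cyc_def
  proof (intro ballI conjI)
    fix u assume u: "u \<in> V"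
    show "(h ^^ i) u \<in> V" using free_cyc_funpow[OF hc(2) u] .
    show "((h ^^ i) ^^ p) u = u"
      using free_cyc_mod[OF hc(2) u, of "i * p"] by (simp add: funpow_mult)
    fix j assume j: "j \<in> {1..<p}"
    have "\<not> p dvd i * j"
      using p i j by (auto simp: prime_dvd_mult_iff dest: dvd_imp_le)
    then have "(i * j) mod p \<noteq> 0" by (simp add: dvd_eq_mod_eq_0)
    then have "(h ^^ (i * j)) u \<noteq> (h ^^ 0) u"
      using free_cyc_eq_iff[OF hc(2) u, of "i * j" 0] prime_gt_0_nat[OF p] by auto
    then show "((h ^^ i) ^^ j) u \<noteq> u" by (simp add: funpow_mult)
  qed
  ultimately show ?thesis by (simp add: cent_free_def)
qed

text \<open>Double counting of the pairs \<open>(x, g)\<close> for which both \<open>g\<close> and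
  its conjugate by \<open>x\<close> lie in \<open>cent_free p V \<gamma>\<close>. Every
  \<open>x\<close> in question has at least \<open>p - 1\<close> such \<open>g\<close>, the powers
  of one of them, while prescribing \<open>g\<close> and its conjugate leaves \<open>x\<close> in
  one coset of a centralizer.\<close>

lemma card_full_le:
  assumes fin: "finite U" and sub: "V \<subseteq> U" and fc: "free_cyc p V \<gamma>" and card: "card V = p * k"
    and p: "Factorial_Ring.prime (p::nat)" and k: "k > 0"
  shows "card {x. x permutes U \<and> (\<exists>g\<in>cent_free p V \<gamma>. x \<circ> g \<circ> inv' x \<in> cent_free p V \<gamma>)} * (p - 1)
    \<le> (card (cent_free p V \<gamma>))\<^sup>2 * (p ^ k * fact k * fact (card U - p * k))"
    (is "card ?F * _ \<le> _ * ?C")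
proof -
  let ?R = "cent_free p V \<gamma>"
  define A where "A x = {g \<in> ?R. x \<circ> g \<circ> inv' x \<in> ?R}" for x
  have p2: "p \<ge> 2" using p prime_ge_2_nat by blast
  have finV: "finite V" using fin sub finite_subset by blast
  have finR: "finite ?R" using finite_cent[OF finV] by (auto simp: cent_free_def)
  have cl: "\<And>v. v \<in> V \<Longrightarrow> \<gamma> v \<in> V" using fc by (auto simp: free_cyc_def)
  obtain a where a: "a \<in> V" using card k p2 by fastforce
  have "p - 1 \<le> card (A x)" if x: "x \<in> ?F" for x
  proof -
    obtain g where g: "g \<in> ?R" "x \<circ> g \<circ> inv' x \<in> ?R" using x by auto
    have "(\<lambda>i. g ^^ i) ` {1..<p} \<subseteq> A x"
      using cent_free_funpow[OF p g(1) _ cl] cent_free_funpow[OF p g(2) _ cl] x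
      by (auto simp: A_def conj_funpow simp flip: conj_funpow)
    moreover have "inj_on (\<lambda>i. g ^^ i) {1..<p}"
    proof (rule inj_onI)
      fix i j assume ij: "i \<in> {1..<p}" "j \<in> {1..<p}" "g ^^ i = g ^^ j"
      have "(g ^^ i) a = (g ^^ j) a" using ij by simp
      then show "i = j" using free_cyc_eq_iff[of p V g a i j] g(1) a ij by (auto simp: cent_free_def)
    qed
    moreover have "finite (A x)" using finR by (simp add: A_def)
    ultimately have "card {1..<p} \<le> card (A x)" using card_inj_on_le by blast
    then show ?thesis by simp
  qed
  then have "card ?F * (p - 1) \<le> (\<Sum>x\<in>?F. card (A x))"
    using sum_bounded_below[of ?F "p - 1" "\<lambda>x. card (A x)"] by simp
  also have "\<dots> = card (Sigma ?F A)"
    using finite_permutations[OF fin] finR by (subst card_SigmaI) (auto simp: A_def)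
  also have "\<dots> \<le> card (\<Union>g\<in>?R. \<Union>h\<in>?R. (\<lambda>x. (x, g)) ` {x. x permutes U \<and> x \<circ> g = h \<circ> x})"
  proof (rule card_mono)
    show "finite (\<Union>g\<in>?R. \<Union>h\<in>?R. (\<lambda>x. (x, g)) ` {x. x permutes U \<and> x \<circ> g = h \<circ> x})"
      using finite_permutations[OF fin] finR by auto
    show "Sigma ?F A \<subseteq> (\<Union>g\<in>?R. \<Union>h\<in>?R. (\<lambda>x. (x, g)) ` {x. x permutes U \<and> x \<circ> g = h \<circ> x})"
    proof
      fix y assume "y \<in> Sigma ?F A"
      then obtain x g where y: "y = (x, g)" "x permutes U" "g \<in> ?R" "x \<circ> g \<circ> inv' x \<in> ?R"
        by (auto simp: A_def)
      have "x \<circ> g = (x \<circ> g \<circ> inv' x) \<circ> x"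
        using permutes_inverses[OF y(2)] by (auto simp: fun_eq_iff)
      then show "y \<in> (\<Union>g\<in>?R. \<Union>h\<in>?R. (\<lambda>x. (x, g)) ` {x. x permutes U \<and> x \<circ> g = h \<circ> x})"
        using y by blast
    qed
  qed
  also have "\<dots> \<le> (\<Sum>g\<in>?R. card (\<Union>h\<in>?R. (\<lambda>x. (x, g)) ` {x. x permutes U \<and> x \<circ> g = h \<circ> x}))"
    by (rule card_UN_le[OF finR])
  also have "\<dots> \<le> (\<Sum>g\<in>?R. \<Sum>h\<in>?R. ?C)"
  proof (rule sum_mono)
    fix g assume g: "g \<in> ?R"
    have "card (\<Union>h\<in>?R. (\<lambda>x. (x, g)) ` {x. x permutes U \<and> x \<circ> g = h \<circ> x})
      \<le> (\<Sum>h\<in>?R. card ((\<lambda>x. (x, g)) ` {x. x permutes U \<and> x \<circ> g = h \<circ> x}))"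
      by (rule card_UN_le[OF finR])
    also have "\<dots> \<le> (\<Sum>h\<in>?R. ?C)"
    proof (rule sum_mono)
      fix h
      have "card ((\<lambda>x. (x, g)) ` {x. x permutes U \<and> x \<circ> g = h \<circ> x}) \<le> card {x. x permutes U \<and> x \<circ> g = h \<circ> x}"
        using finite_permutations[OF fin] by (intro card_image_le) auto
      also have "\<dots> \<le> ?C"
        using card_conjugators_le[OF fin sub _ _ p2 card] g by (auto simp: cent_free_def cent_def)
      finally show "card ((\<lambda>x. (x, g)) ` {x. x permutes U \<and> x \<circ> g = h \<circ> x}) \<le> ?C" .
    qed
    finally show "card (\<Union>h\<in>?R. (\<lambda>x. (x, g)) ` {x. x permutes U \<and> x \<circ> g = h \<circ> x}) \<le> (\<Sum>h\<in>?R. ?C)" .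
  qed
  also have "\<dots> = (card ?R)\<^sup>2 * ?C" by (simp add: power2_eq_square)
  finally show ?thesis .
qed

text \<open>In the term for \<open>l\<close>, the squared binomial bounds the choices of a union
  \<open>S\<close> of \<open>l\<close> cycles and of its image, the factorials count the
  permutations that map the one to the other.\<close>

definition mid_count :: "nat \<Rightarrow> nat \<Rightarrow> nat"
  where "mid_count p m = (\<Sum>l=1..<m div p. (m div p choose l)\<^sup>2 * fact (p * l) * fact (m - p * l))"

text \<open>A common element of order \<open>p\<close> moves a proper nonempty union of cycles of \<open>\<gamma>\<close>, which \<open>x\<close> maps to
  another such union (the sum \<open>mid_count\<close>), or it moves every point of \<open>V\<close>. In the second case all its
  \<open>p - 1\<close> nontrivial powers are common as well, which explains the division.\<close>

lemma card_bad_le: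
  assumes fin: "finite U" and sub: "V \<subseteq> U" and fc: "free_cyc p V \<gamma>" and card: "card V = p * (card U div p)"
    and p: "Factorial_Ring.prime (p::nat)" and k: "p \<le> card U"
  shows "card (bad p U (cent V \<gamma>)) \<le> mid_count p (card U) +
    ((card (cent_free p V \<gamma>))\<^sup>2 * (p ^ (card U div p) * fact (card U div p) * fact (card U mod p))) div (p - 1)"
proof -
  let ?R = "cent_free p V \<gamma>" and ?k = "card U div p" and ?m = "card U"
  define F where "F = {x. x permutes U \<and> (\<exists>g\<in>?R. x \<circ> g \<circ> inv' x \<in> ?R)}"
  define I where "I l = {S. S \<subseteq> V \<and> (\<forall>x\<in>S. \<gamma> x \<in> S) \<and> card S = p * l}" for l
  define Q where "Q l = (\<Union>S\<in>I l. \<Union>S'\<in>I l. {x. x permutes U \<and> x ` S = S'})" for l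
  have p2: "p \<ge> 2" using p prime_ge_2_nat by blast
  have finV: "finite V" using fin sub finite_subset by blast
  have finI: "finite (I l)" for l using finV by (auto simp: I_def intro: finite_subset[of _ "Pow V"])
  have cI: "card (I l) \<le> ?k choose l" for l
    using card_invariant_subsets[OF fc _ finV card, of l] p2 by (simp add: I_def)
  have "bad p U (cent V \<gamma>) \<subseteq> (\<Union>l\<in>{1..<?k}. Q l) \<union> F"
  proof
    fix x assume "x \<in> bad p U (cent V \<gamma>)"
    then obtain g where x: "x permutes U" and g: "g \<in> cent V \<gamma>" "g \<noteq> id" "g ^^ p = id"
      and hc0: "x \<circ> g \<circ> inv' x \<in> cent V \<gamma>" by (auto simp: bad_def)
    define h where "h = x \<circ> g \<circ> inv' x"
    then have hc: "h \<in> cent V \<gamma>" using hc0 by simp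
    let ?S = "{u. g u \<noteq> u}" and ?T = "{u. h u \<noteq> u}"
    have hp: "h ^^ p = id" using conj_funpow[OF x, where g = g and i = p] g(3) permutes_inv_o(1)[OF x]
      by (simp add: h_def)
    have T: "?T = x ` ?S" unfolding h_def by (rule conj_support[OF x])
    have fS: "finite ?S" using cent_support(1)[OF g(1) fc] p2 finV finite_subset by auto
    have "p dvd card ?S" using free_cyc_dvd_card[OF free_cyc_support[OF p g(3)] _ fS] p2 by auto
    then obtain l where l: "card ?S = p * l" by auto
    have "?S \<noteq> {}" using g(2) by (auto simp: fun_eq_iff)
    then have l1: "l \<ge> 1" using l fS by (cases l) auto
    have "card ?S \<le> card V" using cent_support(1)[OF g(1) fc] p2 finV by (intro card_mono) auto
    then have lk: "l \<le> ?k" using l card p2 by simp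
    have cT: "card ?T = p * l" using T l card_image[of x ?S] permutes_inj_on[OF x] by simp
    have SI: "?S \<in> I l" using cent_support[OF g(1) fc] p2 l by (auto simp: I_def)
    have TI: "?T \<in> I l" using cent_support[OF hc fc] p2 cT by (auto simp: I_def)
    show "x \<in> (\<Union>l\<in>{1..<?k}. Q l) \<union> F"
    proof (cases "l < ?k")
      case True
      then have "x \<in> Q l" using SI TI T x unfolding Q_def by blast
      then show ?thesis using True l1 by auto
    next
      case False
      then have "?S = V" "?T = V"
        using SI TI lk card finV card_subset_eq[of V] by (auto simp: I_def)
      then have "g \<in> ?R" "h \<in> ?R"
        using free_cyc_support[OF p g(3)] free_cyc_support[OF p hp] g(1) hc
        by (auto simp: cent_free_def)
      then show ?thesis using x by (auto simp: F_def h_def)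
    qed
  qed
  moreover have finF: "finite F" "finite (Q l)" for l
    using finite_permutations[OF fin] finI by (auto simp: F_def Q_def)
  ultimately have "card (bad p U (cent V \<gamma>)) \<le> card ((\<Union>l\<in>{1..<?k}. Q l) \<union> F)"
    by (intro card_mono) auto
  also have "\<dots> \<le> card (\<Union>l\<in>{1..<?k}. Q l) + card F" by (rule card_Un_le)
  also have "card (\<Union>l\<in>{1..<?k}. Q l) \<le> (\<Sum>l\<in>{1..<?k}. card (Q l))" by (rule card_UN_le) simp
  also have "\<dots> \<le> mid_count p ?m"
    unfolding mid_count_def
  proof (rule sum_mono)
    fix l
    let ?c = "fact (p * l) * fact (?m - p * l) :: nat"
    have "card (Q l) \<le> (\<Sum>S\<in>I l. card (\<Union>S'\<in>I l. {x. x permutes U \<and> x ` S = S'}))"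
      unfolding Q_def by (rule card_UN_le[OF finI])
    also have "\<dots> \<le> (\<Sum>S\<in>I l. \<Sum>S'\<in>I l. ?c)"
    proof (rule sum_mono)
      fix S assume S: "S \<in> I l"
      have "card (\<Union>S'\<in>I l. {x. x permutes U \<and> x ` S = S'}) \<le> (\<Sum>S'\<in>I l. card {x. x permutes U \<and> x ` S = S'})"
        by (rule card_UN_le[OF finI])
      also have "\<dots> \<le> (\<Sum>S'\<in>I l. ?c)"
        using card_map_set_le[OF fin, of S] S sub by (intro sum_mono) (auto simp: I_def)
      finally show "card (\<Union>S'\<in>I l. {x. x permutes U \<and> x ` S = S'}) \<le> (\<Sum>S'\<in>I l. ?c)" .
    qed
    also have "\<dots> = (card (I l))\<^sup>2 * ?c" by (simp add: power2_eq_square)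
    also have "\<dots> \<le> (?k choose l)\<^sup>2 * ?c" using cI[of l] by (intro mult_right_mono power_mono) auto
    finally show "card (Q l) \<le> (?k choose l)\<^sup>2 * fact (p * l) * fact (?m - p * l)"
      by (simp add: mult.assoc)
  qed
  also have "card F \<le> ((card ?R)\<^sup>2 * (p ^ ?k * fact ?k * fact (?m mod p))) div (p - 1)"
  proof -
    have k0: "?k > 0" using k p2 by (simp add: div_greater_zero_iff)
    have "?m - p * ?k = ?m mod p" by (simp add: minus_mult_div_eq_mod)
    then have "card F * (p - 1) \<le> (card ?R)\<^sup>2 * (p ^ ?k * fact ?k * fact (?m mod p))"
      using card_full_le[OF fin sub fc card p k0] by (simp add: F_def)
    then show ?thesis using p2 by (simp add: less_eq_div_iff_mult_less_eq)
  qed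
  finally show ?thesis by simp
qed

text \<open>Discarding only the identity is good enough for \<open>p \<ge> 5\<close>. For
  \<open>p = 3\<close> and \<open>m\<close> a multiple of 3 above 3 the resulting bound would exceed
  \<open>fact m\<close>, which is why the count is refined below.\<close>

lemma card_cent_free_less:
  assumes "free_cyc p V \<gamma>" "p \<ge> 2" "finite V" "card V = p * k" "k > 0"
  shows "card (cent_free p V \<gamma>) \<le> p ^ k * fact k - 1"
proof -
  obtain a where a: "a \<in> V" using assms by fastforce
  have "(id ^^ 1) a = a" by simp
  then have "id \<notin> cent_free p V \<gamma>" using a assms(2) by (auto simp: cent_free_def free_cyc_def)
  then have "cent_free p V \<gamma> \<subseteq> cent V \<gamma> - {id}" by (auto simp: cent_free_def)
  then have "card (cent_free p V \<gamma>) \<le> card (cent V \<gamma> - {id})"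
    using finite_cent[OF assms(3)] by (intro card_mono) auto
  moreover have "id \<in> cent V \<gamma>" by (auto simp: cent_def)
  ultimately show ?thesis using card_cent[OF assms(1) _ assms(3,4)] assms(2) by simp
qed

lemma orb_disjoint:
  assumes "free_cyc p V g" "a \<in> V" "u \<in> V" "p > 0" "u \<notin> orb g a"
  shows "orb g u \<inter> orb g a = {}"
proof -
  have "(g ^^ i) u \<notin> orb g a" for i
  proof (induction i)
    case (Suc i)
    then show ?case
      using orb_facts(5)[OF assms(1,2,4) free_cyc_funpow[OF assms(1,3), of i]] by auto
  qed (use assms in auto)
  then show ?thesis by (auto simp: orb_def)
qed

text \<open>The recursion step of the count below: elements that agree on the union \<open>T\<close>
  of cycles and preserve it are determined by what they do on the other cycles.\<close>

lemma card_cent_free_restrict: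
  assumes fc: "free_cyc p V \<gamma>" and p: "p > 0" and fin: "finite V" and T: "T \<subseteq> V" "\<And>u. u \<in> T \<Longrightarrow> \<gamma> u \<in> T"
    and D: "D \<subseteq> cent_free p V \<gamma>" "\<And>g u. g \<in> D \<Longrightarrow> u \<in> T \<Longrightarrow> g u \<in> T"
    and agree: "\<And>g h u. g \<in> D \<Longrightarrow> h \<in> D \<Longrightarrow> u \<in> T \<Longrightarrow> g u = h u"
  shows "card D \<le> card (cent_free p (V - T) \<gamma>)"
proof (rule card_inj_on_le)
  show "inj_on (\<lambda>g. restrict_id g (V - T)) D"
  proof (rule inj_onI)
    fix g h assume gh: "g \<in> D" "h \<in> D" "restrict_id g (V - T) = restrict_id h (V - T)"
    show "g = h"
    proof
      fix u
      have "g permutes V" "h permutes V" using gh D(1) by (auto simp: cent_free_def cent_def)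
      then show "g u = h u"
        using agree[OF gh(1,2), of u] fun_cong[OF gh(3), of u]
        by (auto simp: restrict_id_def permutes_not_in split: if_splits)
    qed
  qed
  show "(\<lambda>g. restrict_id g (V - T)) ` D \<subseteq> cent_free p (V - T) \<gamma>"
  proof (rule image_subsetI)
    fix g assume g: "g \<in> D"
    then have gc: "g \<in> cent V \<gamma>" "free_cyc p V g" using D(1) by (auto simp: cent_free_def)
    note gp = centD(1)[OF gc(1)]
    have "g ` T \<subseteq> T" using D(2)[OF g] by auto
    then have im: "g ` T = T"
      using permutes_inj_on[OF gp, of T] finite_subset[OF T(1) fin] by (simp add: endo_inj_surj)
    have fg: "free_cyc p (V - T) g" using free_cyc_Diff[OF gc(2) p T(1)] D(2)[OF g] by auto
    have f\<gamma>: "free_cyc p (V - T) \<gamma>" using free_cyc_Diff[OF fc p T(1)] T(2) by auto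
    have pow: "(restrict_id g (V - T) ^^ i) u = (g ^^ i) u" if "u \<in> V - T" for i u
      using free_cyc_funpow[OF fg that] by (induction i) auto
    have "free_cyc p (V - T) (restrict_id g (V - T))"
      using fg pow unfolding free_cyc_def by auto
    moreover have "restrict_id g (V - T) permutes (V - T)"
      by (rule restrict_id_permutes[OF gp permutes_Diff_image[OF gp im]])
    moreover have "restrict_id g (V - T) (\<gamma> u) = \<gamma> (restrict_id g (V - T) u)" if "u \<in> V - T" for u
      using that f\<gamma> gc(1) by (auto simp: free_cyc_def cent_def)
    ultimately show "restrict_id g (V - T) \<in> cent_free p (V - T) \<gamma>"
      by (auto simp: cent_free_def cent_def)
  qed
  show "finite (cent_free p (V - T) \<gamma>)"
    using finite_cent[of "V - T" \<gamma>] fin by (auto simp: cent_free_def)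
qed

text \<open>A fixed-point-free element of order three commuting with \<open>\<gamma>\<close> either preserves a given cycle of \<open>\<gamma>\<close>
  (two possibilities) or permutes it cyclically with two others (\<open>9 * k * (k - 1)\<close> possibilities).\<close>

fun free3_count :: "nat \<Rightarrow> nat" where
  "free3_count 0 = 1"
| "free3_count (Suc k) = 2 * free3_count k + 9 * k * (k - 1) * free3_count (k - 2)"

lemma card_cent_free_3_le:
  assumes "free_cyc 3 V \<gamma>" "finite V" "card V = 3 * k"
  shows "card (cent_free 3 V \<gamma>) \<le> free3_count k"
  using assms
proof (induction k arbitrary: V rule: less_induct)
  case (less k)
  show ?case
  proof (cases k)
    case 0
    then have "cent_free 3 V \<gamma> \<subseteq> {id}" using less.prems by (auto simp: cent_free_def cent_def)
    then have "card (cent_free 3 V \<gamma>) \<le> card {id :: 'a \<Rightarrow> 'a}" by (intro card_mono) auto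
    then show ?thesis using 0 by simp
  next
    case (Suc k')
    note fc = less.prems(1) and fin = less.prems(2)
    obtain a where a: "a \<in> V" using less.prems(3) Suc by fastforce
    let ?R = "cent_free 3 V \<gamma>"
    note o = orb_facts[OF fc a]
    have cl: "\<And>v. v \<in> V \<Longrightarrow> \<gamma> v \<in> V" using fc by (auto simp: free_cyc_def)
    \<comment> \<open>\<open>A\<close> collects the elements that keep the cycle of
      \<open>a\<close>, \<open>B\<close> those that move it through two further cycles. The members
      of one such set agree on the cycles involved, so only \<open>k'\<close> or
      \<open>k' - 2\<close> cycles remain free.\<close>
    define A where "A u = {g \<in> ?R. g a = u}" for u
    define B where "B u w = {g \<in> ?R. g a = u \<and> g u = w}" for u w
    let ?V2 = "\<lambda>u. V - orb \<gamma> a - orb \<gamma> u"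
    have fcV: "free_cyc 3 (V - orb \<gamma> a) \<gamma>" using free_cyc_Diff[OF fc _ o(1)] o(4) by auto
    have cV: "card (V - orb \<gamma> a) = 3 * k'"
      using less.prems(3) Suc card_Diff_subset[OF finite_subset[OF o(1) fin] o(1)] o(3) by simp
    have aux: "g ((\<gamma> ^^ i) v) = (\<gamma> ^^ i) (g v)" if "g \<in> ?R" "v \<in> V" for g v i
      using cent_funpow[of g V \<gamma> v i] that cl by (auto simp: cent_free_def)
    have cA: "card (A u) \<le> free3_count k'" if u: "u \<in> orb \<gamma> a" for u
    proof -
      have "card (A u) \<le> card (cent_free 3 (V - orb \<gamma> a) \<gamma>)"
      proof (rule card_cent_free_restrict[OF fc _ fin o(1)])
        fix g v assume g: "g \<in> A u" and "v \<in> orb \<gamma> a"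
        then obtain i where i: "v = (\<gamma> ^^ i) a" by (auto simp: orb_def)
        have "g v = (\<gamma> ^^ i) u" using aux[of g a i] a g i by (simp add: A_def)
        moreover have "(\<gamma> ^^ i) u \<in> orb \<gamma> a" using u o(4) by (induction i) auto
        ultimately show "g v \<in> orb \<gamma> a" by simp
      next
        fix g h v assume g: "g \<in> A u" "h \<in> A u" and "v \<in> orb \<gamma> a"
        then obtain i where i: "v = (\<gamma> ^^ i) a" by (auto simp: orb_def)
        show "g v = h v" using aux[of g a i] aux[of h a i] a g i by (simp add: A_def)
      qed (use o(4) in \<open>auto simp: A_def\<close>)
      also have "\<dots> \<le> free3_count k'" using less.IH[of k' "V - orb \<gamma> a"] Suc fcV fin cV by simp
      finally show ?thesis .
    qed
    have cB: "card (B u w) \<le> free3_count (k' - 2)" and k2: "k' \<ge> 2"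
      if u: "u \<in> V - orb \<gamma> a" and w: "w \<in> ?V2 u" for u w
    proof -
      have uV: "u \<in> V" and wV: "w \<in> V" using u w by auto
      note ou = orb_facts[OF fc uV] and ow = orb_facts[OF fc wV]
      let ?T = "orb \<gamma> a \<union> orb \<gamma> u \<union> orb \<gamma> w"
      have T: "?T \<subseteq> V" using o(1) ou(1) ow(1) by auto
      have Tc: "\<And>v. v \<in> ?T \<Longrightarrow> \<gamma> v \<in> ?T" using o(4) ou(4) ow(4) by auto
      have d: "orb \<gamma> u \<inter> orb \<gamma> a = {}" "orb \<gamma> w \<inter> orb \<gamma> a = {}" "orb \<gamma> w \<inter> orb \<gamma> u = {}"
        using orb_disjoint[OF fc a uV] orb_disjoint[OF fc a wV] orb_disjoint[OF fc uV wV] u w by auto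
      have fo: "finite (orb \<gamma> a)" "finite (orb \<gamma> u)" "finite (orb \<gamma> w)"
        using o(1) ou(1) ow(1) fin finite_subset by auto
      have cT: "card ?T = 9"
      proof -
        have "card (orb \<gamma> a \<union> orb \<gamma> u) = 6"
          using card_Un_disjoint[OF fo(1,2)] d(1) o(3) ou(3) by (simp add: Int_commute)
        moreover have "(orb \<gamma> a \<union> orb \<gamma> u) \<inter> orb \<gamma> w = {}" using d by auto
        ultimately show ?thesis using card_Un_disjoint[of "orb \<gamma> a \<union> orb \<gamma> u" "orb \<gamma> w"] fo ow(3) by simp
      qed
      have "card ?T \<le> card V" using T fin by (intro card_mono)
      then show "k' \<ge> 2" using cT less.prems(3) Suc by simp
      have "card (B u w) \<le> card (cent_free 3 (V - ?T) \<gamma>)"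
      proof (rule card_cent_free_restrict[OF fc _ fin T Tc])
        have *: "g ((\<gamma> ^^ i) a) = (\<gamma> ^^ i) u" "g ((\<gamma> ^^ i) u) = (\<gamma> ^^ i) w"
          "g ((\<gamma> ^^ i) w) = (\<gamma> ^^ i) a" if g: "g \<in> B u w" for g i
        proof -
          have gR: "g \<in> ?R" "g a = u" "g u = w" using g by (auto simp: B_def)
          have "(g ^^ 3) a = a" using gR(1) a by (auto simp: cent_free_def free_cyc_def)
          then have "g w = a" using gR by (simp add: numeral_3_eq_3)
          then show "g ((\<gamma> ^^ i) a) = (\<gamma> ^^ i) u" "g ((\<gamma> ^^ i) u) = (\<gamma> ^^ i) w"
            "g ((\<gamma> ^^ i) w) = (\<gamma> ^^ i) a"
            using aux[OF gR(1)] a uV wV gR by auto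
        qed
        show "g v \<in> ?T" if "g \<in> B u w" "v \<in> ?T" for g v
          using *[OF that(1)] that(2) by (auto simp: orb_def)
        show "g v = h v" if "g \<in> B u w" "h \<in> B u w" "v \<in> ?T" for g h v
          using *[OF that(1)] *[OF that(2)] that(3) by (auto simp: orb_def)
      qed (auto simp: B_def)
      also have "\<dots> \<le> free3_count (k' - 2)"
      proof (rule less.IH)
        show "k' - 2 < k" using Suc by simp
        show "free_cyc 3 (V - ?T) \<gamma>" using free_cyc_Diff[OF fc _ T] Tc by auto
        show "card (V - ?T) = 3 * (k' - 2)"
          using card_Diff_subset[OF finite_subset[OF T fin] T] cT less.prems(3) Suc by simp
      qed (use fin in auto)
      finally show "card (B u w) \<le> free3_count (k' - 2)" .
    qed
    have cov: "?R \<subseteq> (\<Union>u\<in>{\<gamma> a, \<gamma> (\<gamma> a)}. A u) \<union> (\<Union>u\<in>V - orb \<gamma> a. \<Union>w\<in>?V2 u. B u w)"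
    proof
      fix g assume g: "g \<in> ?R"
      then have gc: "g permutes V" "free_cyc 3 V g" by (auto simp: cent_free_def cent_def)
      have ga: "g a \<noteq> a" using gc(2) a unfolding free_cyc_def by (auto dest!: bspec[of _ _ a] bspec[of _ _ 1])
      show "g \<in> (\<Union>u\<in>{\<gamma> a, \<gamma> (\<gamma> a)}. A u) \<union> (\<Union>u\<in>V - orb \<gamma> a. \<Union>w\<in>?V2 u. B u w)"
      proof (cases "g a \<in> orb \<gamma> a")
        case True
        then obtain i where "g a = (\<gamma> ^^ i) a" by (auto simp: orb_def)
        then have i: "g a = (\<gamma> ^^ (i mod 3)) a" using free_cyc_mod[OF fc a, of i] by simp
        have "i mod 3 \<in> {0, 1, 2}" by auto
        then have "g a \<in> {\<gamma> a, \<gamma> (\<gamma> a)}" using i ga by (auto simp: numeral_2_eq_2)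
        then show ?thesis using g by (auto simp: A_def)
      next
        case False
        let ?u = "g a" let ?w = "g ?u"
        have uV: "?u \<in> V" "?w \<in> V" using a permutes_in_image[OF gc(1)] by auto
        have g3: "g ?w = a" using gc(2) a by (auto simp: free_cyc_def numeral_3_eq_3)
        have "?w \<notin> orb \<gamma> a"
        proof
          assume "?w \<in> orb \<gamma> a"
          then obtain i where i: "?w = (\<gamma> ^^ i) a" by (auto simp: orb_def)
          then have "a = (\<gamma> ^^ i) ?u" using aux[OF g a, of i] g3 by simp
          then have "a \<in> orb \<gamma> ?u" unfolding orb_def by blast
          then show False using orb_disjoint[OF fc a uV(1) _ False] o(2) by auto
        qed
        moreover have "?w \<notin> orb \<gamma> ?u"
        proof
          assume "?w \<in> orb \<gamma> ?u"
          then obtain i where i: "?w = (\<gamma> ^^ i) ?u" by (auto simp: orb_def)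
          then have "g ?u = g ((\<gamma> ^^ i) a)" using aux[OF g a, of i] by simp
          then have "?u = (\<gamma> ^^ i) a" using permutes_inj[OF gc(1)] by (auto dest: injD)
          then show False using False by (auto simp: orb_def)
        qed
        ultimately show ?thesis using False uV g by (auto simp: B_def)
      qed
    qed
    have finR: "finite ?R" using finite_cent[OF fin] by (auto simp: cent_free_def)
    have "card ?R \<le> card ((\<Union>u\<in>{\<gamma> a, \<gamma> (\<gamma> a)}. A u) \<union> (\<Union>u\<in>V - orb \<gamma> a. \<Union>w\<in>?V2 u. B u w))"
      using cov finR fin by (intro card_mono) (auto simp: A_def B_def)
    also have "\<dots> \<le> card (\<Union>u\<in>{\<gamma> a, \<gamma> (\<gamma> a)}. A u) + card (\<Union>u\<in>V - orb \<gamma> a. \<Union>w\<in>?V2 u. B u w)"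
      by (rule card_Un_le)
    also have "card (\<Union>u\<in>{\<gamma> a, \<gamma> (\<gamma> a)}. A u) \<le> 2 * free3_count k'"
    proof -
      have "card (\<Union>u\<in>{\<gamma> a, \<gamma> (\<gamma> a)}. A u) \<le> (\<Sum>u\<in>{\<gamma> a, \<gamma> (\<gamma> a)}. card (A u))"
        by (rule card_UN_le) simp
      also have "\<dots> \<le> (\<Sum>u\<in>{\<gamma> a, \<gamma> (\<gamma> a)}. free3_count k')"
        using cA o(2,4) by (intro sum_mono) auto
      also have "\<dots> \<le> 2 * free3_count k'" by (simp add: card_insert_if)
      finally show ?thesis .
    qed
    \<comment> \<open>There are \<open>3 * k'\<close> points \<open>u\<close> off the cycle of
      \<open>a\<close>, and then \<open>3 * (k' - 1)\<close> points \<open>w\<close> off both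
      cycles.\<close>
    also have "card (\<Union>u\<in>V - orb \<gamma> a. \<Union>w\<in>?V2 u. B u w) \<le> 9 * k' * (k' - 1) * free3_count (k' - 2)"
    proof -
      have "card (\<Union>u\<in>V - orb \<gamma> a. \<Union>w\<in>?V2 u. B u w) \<le> (\<Sum>u\<in>V - orb \<gamma> a. card (\<Union>w\<in>?V2 u. B u w))"
        using fin by (intro card_UN_le) auto
      also have "\<dots> \<le> (\<Sum>u\<in>V - orb \<gamma> a. 3 * (k' - 1) * free3_count (k' - 2))"
      proof (rule sum_mono)
        fix u assume u: "u \<in> V - orb \<gamma> a"
        have uV: "u \<in> V" using u by auto
        have ou: "orb \<gamma> u \<subseteq> V - orb \<gamma> a"
          using orb_facts(1)[OF fc uV] orb_disjoint[OF fc a uV] u by auto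
        then have c2: "card (?V2 u) = 3 * (k' - 1)"
          using card_Diff_subset[OF _ ou] fin cV orb_facts(3)[OF fc uV] finite_subset[OF ou] by simp
        have "card (\<Union>w\<in>?V2 u. B u w) \<le> (\<Sum>w\<in>?V2 u. card (B u w))"
          using fin by (intro card_UN_le) auto
        also have "\<dots> \<le> (\<Sum>w\<in>?V2 u. free3_count (k' - 2))" using cB[OF u] by (intro sum_mono) auto
        also have "\<dots> = 3 * (k' - 1) * free3_count (k' - 2)" using c2 by simp
        finally show "card (\<Union>w\<in>?V2 u. B u w) \<le> 3 * (k' - 1) * free3_count (k' - 2)" .
      qed
      also have "\<dots> = 9 * k' * (k' - 1) * free3_count (k' - 2)" using cV by simp
      finally show ?thesis .
    qed
    finally show ?thesis using Suc by simp
  qed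
qed

section \<open>Standard overgroups of Sylow subgroups\<close>

text \<open>The product of the cycles on consecutive blocks of \<open>p\<close> numbers, starting at
  1: a multiple of \<open>p\<close> ends its block and returns to the block's first point.\<close>

definition std_cyc :: "nat \<Rightarrow> nat \<Rightarrow> nat"
  where "std_cyc p i = (if p dvd i then i + 1 - p else i + 1)"

lemma std_cyc_funpow:
  assumes "r < p"
  shows "(std_cyc p ^^ j) (p * q + r + 1) = p * q + (r + j) mod p + 1"
proof (induction j)
  case (Suc j)
  let ?s = "(r + j) mod p"
  have s: "?s < p" using assms by simp
  show ?case
  proof (cases "?s + 1 = p")
    case True
    then have "p * q + ?s + 1 = p * (q + 1)" by simp
    then have "p dvd p * q + ?s + 1" by (metis dvd_triv_left)
    moreover have "(r + Suc j) mod p = 0" using True by (simp add: mod_Suc)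
    ultimately show ?thesis using Suc True by (simp add: std_cyc_def)
  next
    case False
    then have "?s + 1 < p" using s by simp
    then have "\<not> p dvd p * q + (?s + 1)"
      by (subst dvd_add_right_iff) (auto dest: dvd_imp_le)
    moreover have "(r + Suc j) mod p = ?s + 1" using False by (simp add: mod_Suc)
    ultimately show ?thesis using Suc by (simp add: std_cyc_def)
  qed
qed (use assms in simp)

lemma free_cyc_std_cyc: "free_cyc p {1..p * k} (std_cyc p)"
  unfolding free_cyc_def
proof (intro ballI)
  fix u assume u: "u \<in> {1..p * k}"
  then have p: "p > 0" by (cases p) auto
  define q r where "q = (u - 1) div p" and "r = (u - 1) mod p"
  have u': "u = p * q + r + 1" and r: "r < p"
    using u p by (auto simp: q_def r_def)
  have "u \<le> p * k" using u by simp
  then have "p * q < p * k" using u' by linarith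
  then have "q < k" by simp
  then have "p * q + p \<le> p * k" by (metis Suc_leI mult_Suc_right add.commute mult_le_mono2)
  have *: "(std_cyc p ^^ j) u = p * q + (r + j) mod p + 1" for j
    using std_cyc_funpow[OF r] u' by simp
  have "std_cyc p u = p * q + (r + 1) mod p + 1" using *[of 1] by simp
  moreover have "(r + 1) mod p < p" using p by simp
  ultimately have "std_cyc p u \<in> {1..p * k}" using \<open>p * q + p \<le> p * k\<close> by simp
  moreover have "(std_cyc p ^^ p) u = u" using * u' r by simp
  moreover have "(std_cyc p ^^ i) u \<noteq> u" if "i \<in> {1..<p}" for i
  proof
    assume "(std_cyc p ^^ i) u = u"
    then have "(r + i) mod p = r" using * u' by simp
    then have "(r + i) mod p = (r + 0) mod p" using r by simp
    then have "p dvd i" by (metis add_diff_cancel_left' add.right_neutral le_add1 mod_eq_dvd_iff_nat)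
    then show False using that by (auto dest: dvd_imp_le)
  qed
  ultimately show "std_cyc p u \<in> {1..p * k} \<and> (std_cyc p ^^ p) u = u \<and>
      (\<forall>i\<in>{1..<p}. (std_cyc p ^^ i) u \<noteq> u)" by auto
qed

text \<open>For \<open>k = m div p\<close> this is the wreath product of a cyclic group of order \<open>p\<close> with the symmetric group on
  \<open>k\<close> points. Its index in the symmetric group is prime to \<open>p\<close>, also for \<open>p = 2\<close>.\<close>

definition std_cent :: "nat \<Rightarrow> nat \<Rightarrow> (nat \<Rightarrow> nat) set"
  where "std_cent p m = cent {1..p * (m div p)} (std_cyc p)"

lemma subgroup_cent:
  assumes "free_cyc p {1..n} g" "n \<le> m"
  shows "subgroup (cent {1..n} g) (sym_group m)"
proof (rule subgroup_sym_groupI)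
  show "w permutes {1..m}" if "w \<in> cent {1..n} g" for w
    using permutes_subset[OF centD(1)[OF that], of "{1..m}"] assms(2) by auto
  show "id \<in> cent {1..n} g" by (auto simp: cent_def)
  show "inv' w \<in> cent {1..n} g" if "w \<in> cent {1..n} g" for w
    using cent_inv[OF that] assms(1) by (auto simp: free_cyc_def)
qed (rule cent_comp)

lemma std_cent_index:
  assumes "Factorial_Ring.prime (p::nat)"
  shows "subgroup (std_cent p m) (sym_group m)" "\<not> p dvd fact m div card (std_cent p m)"
proof -
  show "subgroup (std_cent p m) (sym_group m)"
    unfolding std_cent_def by (rule subgroup_cent[OF free_cyc_std_cyc]) simp
  have p: "p > 0" using assms prime_gt_0_nat by blast
  have "card (std_cent p m) = p ^ (m div p) * fact (m div p)"
    unfolding std_cent_def using card_cent[OF free_cyc_std_cyc p, of "m div p"] by simp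
  moreover obtain q where "fact m = p ^ (m div p) * fact (m div p) * q" "\<not> p dvd q"
    using fact_prime_part[OF assms] by blast
  ultimately show "\<not> p dvd fact m div card (std_cent p m)" using p by simp
qed

lemma card_bad_odd_le:
  assumes "Factorial_Ring.prime (p::nat)" "p \<le> m"
  shows "card (bad p {1..m} (std_cent p m)) \<le> mid_count p m +
    ((p ^ (m div p) * fact (m div p) - 1)\<^sup>2 * (p ^ (m div p) * fact (m div p) * fact (m mod p))) div (p - 1)"
proof -
  let ?k = "m div p" let ?V = "{1..p * ?k}"
  have p2: "p \<ge> 2" using assms prime_ge_2_nat by blast
  have "card (bad p {1..m} (std_cent p m)) \<le> mid_count p m +
    ((card (cent_free p ?V (std_cyc p)))\<^sup>2 * (p ^ ?k * fact ?k * fact (m mod p))) div (p - 1)"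
    using card_bad_le[OF _ _ free_cyc_std_cyc, of "{1..m}" p ?k] assms
    by (simp add: std_cent_def)
  also have "\<dots> \<le> mid_count p m +
    ((p ^ ?k * fact ?k - 1)\<^sup>2 * (p ^ ?k * fact ?k * fact (m mod p))) div (p - 1)"
    using card_cent_free_less[OF free_cyc_std_cyc p2, of ?k] assms p2
    by (intro add_mono div_le_mono mult_right_mono power_mono order.refl)
       (auto simp: div_greater_zero_iff)
  finally show ?thesis .
qed

lemma card_bad_3_le:
  assumes "3 \<le> m"
  shows "card (bad 3 {1..m} (std_cent 3 m)) \<le> mid_count 3 m +
    ((free3_count (m div 3))\<^sup>2 * (3 ^ (m div 3) * fact (m div 3) * fact (m mod 3))) div 2"
proof -
  let ?k = "m div 3" let ?V = "{1..3 * ?k}"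
  have "card (bad 3 {1..m} (std_cent 3 m)) \<le> mid_count 3 m +
    ((card (cent_free 3 ?V (std_cyc 3)))\<^sup>2 * (3 ^ ?k * fact ?k * fact (m mod 3))) div (3 - 1)"
    using card_bad_le[OF _ _ free_cyc_std_cyc, of "{1..m}" 3 ?k] assms
    by (simp add: std_cent_def)
  also have "\<dots> \<le> mid_count 3 m + ((free3_count ?k)\<^sup>2 * (3 ^ ?k * fact ?k * fact (m mod 3))) div (3 - 1)"
    using card_cent_free_3_le[OF free_cyc_std_cyc, of ?k]
    by (intro add_mono div_le_mono mult_right_mono power_mono order.refl) auto
  finally show ?thesis by simp
qed

section \<open>Even and odd elements of the bad sets\<close>

text \<open>Left multiplication by the odd \<open>t\<close> embeds the even elements into the odd
  ones and conversely.\<close>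

lemma card_even_half:
  assumes fin: "finite B" and perm: "\<And>x. x \<in> B \<Longrightarrow> permutation x"
    and t: "permutation t" "\<not> evenperm t" and cl: "\<And>x. x \<in> B \<Longrightarrow> t \<circ> x \<in> B"
  shows "2 * card {x \<in> B. evenperm x} = card B"
proof -
  let ?E = "{x \<in> B. evenperm x}" and ?O = "{x \<in> B. \<not> evenperm x}"
  have inj: "inj_on ((\<circ>) t) B"
    using bij_is_inj[OF permutation_bijective[OF t(1)]] by (auto intro!: inj_onI simp: fun_eq_iff inj_eq)
  have "card ?E \<le> card ?O"
    using perm cl fin t by (intro card_inj_on_le[of "(\<circ>) t"] inj_on_subset[OF inj]) (auto simp: evenperm_comp)
  moreover have "card ?O \<le> card ?E"
    using perm cl fin t by (intro card_inj_on_le[of "(\<circ>) t"] inj_on_subset[OF inj]) (auto simp: evenperm_comp)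
  moreover have "card B = card ?E + card ?O"
    using fin by (subst card_Un_disjoint[symmetric]) (auto intro!: arg_cong[of _ _ card])
  ultimately show ?thesis by simp
qed

text \<open>Conjugation by \<open>t \<circ> x\<close> is conjugation by \<open>x\<close> followed by
  conjugation by \<open>t\<close>, which preserves \<open>W\<close>. With an odd \<open>t\<close>
  the bad set splits evenly.\<close>

lemma bad_normalizer:
  assumes t: "t permutes U" and n: "\<And>w. w \<in> W \<Longrightarrow> t \<circ> w \<circ> inv' t \<in> W" and x: "x \<in> bad p U W"
  shows "t \<circ> x \<in> bad p U W"
proof -
  from x obtain g where g: "x permutes U" "g \<in> W" "g \<noteq> id" "g ^^ p = id" "x \<circ> g \<circ> inv' x \<in> W"
    by (auto simp: bad_def)
  have "inv' (t \<circ> x) = inv' x \<circ> inv' t"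
    using t g(1) by (simp add: o_inv_distrib permutes_bij)
  then have "t \<circ> x \<circ> g \<circ> inv' (t \<circ> x) = t \<circ> (x \<circ> g \<circ> inv' x) \<circ> inv' t" by (simp add: comp_assoc)
  moreover have "t \<circ> (x \<circ> g \<circ> inv' x) \<circ> inv' t \<in> W" by (rule n[OF g(5)])
  ultimately have "t \<circ> x \<circ> g \<circ> inv' (t \<circ> x) \<in> W" by metis
  then show ?thesis using g(2-4) permutes_compose[OF g(1) t] unfolding bad_def by blast
qed

lemma finite_bad: "finite U \<Longrightarrow> finite (bad p U W)"
  using finite_permutations[of U] by (auto simp: bad_def)

lemma card_even_bad:
  assumes "finite U" "t permutes U" "\<not> evenperm t" "\<And>w. w \<in> W \<Longrightarrow> t \<circ> w \<circ> inv' t \<in> W"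
  shows "2 * card {x \<in> bad p U W. evenperm x} = card (bad p U W)"
  using assms
  by (intro card_even_half[of _ t] bad_normalizer finite_bad)
     (auto simp: bad_def permutes_imp_permutation)

text \<open>For \<open>m < 6\<close> there is a single 3-cycle, and a transposition inverts it, so
  it normalizes the group generated. From \<open>m = 6\<close> on, exchanging the first two 3-cycles
  is a product of three transpositions, an odd element of the centralizer itself.\<close>

lemma std_cent_3_odd_normalizer:
  assumes "3 \<le> m"
  shows "\<exists>t. t permutes {1..m} \<and> \<not> evenperm t \<and> (\<forall>w\<in>std_cent 3 m. t \<circ> w \<circ> inv' t \<in> std_cent 3 m)"
proof (cases "m < 6")
  case True
  then have md: "m div 3 = 1" using assms by auto
  let ?t = "transpose 1 (2::nat)"
  have "?t \<circ> w \<circ> inv' ?t \<in> cent {1..3} (std_cyc 3)" if w: "w \<in> cent {1..3} (std_cyc 3)" for w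
  proof -
    have wp: "w permutes {1..3}" using centD(1)[OF w] .
    have tp: "?t permutes {1..3}" by (rule permutes_swap_id) auto
    have U: "{1..3::nat} = {1, 2, 3}" by auto
    let ?g = "std_cyc 3"
    have gU: "?g u \<in> {1..3}" if "u \<in> {1..3}" for u
      using that unfolding U by (elim insertE emptyE) (simp_all add: std_cyc_def)
    have tU: "?t u \<in> {1..3}" if "u \<in> {1..3}" for u using that by (auto simp: U transpose_def)
    have wU: "w u \<in> {1..3}" if "u \<in> {1..3}" for u using that permutes_in_image[OF wp] by blast
    have wg: "w (?g u) = ?g (w u)" if "u \<in> {1..3}" for u using centD(2)[OF w that] .
    \<comment> \<open>Conjugation by \<open>?t\<close> inverts the 3-cycle, that is, it replaces
      \<open>?g\<close> by its square.\<close>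
    have tg: "?t (?g u) = ?g (?g (?t u))" "?t (?g (?g u)) = ?g (?t u)" if "u \<in> {1..3}" for u
    proof -
      have g: "?g 1 = 2" "?g 2 = 3" "?g 3 = 1" by (simp_all add: std_cyc_def)
      have t: "?t 1 = 2" "?t 2 = 1" "?t 3 = 3" by (simp_all add: transpose_def)
      have "u = 1 \<or> u = 2 \<or> u = 3" using that by auto
      then show "?t (?g u) = ?g (?g (?t u))" "?t (?g (?g u)) = ?g (?t u)"
        by (elim disjE; simp only: g t)+
    qed
    have "(?t \<circ> w \<circ> ?t) (?g u) = ?g ((?t \<circ> w \<circ> ?t) u)" if u: "u \<in> {1..3}" for u
    proof -
      have "w (?t (?g u)) = ?g (?g (w (?t u)))" using u wg gU tU tg(1) by simp
      then show ?thesis using u tg(2)[OF wU[OF tU[OF u]]] by simp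
    qed
    then show ?thesis
      using permutes_compose[OF permutes_compose[OF tp wp] tp] by (simp add: cent_def comp_assoc)
  qed
  moreover have "?t permutes {1..m}" using assms by (intro permutes_swap_id) auto
  moreover have "\<not> evenperm ?t" by (simp add: evenperm_swap)
  ultimately show ?thesis unfolding std_cent_def md by (intro exI[of _ ?t]) simp
next
  case False
  let ?t = "transpose 1 4 \<circ> transpose 2 5 \<circ> transpose 3 (6::nat)"
  let ?V = "{1..3 * (m div 3)}"
  have six: "6 \<le> 3 * (m div 3)" using False by presburger
  have tp: "?t permutes ?V" using six by (intro permutes_compose permutes_swap_id) auto
  have t: "?t u = (if u \<in> {1,2,3} then u + 3 else if u \<in> {4,5,6} then u - 3 else u)" for u
    by (auto simp: transpose_def)
  have comm: "?t (std_cyc 3 u) = std_cyc 3 (?t u)" if uV: "u \<in> ?V" for u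
  proof -
    consider "u \<in> {1,2,3,4,5,6}" | "u > 6" using uV by fastforce
    then show ?thesis
    proof cases
      case 1
      then show ?thesis unfolding t by (auto simp: std_cyc_def)
    next
      case 2
      then have "std_cyc 3 u > 6" by (auto simp: std_cyc_def elim!: dvdE)
      then show ?thesis using 2 unfolding t by auto
    qed
  qed
  have tc: "?t \<in> std_cent 3 m" using tp comm unfolding std_cent_def cent_def by blast
  have "?t permutes {1..m}" using permutes_subset[OF tp, of "{1..m}"] by auto
  moreover have "\<not> evenperm ?t"
    by (simp add: evenperm_comp permutation_compose permutation_swap_id evenperm_swap)
  moreover have "?t \<circ> w \<circ> inv' ?t \<in> std_cent 3 m" if "w \<in> std_cent 3 m" for w
  proof -
    have "subgroup (std_cent 3 m) (sym_group m)" using std_cent_index(1)[of 3 m] by simp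
    then show ?thesis using subgroup_sym_groupD(3,4)[of "std_cent 3 m" m] tc that by blast
  qed
  ultimately show ?thesis by blast
qed

lemma card_even_bad_3:
  assumes "3 \<le> m"
  shows "2 * card {x \<in> bad 3 {1..m} (std_cent 3 m). evenperm x} = card (bad 3 {1..m} (std_cent 3 m))"
proof -
  obtain t where "t permutes {1..m}" "\<not> evenperm t" "\<forall>w\<in>std_cent 3 m. t \<circ> w \<circ> inv' t \<in> std_cent 3 m"
    using std_cent_3_odd_normalizer[OF assms] by blast
  then show ?thesis by (intro card_even_bad[of _ t]) auto
qed

text \<open>An element of order 3 in the centralizer cannot exchange the two 3-cycles, so its own
  cycles are among the blocks \<open>{1,2,3}\<close> and \<open>{4,5,6}\<close>. Hence a bad
  \<open>x\<close> sends a block to a block, and so \<open>{1,2,3}\<close> to one of the two: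
  \<open>2 * fact 3 * fact 3 = 72\<close> possibilities.\<close>

lemma card_bad_3_6: "card (bad 3 {1..6} (std_cent 3 6)) \<le> 72"
proof -
  let ?V = "{1..6::nat}" and ?c = "std_cyc 3" and ?B = "{1,2,3::nat}" and ?C = "{4,5,6::nat}"
  have V: "?V = {1,2,3,4,5,6}" by auto
  have Ws: "std_cent 3 6 = cent ?V ?c" by (simp add: std_cent_def)
  have key: "(\<forall>u\<in>?B. w u \<in> ?B) \<and> (\<forall>u\<in>?C. w u \<in> ?C)"
    if w: "w \<in> cent ?V ?c" "w ^^ 3 = id" for w
  proof -
    have wp: "w permutes ?V" using centD(1)[OF w(1)] .
    have w3: "w (w (w u)) = u" for u using fun_cong[OF w(2), of u] by (simp add: numeral_3_eq_3)
    have in_V: "w u \<in> ?B \<or> w u \<in> ?C" if "u \<in> ?V" for u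
      using permutes_in_image[OF wp, of u] that unfolding V by blast
    have c: "w (?c u) = ?c (w u)" if "u \<in> ?V" for u using centD(2)[OF w(1) that] .
    have cB: "u \<in> ?B \<Longrightarrow> ?c u \<in> ?B" "u \<in> ?C \<Longrightarrow> ?c u \<in> ?C" for u by (auto simp: std_cyc_def)
    have e: "?c 1 = 2" "?c 2 = 3" "?c 4 = 5" "?c 5 = 6" by (auto simp: std_cyc_def)
    have w23: "w 2 = ?c (w 1)" "w 3 = ?c (w 2)" "w 5 = ?c (w 4)" "w 6 = ?c (w 5)"
      using c[of 1] c[of 2] c[of 4] c[of 5] unfolding e by auto
    have BB: "\<forall>u\<in>?B. w u \<in> ?B" if "w 1 \<in> ?B" using that cB(1) w23 by auto
    have BC: "\<forall>u\<in>?B. w u \<in> ?C" if "w 1 \<in> ?C" using that cB(2) w23 by auto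
    have CB: "\<forall>u\<in>?C. w u \<in> ?B" if "w 4 \<in> ?B" using that cB(1) w23 by auto
    have CC: "\<forall>u\<in>?C. w u \<in> ?C" if "w 4 \<in> ?C" using that cB(2) w23 by auto
    have dj: "\<not> (u \<in> ?B \<and> u \<in> ?C)" for u by auto
    have "w 1 \<in> ?B"
    proof (rule ccontr)
      assume "w 1 \<notin> ?B"
      then have w1: "w 1 \<in> ?C" using in_V[of 1] by auto
      show False
      proof (cases "w 4 \<in> ?B")
        case True
        then have "w (w 1) \<in> ?B" using CB w1 by blast
        then have "w (w (w 1)) \<in> ?C" using BC[OF w1] by blast
        then show False using w3[of 1] by simp
      next
        case False
        then have "w 4 \<in> ?C" using in_V[of 4] by auto
        then have "w (w 1) \<in> ?C" "w (w (w 1)) \<in> ?C" using CC w1 by blast+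
        then show False using w3[of 1] by simp
      qed
    qed
    moreover have "w 4 \<in> ?C"
    proof (rule ccontr)
      assume "w 4 \<notin> ?C"
      then have "w 4 \<in> ?B" using in_V[of 4] by auto
      then have "w (w 4) \<in> ?B" "w (w (w 4)) \<in> ?B" using BB[OF \<open>w 1 \<in> ?B\<close>] by blast+
      then show False using w3[of 4] by simp
    qed
    ultimately show ?thesis using BB CC by blast
  qed
  have "bad 3 ?V (cent ?V ?c) \<subseteq> {x. x permutes ?V \<and> x ` ?B = ?B} \<union> {x. x permutes ?V \<and> x ` ?B = ?C}"
  proof
    fix x assume "x \<in> bad 3 ?V (cent ?V ?c)"
    then obtain g where x: "x permutes ?V" and g: "g \<in> cent ?V ?c" "g \<noteq> id" "g ^^ 3 = id"
      and h: "x \<circ> g \<circ> inv' x \<in> cent ?V ?c" by (auto simp: bad_def)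
    let ?h = "x \<circ> g \<circ> inv' x"
    have h3: "?h ^^ 3 = id" using conj_funpow[OF x, where g = g and i = 3] g(3) permutes_inv_o(1)[OF x] by simp
    note kg = key[OF g(1,3)] and kh = key[OF h h3]
    obtain u where u: "g u \<noteq> u" using g(2) by (auto simp: fun_eq_iff)
    have uV: "u \<in> ?V" using u permutes_not_in[OF centD(1)[OF g(1)]] by blast
    have fc: "free_cyc 3 {u. g u \<noteq> u} g" using free_cyc_support[of 3 g] g(3) by simp
    define Q where "Q = {u, g u, g (g u)}"
    have d: "g u \<noteq> u" "g (g u) \<noteq> u" "g (g u) \<noteq> g u"
    proof -
      show "g u \<noteq> u" by (rule u)
      have "\<forall>i\<in>{1..<3}. (g ^^ i) u \<noteq> u" using fc u unfolding free_cyc_def by blast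
      then have "(g ^^ 2) u \<noteq> u" by simp
      then show "g (g u) \<noteq> u" by (simp add: numeral_2_eq_2)
      have "g u \<in> {u. g u \<noteq> u}" using fc u unfolding free_cyc_def by blast
      then show "g (g u) \<noteq> g u" by simp
    qed
    have cQ: "card Q = 3" using d by (auto simp: Q_def card_insert_if)
    have "Q = ?B \<or> Q = ?C"
    proof -
      have "Q \<subseteq> ?B \<or> Q \<subseteq> ?C" using uV kg unfolding V Q_def by blast
      moreover have "card ?B = 3" "card ?C = 3" by auto
      ultimately show ?thesis using cQ card_subset_eq[of ?B Q] card_subset_eq[of ?C Q] by auto
    qed
    moreover have xQ: "x ` Q = ?B \<or> x ` Q = ?C"
    proof -
      have hx: "?h (x v) = x (g v)" for v using permutes_inverses(2)[OF x] by simp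
      have "x u \<in> ?B \<or> x u \<in> ?C" using permutes_in_image[OF x, of u] uV unfolding V by blast
      then have "x ` Q \<subseteq> ?B \<or> x ` Q \<subseteq> ?C"
        using kh hx[of u] hx[of "g u"] unfolding Q_def by (metis empty_subsetI image_empty image_insert insert_subset)
      moreover have "card ?B = 3" "card ?C = 3" "card (x ` Q) = 3"
        using card_image[OF permutes_inj_on[OF x]] cQ by auto
      ultimately show ?thesis using card_subset_eq[of ?B "x ` Q"] card_subset_eq[of ?C "x ` Q"] by auto
    qed
    moreover have "x ` ?B = ?V - x ` ?C"
    proof -
      have "?B = ?V - ?C" by auto
      then show ?thesis using image_set_diff[OF permutes_inj[OF x], of ?V ?C] permutes_image[OF x] by metis
    qed
    moreover have "?V - ?B = ?C" "?V - ?C = ?B" by auto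
    ultimately have "x ` ?B = ?B \<or> x ` ?B = ?C" by metis
    then show "x \<in> {x. x permutes ?V \<and> x ` ?B = ?B} \<union> {x. x permutes ?V \<and> x ` ?B = ?C}"
      using x by blast
  qed
  then have "card (bad 3 ?V (cent ?V ?c)) \<le>
    card ({x. x permutes ?V \<and> x ` ?B = ?B} \<union> {x. x permutes ?V \<and> x ` ?B = ?C})"
    using finite_permutations[of ?V] by (intro card_mono) auto
  also have "\<dots> \<le> card {x. x permutes ?V \<and> x ` ?B = ?B} + card {x. x permutes ?V \<and> x ` ?B = ?C}"
    by (rule card_Un_le)
  also have "\<dots> \<le> 36 + 36"
  proof -
    have "card {x. x permutes ?V \<and> x ` ?B = S} \<le> 36" for S
    proof -
      have "card {x. x permutes ?V \<and> x ` ?B = S} \<le> fact (card ?B) * fact (card ?V - card ?B)"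
        by (rule card_map_set_le) auto
      also have "\<dots> = 36" by (simp add: fact_numeral)
      finally show ?thesis .
    qed
    then show ?thesis by (intro add_mono)
  qed
  also have "\<dots> = 72" by simp
  finally show ?thesis by (simp add: Ws)
qed

section \<open>The prime two\<close>

definition good :: "nat \<Rightarrow> (nat \<Rightarrow> nat) set \<Rightarrow> (nat \<Rightarrow> nat) set"
  where "good m V = {x. x permutes {1..m}} - bad 2 {1..m} V"

lemma finite_good: "finite (good m V)"
  by (simp add: good_def finite_permutations)

lemma card_even_good:
  assumes "subgroup V (sym_group m)" "transpose 1 2 \<in> V"
  shows "2 * card {x \<in> good m V. evenperm x} = card (good m V)"
proof -
  let ?t = "transpose 1 (2::nat)"
  note V = subgroup_sym_groupD[OF assms(1)]
  have t: "?t permutes {1..m}" using V(1) assms(2) by blast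
  have tt: "?t \<circ> (?t \<circ> x) = x" for x by (simp add: fun_eq_iff)
  show ?thesis
  proof (rule card_even_half[OF finite_good, of _ _ ?t])
    fix x assume x: "x \<in> good m V"
    then show "permutation x" by (auto simp: good_def intro: permutes_imp_permutation)
    have "?t \<circ> x \<notin> bad 2 {1..m} V"
    proof
      assume "?t \<circ> x \<in> bad 2 {1..m} V"
      then have "?t \<circ> (?t \<circ> x) \<in> bad 2 {1..m} V"
        using V(3,4) assms(2) by - (rule bad_normalizer[OF t]; blast)
      then have "x \<in> bad 2 {1..m} V" by (simp only: tt)
      then show False using x by (simp add: good_def)
    qed
    then show "?t \<circ> x \<in> good m V" using x permutes_compose[OF _ t] by (auto simp: good_def)
  qed (auto simp: permutation_swap_id evenperm_swap)
qed

text \<open>If \<open>v \<circ> c \<circ> w = v1 \<circ> c \<circ> w1\<close>, then conjugating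
  \<open>w1 \<circ> inv' w\<close> by \<open>c\<close> yields \<open>inv' v1 \<circ> v\<close>, so
  \<open>w1 \<circ> inv' w\<close> is one of at most \<open>N\<close> elements and determines the
  pair. A subset \<open>P\<close> of \<open>W \<times> W\<close> is allowed so that unwanted pairs
  can be removed beforehand.\<close>

lemma card_double_coset_le:
  assumes W: "subgroup W (sym_group m)" and c: "c permutes {1..m}"
    and D: "card {d \<in> W. c \<circ> d \<circ> inv' c \<in> W} \<le> N"
    and P: "P \<subseteq> W \<times> W" "\<And>v w. (v, w) \<in> P \<Longrightarrow> v \<circ> c \<circ> w \<in> G" and G: "finite G"
  shows "card P \<le> N * card G"
proof -
  let ?D = "{d \<in> W. c \<circ> d \<circ> inv' c \<in> W}"
  let ?f = "\<lambda>(v, w). v \<circ> c \<circ> w"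
  note Wd = subgroup_sym_groupD[OF W]
  have finW: "finite W" using Wd(1) finite_subset[OF _ finite_permutations[of "{1..m}"]] by auto
  have finP: "finite P" using P(1) finW finite_subset by blast
  have "card {y \<in> P. ?f y = x} \<le> N" for x
  proof (cases "{y \<in> P. ?f y = x} = {}")
    case False
    then obtain v1 w1 where 1: "(v1, w1) \<in> P" "v1 \<circ> c \<circ> w1 = x" by auto
    have 1: "(v1, w1) \<in> P" "v1 \<in> W" "w1 \<in> W" "v1 \<circ> c \<circ> w1 = x" using 1 P(1) by auto
    let ?h = "\<lambda>(v, w). w1 \<circ> inv' w"
    have "card {y \<in> P. ?f y = x} \<le> card ?D"
    proof (rule card_inj_on_le)
      show "inj_on ?h {y \<in> P. ?f y = x}"
      proof (rule inj_onI, clarsimp)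
        fix v w v' w' assume vw: "(v, w) \<in> P" "(v', w') \<in> P" "v' \<circ> c \<circ> w' = v \<circ> c \<circ> w"
          and e: "w1 \<circ> inv' w = w1 \<circ> inv' w'"
        have p: "w permutes {1..m}" "w' permutes {1..m}" "w1 permutes {1..m}"
          using vw P(1) Wd(1) 1 by auto
        have "inv' w1 \<circ> (w1 \<circ> inv' w) = inv' w1 \<circ> (w1 \<circ> inv' w')" using e by simp
        then have "inv' w = inv' w'" using permutes_inv_o(2)[OF p(3)] by (simp flip: comp_assoc)
        then have ww: "w = w'" using p by (metis permutes_inv_inv)
        have "v' \<circ> c \<circ> w \<circ> inv' w \<circ> inv' c = v \<circ> c \<circ> w \<circ> inv' w \<circ> inv' c" using vw ww by simp
        then have "v' = v" using permutes_inv_o(1)[OF p(1)] permutes_inv_o(1)[OF c]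
          by (simp add: comp_assoc)
        then show "v = v' \<and> w = w'" using ww by simp
      qed
      show "?h ` {y \<in> P. ?f y = x} \<subseteq> ?D"
      proof (rule image_subsetI, clarsimp)
        fix v w assume vw: "(v, w) \<in> P" and e: "x = v \<circ> c \<circ> w"
        then have W': "v \<in> W" "w \<in> W" using P(1) by auto
        have p: "w permutes {1..m}" "v1 permutes {1..m}" using W' Wd(1) 1 by auto
        have "v1 \<circ> (c \<circ> (w1 \<circ> inv' w) \<circ> inv' c) = x \<circ> inv' w \<circ> inv' c"
          using 1(4) by (auto simp: comp_assoc)
        also have "\<dots> = v" using e permutes_inv_o(1)[OF p(1)] permutes_inv_o(1)[OF c]
          by (simp add: comp_assoc)
        finally have "inv' v1 \<circ> v = c \<circ> (w1 \<circ> inv' w) \<circ> inv' c"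
          using permutes_inv_o(2)[OF p(2)] by (metis comp_assoc id_comp)
        moreover have "inv' v1 \<circ> v \<in> W" using Wd(3,4) W' 1 by blast
        ultimately show "w1 \<circ> inv' w \<in> W \<and> c \<circ> (w1 \<circ> inv' w) \<circ> inv' c \<in> W"
          using Wd(3,4) W' 1 by metis
      qed
    qed (use finW in auto)
    then show ?thesis using D by simp
  next
    case True
    then show ?thesis by (metis card.empty le0)
  qed
  then have "(\<Sum>x\<in>?f ` P. card {y \<in> P. ?f y = x}) \<le> (\<Sum>x\<in>?f ` P. N)" by (intro sum_mono)
  moreover have "card P = (\<Sum>x\<in>?f ` P. card {y \<in> P. ?f y = x})"
    using sum.image_gen[OF finP, of "\<lambda>_. 1::nat" ?f] by simp
  ultimately have "card P \<le> card (?f ` P) * N" by simp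
  also have "\<dots> \<le> card G * N"
    using P(2) G by (intro mult_right_mono card_mono) auto
  finally show ?thesis by (simp add: mult.commute)
qed

text \<open>Transfers a common element for \<open>v \<circ> c \<circ> w\<close> to one for
  \<open>c\<close>: if \<open>v\<close>, \<open>w\<close>, \<open>g\<close> and the conjugate of
  \<open>g\<close> lie in a group \<open>W\<close>, then \<open>w \<circ> g \<circ> inv' w\<close>
  lies in \<open>W\<close> together with its conjugate by \<open>c\<close>.\<close>

lemma conj_double_coset:
  assumes "v permutes U" "c permutes U" "w permutes U"
  shows "c \<circ> (w \<circ> g \<circ> inv' w) \<circ> inv' c =
    inv' v \<circ> (v \<circ> c \<circ> w \<circ> g \<circ> inv' (v \<circ> c \<circ> w)) \<circ> v"
proof -
  have "inv' (v \<circ> c \<circ> w) = inv' w \<circ> inv' c \<circ> inv' v"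
    using assms by (simp add: o_inv_distrib permutes_bij bij_comp comp_assoc)
  then show ?thesis using permutes_inverses[OF assms(1)] by (simp add: fun_eq_iff)
qed

lemma conj_eq_id:
  assumes "w permutes U" "w \<circ> g \<circ> inv' w = id"
  shows "g = id"
proof
  fix u
  have "w (g (inv' w (w u))) = w u" using assms(2) by (metis comp_apply id_apply)
  then show "g u = id u" using permutes_inverses[OF assms(1)] permutes_inj[OF assms(1)]
    by (auto dest: injD)
qed

lemma card_std_cent: "p > 0 \<Longrightarrow> card (std_cent p m) = p ^ (m div p) * fact (m div p)"
  unfolding std_cent_def using card_cent[OF free_cyc_std_cyc, of p "m div p"] by simp

definition shift :: "nat \<Rightarrow> nat \<Rightarrow> nat"
  where "shift m i = (if i \<in> {1..<m} then i + 1 else if i = m then 1 else i)"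

lemma shift_permutes: "m \<ge> 1 \<Longrightarrow> shift m permutes {1..m}"
proof (rule bij_imp_permutes)
  assume "m \<ge> 1"
  then show "bij_betw (shift m) {1..m} {1..m}"
    by (intro bij_betw_byWitness[where f' = "\<lambda>i. if i = 1 then m else i - 1"]) (auto simp: shift_def)
qed (auto simp: shift_def)

lemma transpose_12_mem:
  assumes "2 \<le> m"
  shows "transpose 1 2 \<in> std_cent 2 m"
proof -
  let ?t = "transpose 1 (2::nat)"
  have k: "2 \<le> 2 * (m div 2)" using assms by presburger
  have "?t permutes {1..2 * (m div 2)}" using k by (intro permutes_swap_id) auto
  moreover have "?t (std_cyc 2 u) = std_cyc 2 (?t u)" if u: "u \<ge> 1" for u
  proof -
    consider "u = 1" | "u = 2" | "u > 2" using u by linarith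
    then show ?thesis
    proof cases
      case 3
      then have "std_cyc 2 u > 2" by (auto simp: std_cyc_def elim!: evenE)
      then show ?thesis using 3 by (auto simp: transpose_def)
    qed (auto simp: std_cyc_def transpose_def)
  qed
  ultimately show ?thesis by (auto simp: std_cent_def cent_def)
qed

section \<open>Odd degree: two matchings forming a Hamiltonian path\<close>

text \<open>An element \<open>d\<close> of the intersection preserves the standard matching and its
  image under the inverse shift. Their union is a path through all points from \<open>m\<close> to
  \<open>2 * k\<close>; each end is the only point missed by one of the matchings, so both ends are
  fixed and \<open>d\<close> is the identity. The double coset therefore has
  \<open>card W ^ 2\<close> elements.\<close>

lemma card_good_odd:
  assumes "m = 2 * k + 1"
  shows "(2 ^ k * fact k)\<^sup>2 \<le> card (good m (std_cent 2 m))"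
proof -
  let ?W = "std_cent 2 m" let ?c = "shift m"
  have W: "subgroup ?W (sym_group m)" using std_cent_index(1)[of 2 m] by simp
  note Wd = subgroup_sym_groupD[OF W]
  have c: "?c permutes {1..m}" using assms by (intro shift_permutes) simp
  have md: "m div 2 = k" using assms by simp
  have WW: "?W = cent {1..2 * k} (std_cyc 2)" by (simp add: std_cent_def md)
  have triv: "d = id" if d: "d \<in> ?W" "?c \<circ> d \<circ> inv' ?c \<in> ?W" for d
  proof -
    let ?h = "?c \<circ> d \<circ> inv' ?c"
    have dp: "d permutes {1..2 * k}" and hp: "?h permutes {1..2 * k}"
      using centD(1)[OF d(1)[unfolded WW]] centD(1)[OF d(2)[unfolded WW]] by auto
    have hc: "?h (?c i) = ?c (d i)" for i using permutes_inverses(2)[OF c] by simp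
    have cinj: "?c i = ?c j \<longleftrightarrow> i = j" for i j using permutes_inj[OF c] by (auto simp: inj_eq)
    have comm_d: "d (std_cyc 2 i) = std_cyc 2 (d i)" and comm_h: "?h (std_cyc 2 i) = std_cyc 2 (?h i)"
      if "i \<in> {1..2 * k}" for i
      using centD(2)[OF d(1)[unfolded WW] that] centD(2)[OF d(2)[unfolded WW] that] by auto
    have dc: "d i = i" if "?h (?c i) = ?c i" for i using hc[of i] that cinj by simp
    have m_h: "?h m = m" using permutes_not_in[OF hp, of m] assms by simp
    have m_d: "d m = m" using permutes_not_in[OF dp, of m] assms by simp
    \<comment> \<open>Walk along the path from its end \<open>2 * k\<close>: the edge from an even
      \<open>j\<close> to \<open>j - 1\<close> is in the standard matching, the edge from an odd
      \<open>j\<close> in the shifted one.\<close>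
    have fix_d: "d (2 * k - i) = 2 * k - i" if "i < 2 * k" for i
      using that
    proof (induction i)
      case 0
      then have "?c (2 * k) = m" using assms by (auto simp: shift_def)
      then show ?case using dc[of "2 * k"] m_h by simp
    next
      case (Suc i)
      define j where "j = 2 * k - i"
      have j: "d j = j" "2 \<le> j" "j \<le> 2 * k" using Suc by (auto simp: j_def)
      have "d (j - 1) = j - 1"
      proof (cases "even j")
        case True
        then show ?thesis using comm_d[of j] j by (simp add: std_cyc_def)
      next
        case False
        then have odd: "j < 2 * k" using j by (metis dvd_triv_left le_neq_implies_less)
        then have cj: "?c j = j + 1" "?c (j - 1) = j" using j assms by (auto simp: shift_def)
        have "?h (j + 1) = j + 1" using hc[of j] j cj by simp
        then have "?h (std_cyc 2 (j + 1)) = std_cyc 2 (j + 1)" using comm_h[of "j + 1"] odd by simp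
        moreover have "std_cyc 2 (j + 1) = j" using False by (simp add: std_cyc_def)
        ultimately show ?thesis using dc[of "j - 1"] cj by simp
      qed
      then show ?case by (simp add: j_def)
    qed
    have "d i = i" if i: "i \<in> {1..2 * k}" for i
      using fix_d[of "2 * k - i"] i by simp
    then show ?thesis using permutes_not_in[OF dp] by (auto simp: fun_eq_iff)
  qed
  have "card (?W \<times> ?W) \<le> 1 * card (good m ?W)"
  proof (rule card_double_coset_le[OF W c _ order.refl _ finite_good])
    have "{d \<in> ?W. ?c \<circ> d \<circ> inv' ?c \<in> ?W} \<subseteq> {id}" using triv by auto
    from card_mono[OF _ this] show "card {d \<in> ?W. ?c \<circ> d \<circ> inv' ?c \<in> ?W} \<le> 1" by simp
    fix v w assume "(v, w) \<in> ?W \<times> ?W"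
    then have vw: "v \<in> ?W" "w \<in> ?W" by auto
    then have p: "v permutes {1..m}" "w permutes {1..m}" using Wd(1) by auto
    show "v \<circ> ?c \<circ> w \<in> good m ?W"
      unfolding good_def bad_def
    proof (intro DiffI CollectI notI)
      show "v \<circ> ?c \<circ> w permutes {1..m}" using p c by (intro permutes_compose)
      assume "v \<circ> ?c \<circ> w \<in> {x. x permutes {1..m} \<and>
        (\<exists>g\<in>?W. g \<noteq> id \<and> g ^^ 2 = id \<and> x \<circ> g \<circ> inv' x \<in> ?W)}"
      then obtain g where g: "g \<in> ?W" "g \<noteq> id" "v \<circ> ?c \<circ> w \<circ> g \<circ> inv' (v \<circ> ?c \<circ> w) \<in> ?W" by blast
      have "?c \<circ> (w \<circ> g \<circ> inv' w) \<circ> inv' ?c \<in> ?W"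
        using conj_double_coset[OF p(1) c p(2), of g] Wd(3,4) vw g(3) by metis
      then have "w \<circ> g \<circ> inv' w = id" using triv Wd(3,4) vw g(1) by metis
      then show False using g(2) conj_eq_id[OF p(2)] by blast
    qed
  qed
  then show ?thesis using card_std_cent[of 2 m] md by (simp add: card_cartesian_product power2_eq_square)
qed

text \<open>\<open>W2 k\<close> is the stabilizer of the perfect matching \<open>{2 * j - 1, 2 * j}\<close>, and \<open>pair_perm\<close> gives its action on
  the \<open>k\<close> edges.\<close>

abbreviation W2 :: "nat \<Rightarrow> (nat \<Rightarrow> nat) set"
  where "W2 k \<equiv> cent {1..2 * k} (std_cyc 2)"

definition pair_perm :: "nat \<Rightarrow> (nat \<Rightarrow> nat) \<Rightarrow> nat \<Rightarrow> nat"
  where "pair_perm k w j = (if j \<in> {1..k} then (w (2 * j) + 1) div 2 else j)"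

section \<open>Even degree: the matching stabilizer and its action on the edges\<close>

lemma W2_mem:
  assumes "w \<in> W2 k" "i \<in> {1..2 * k}"
  shows "w i \<in> {1..2 * k}" "w (std_cyc 2 i) = std_cyc 2 (w i)"
  using permutes_in_image[OF centD(1)[OF assms(1)]] centD(2)[OF assms] assms(2) by blast+

text \<open>\<open>(i + 1) div 2\<close> is the index of the edge containing \<open>i\<close>.
  \<open>pair_perm\<close> is defined through the even end of an edge; the odd end gives the same
  value.\<close>

lemma pair_perm_apply:
  assumes "w \<in> W2 k" "i \<in> {1..2 * k}"
  shows "pair_perm k w ((i + 1) div 2) = (w i + 1) div 2"
proof (cases "even i")
  case True
  then have "(i + 1) div 2 \<in> {1..k}" "2 * ((i + 1) div 2) = i" using assms(2) by (auto elim!: evenE)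
  then show ?thesis by (simp add: pair_perm_def)
next
  case False
  then have i: "(i + 1) div 2 \<in> {1..k}" "2 * ((i + 1) div 2) = i + 1" using assms(2) by (auto elim!: oddE)
  have "w (i + 1) = std_cyc 2 (w i)" using W2_mem[OF assms] False by (simp add: std_cyc_def)
  moreover have "(std_cyc 2 v + 1) div 2 = (v + 1) div 2" if "v \<ge> 1" for v
    using that by (auto simp: std_cyc_def elim!: evenE oddE)
  ultimately show ?thesis using i W2_mem(1)[OF assms] by (simp add: pair_perm_def)
qed

lemma pair_perm_comp:
  assumes "v \<in> W2 k" "w \<in> W2 k"
  shows "pair_perm k (v \<circ> w) = pair_perm k v \<circ> pair_perm k w"
proof
  fix j
  show "pair_perm k (v \<circ> w) j = (pair_perm k v \<circ> pair_perm k w) j"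
  proof (cases "j \<in> {1..k}")
    case True
    then have "w (2 * j) \<in> {1..2 * k}" using W2_mem(1)[OF assms(2), of "2 * j"] by simp
    from pair_perm_apply[OF assms(1) this] True show ?thesis by (simp add: pair_perm_def)
  qed (auto simp: pair_perm_def)
qed

lemma pair_perm_id: "pair_perm k id = id"
  by (auto simp: pair_perm_def fun_eq_iff)

lemma W2_inv: "w \<in> W2 k \<Longrightarrow> inv' w \<in> W2 k"
  using cent_inv free_cyc_std_cyc[of 2 k] unfolding free_cyc_def by blast

lemma pair_perm_permutes:
  assumes "w \<in> W2 k"
  shows "pair_perm k w permutes {1..k}" "pair_perm k (inv' w) = inv' (pair_perm k w)"
proof -
  note wp = centD(1)[OF assms]
  have 1: "pair_perm k (inv' w) \<circ> pair_perm k w = id" "pair_perm k w \<circ> pair_perm k (inv' w) = id"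
    using pair_perm_comp[OF W2_inv[OF assms] assms] pair_perm_comp[OF assms W2_inv[OF assms]]
      permutes_inv_o[OF wp] pair_perm_id by metis+
  have 2: "pair_perm k v j \<in> {1..k}" if "v \<in> W2 k" "j \<in> {1..k}" for v j
    using W2_mem(1)[OF that(1), of "2 * j"] that(2) by (auto simp: pair_perm_def)
  show *: "pair_perm k w permutes {1..k}"
  proof (rule bij_imp_permutes)
    show "bij_betw (pair_perm k w) {1..k} {1..k}"
      using 1 2[OF assms] 2[OF W2_inv[OF assms]]
      by (intro bij_betw_byWitness[where f' = "pair_perm k (inv' w)"]) (auto simp: fun_eq_iff)
  qed (auto simp: pair_perm_def)
  show "pair_perm k (inv' w) = inv' (pair_perm k w)"
    using 1 by (metis inv_unique_comp)
qed

text \<open>An element is determined by the edge permutation and by the set of edges whose even end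
  is sent to an even end.\<close>

lemma card_pair_perm_le:
  assumes "S \<subseteq> {s. s permutes {1..k}}"
  shows "card {w \<in> W2 k. pair_perm k w \<in> S} \<le> 2 ^ k * card S"
proof -
  let ?f = "\<lambda>w. (pair_perm k w, {j \<in> {1..k}. even (w (2 * j))})"
  have finS: "finite S" using assms finite_subset[OF _ finite_permutations[of "{1..k}"]] by auto
  have "card {w \<in> W2 k. pair_perm k w \<in> S} \<le> card (S \<times> Pow {1..k})"
  proof (rule card_inj_on_le[of ?f])
    show "inj_on ?f {w \<in> W2 k. pair_perm k w \<in> S}"
    proof (rule inj_onI)
      fix v w assume v: "v \<in> {w \<in> W2 k. pair_perm k w \<in> S}" and w: "w \<in> {w \<in> W2 k. pair_perm k w \<in> S}"
        and e: "?f v = ?f w"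
      then have vw: "v \<in> W2 k" "w \<in> W2 k" by auto
      have even: "v (2 * j) = w (2 * j)" if j: "j \<in> {1..k}" for j
      proof -
        have "(v (2 * j) + 1) div 2 = (w (2 * j) + 1) div 2"
          using e j by (auto simp: pair_perm_def fun_eq_iff split: if_splits)
        moreover have "even (v (2 * j)) \<longleftrightarrow> even (w (2 * j))" using e j by auto
        ultimately show ?thesis by presburger
      qed
      have "v i = w i" if i: "i \<in> {1..2 * k}" for i
      proof (cases "even i")
        case True
        then show ?thesis using even[of "i div 2"] i by (auto elim!: evenE)
      next
        case False
        then obtain q where q: "i = 2 * q + 1" by (auto elim: oddE)
        have "q + 1 \<le> k" using q i unfolding atLeastAtMost_iff by presburger
        then have j: "2 * (q + 1) \<in> {1..2 * k}" "q + 1 \<in> {1..k}" by auto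
        have "std_cyc 2 (2 * (q + 1)) = i" using q by (simp add: std_cyc_def)
        then show ?thesis using W2_mem(2)[OF vw(1) j(1)] W2_mem(2)[OF vw(2) j(1)] even[OF j(2)] by simp
      qed
      then show "v = w"
        using permutes_not_in[OF centD(1)[OF vw(1)]] permutes_not_in[OF centD(1)[OF vw(2)]]
        by (metis ext)
    qed
  qed (use finS in auto)
  also have "\<dots> = 2 ^ k * card S" by (simp add: card_cartesian_product card_Pow)
  finally show ?thesis .
qed

lemma card_W2: "card (W2 k) = 2 ^ k * fact k"
  using card_cent[OF free_cyc_std_cyc, of 2 k] by simp

text \<open>The upper bounds for \<open>S\<close> and for its complement add up exactly to the order
  of \<open>W2 k\<close>, so both are attained.\<close>

lemma card_pair_perm:
  assumes "S \<subseteq> {s. s permutes {1..k}}"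
  shows "card {w \<in> W2 k. pair_perm k w \<in> S} = 2 ^ k * card S"
proof -
  let ?P = "{s. s permutes {1..k}}"
  have finP: "finite ?P" by (simp add: finite_permutations)
  have "card {w \<in> W2 k. pair_perm k w \<in> S} + card {w \<in> W2 k. pair_perm k w \<in> ?P - S} = card (W2 k)"
    using pair_perm_permutes(1) finite_cent[of "{1..2 * k}" "std_cyc 2"]
    by (subst card_Un_disjoint[symmetric]) (auto intro!: arg_cong[of _ _ card])
  moreover have "card {w \<in> W2 k. pair_perm k w \<in> ?P - S} \<le> 2 ^ k * card (?P - S)"
    by (rule card_pair_perm_le) auto
  moreover have cP: "card ?P = fact k" by (simp add: card_permutations)
  then have "card (?P - S) = fact k - card S" "card S \<le> fact k"
    using card_mono[OF finP assms] card_Diff_subset[OF finite_subset[OF assms finP] assms] by auto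
  ultimately have "card (W2 k) \<le> card {w \<in> W2 k. pair_perm k w \<in> S} + 2 ^ k * (fact k - card S)"
    by simp
  moreover have "card (W2 k) = 2 ^ k * card S + 2 ^ k * (fact k - card S)"
    using \<open>card S \<le> fact k\<close> card_W2[of k] by (simp flip: distrib_left)
  ultimately show ?thesis using card_pair_perm_le[OF assms] by simp
qed

text \<open>The wreath product of a group of order two with \<open>H\<close>.\<close>

definition wreath :: "nat \<Rightarrow> (nat \<Rightarrow> nat) set \<Rightarrow> (nat \<Rightarrow> nat) set"
  where "wreath k H = {w \<in> W2 k. pair_perm k w \<in> H}"

lemma subgroup_W2: "subgroup (W2 k) (sym_group (2 * k))"
  by (rule subgroup_cent[OF free_cyc_std_cyc]) simp

lemma subgroup_wreath:
  assumes "subgroup H (sym_group k)"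
  shows "subgroup (wreath k H) (sym_group (2 * k))"
proof (rule subgroup_sym_groupI)
  note W = subgroup_sym_groupD[OF subgroup_W2] and Hd = subgroup_sym_groupD[OF assms]
  show "id \<in> wreath k H" using W(2) Hd(2) by (simp add: wreath_def pair_perm_id)
  show "v \<circ> w \<in> wreath k H" if "v \<in> wreath k H" "w \<in> wreath k H" for v w
    using that W(3) Hd(3) by (simp add: wreath_def pair_perm_comp)
  show "inv' w \<in> wreath k H" if "w \<in> wreath k H" for w
    using that W(4) Hd(4) by (simp add: wreath_def pair_perm_permutes(2))
qed (use subgroup_sym_groupD(1)[OF subgroup_W2] in \<open>auto simp: wreath_def\<close>)

text \<open>\<open>W2 k\<close> has odd index by \<open>fact_prime_part\<close>, and the index of
  \<open>wreath k H\<close> in it equals that of \<open>H\<close> in the symmetric group on the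
  edges.\<close>

lemma wreath_index:
  assumes "subgroup H (sym_group k)" "odd (fact k div card H)"
  shows "odd (fact (2 * k) div card (wreath k H))"
proof -
  have sub: "H \<subseteq> {s. s permutes {1..k}}" using subgroup_sym_groupD(1)[OF assms(1)] by auto
  have c: "card (wreath k H) = 2 ^ k * card H" unfolding wreath_def by (rule card_pair_perm[OF sub])
  obtain q where q: "(fact (2 * k) :: nat) = 2 ^ k * fact k * q" "odd q"
    using fact_prime_part[of 2 "2 * k"] by auto
  have "card H dvd fact k"
    using group.lagrange[OF sym_group_is_group assms(1)] by (metis dvd_triv_right order_sym_group)
  then obtain r where r: "fact k = card H * r" by auto
  have H0: "card H > 0" using r by (metis fact_nonzero gr0I mult_0)
  have "fact (2 * k) div card (wreath k H) = r * q"
    using c q(1) r H0 by (simp add: mult.assoc)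
  moreover have "fact k div card H = r" using r H0 by simp
  ultimately show ?thesis using assms(2) q(2) by simp
qed

lemma transpose_12_wreath:
  assumes "k \<ge> 1" "subgroup H (sym_group k)"
  shows "transpose 1 2 \<in> wreath k H"
proof -
  have "transpose 1 2 \<in> W2 k" using transpose_12_mem[of "2 * k"] assms(1) by (simp add: std_cent_def)
  moreover have "pair_perm k (transpose 1 2) = id"
    by (auto simp: pair_perm_def fun_eq_iff transpose_def)
  ultimately show ?thesis using subgroup_sym_groupD(2)[OF assms(2)] by (simp add: wreath_def)
qed

text \<open>Together with its image under the cyclic shift this matching forms a \<open>2 * k\<close>-gon. The symmetries of the
  polygon which preserve both matchings and are involutions act on the edges of a matching as the
  reflections \<open>refl_perm\<close> or, for even \<open>k\<close>, as \<open>half_turn\<close>.\<close>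

definition refl_perm :: "nat \<Rightarrow> nat \<Rightarrow> nat \<Rightarrow> nat"
  where "refl_perm k e p = (if p \<in> {1..k} then if p \<le> e then e + 1 - p else e + 1 + k - p else p)"

definition half_turn :: "nat \<Rightarrow> nat \<Rightarrow> nat"
  where "half_turn k p = (if p \<in> {1..k} then if p \<le> k div 2 then p + k div 2 else p - k div 2 else p)"

text \<open>\<open>d\<close> preserves both matchings of the polygon, so it is a symmetry determined
  by the image of vertex 1: the rotation by \<open>d 1 - 1\<close> if \<open>d 1\<close> is odd,
  otherwise the reflection that sends \<open>i\<close> to \<open>d 1 + 1 - i\<close> modulo
  \<open>2 * k\<close>.\<close>

lemma shift_centralizer:
  assumes d: "d \<in> W2 k" and h: "shift (2 * k) \<circ> d \<circ> inv' (shift (2 * k)) \<in> W2 k" and i: "i \<in> {1..2 * k}"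
  shows "d i = (if odd (d 1) then if i + d 1 - 1 \<le> 2 * k then i + d 1 - 1 else i + d 1 - 1 - 2 * k
    else if i \<le> d 1 then d 1 + 1 - i else d 1 + 1 + 2 * k - i)"
proof -
  let ?c = "shift (2 * k)" let ?h = "?c \<circ> d \<circ> inv' ?c"
  have k: "k \<ge> 1" using i by (cases k) auto
  have c: "?c permutes {1..2 * k}" using k by (intro shift_permutes) simp
  have hc: "?h (?c i) = ?c (d i)" for i using permutes_inverses(2)[OF c] by simp
  have cinj: "?c i = ?c j \<longleftrightarrow> i = j" for i j using permutes_inj[OF c] by (auto simp: inj_eq)
  define j where "j = d 1"
  have j: "j \<in> {1..2 * k}" using W2_mem(1)[OF d, of 1] k by (simp add: j_def)
  \<comment> \<open>The edges of the polygon alternate: from an odd \<open>i\<close> to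
    \<open>i + 1\<close> runs an edge of the standard matching, from an even \<open>i\<close> an
    edge of its image under the inverse shift.\<close>
  have step_odd: "d (i + 1) = std_cyc 2 (d i)" if "odd i" "i < 2 * k" for i
  proof -
    have "i \<in> {1..2 * k}" using that by (auto intro: Suc_leI odd_pos)
    from W2_mem(2)[OF d this] that show ?thesis by (simp add: std_cyc_def)
  qed
  have step_even: "?c (d (i + 1)) = std_cyc 2 (?c (d i))" if "even i" "i \<ge> 1" "i < 2 * k" for i
  proof -
    have i: "i + 1 \<in> {1..2 * k}" "i + 2 \<le> 2 * k" using that by (auto elim!: evenE)
    have "?h (std_cyc 2 (i + 1)) = std_cyc 2 (?h (i + 1))" by (rule W2_mem(2)[OF h i(1)])
    moreover have "?c i = i + 1" "?c (i + 1) = i + 2" using that i by (auto simp: shift_def)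
    moreover have "std_cyc 2 (i + 1) = i + 2" using that by (simp add: std_cyc_def)
    ultimately show ?thesis using hc[of i] hc[of "i + 1"] by simp
  qed
  have "n + 1 \<le> 2 * k \<longrightarrow> d (n + 1) = (if odd j then if n + j \<le> 2 * k then n + j else n + j - 2 * k
    else if n < j then j - n else j + 2 * k - n)" for n
  proof (induction n)
    case 0
    then show ?case using j by (simp add: j_def)
  next
    case (Suc n)
    show ?case
    proof
      assume n: "Suc n + 1 \<le> 2 * k"
      then have IH: "d (n + 1) = (if odd j then if n + j \<le> 2 * k then n + j else n + j - 2 * k
        else if n < j then j - n else j + 2 * k - n)" using Suc by simp
      show "d (Suc n + 1) = (if odd j then if Suc n + j \<le> 2 * k then Suc n + j else Suc n + j - 2 * k
        else if Suc n < j then j - Suc n else j + 2 * k - Suc n)"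
      proof (cases "even n")
        case True
        then have "d (n + 1 + 1) = std_cyc 2 (d (n + 1))" using step_odd[of "n + 1"] n by simp
        then have e: "d (Suc n + 1) = std_cyc 2 (d (n + 1))" by simp
        show ?thesis
        proof (cases "odd j")
          case odd: True
          show ?thesis
          proof (cases "n + j \<le> 2 * k")
            case le: True
            then have "Suc n + j \<le> 2 * k" using odd True by presburger
            then show ?thesis unfolding e IH using odd True le by (simp add: std_cyc_def)
          next
            case False
            then show ?thesis unfolding e IH using odd True
              by (simp add: std_cyc_def Suc_diff_le)
          qed
        next
          case evenj: False
          show ?thesis
          proof (cases "n < j")
            case lt: True
            then have "Suc n < j" using evenj True by presburger
            then show ?thesis unfolding e IH using evenj True lt by (simp add: std_cyc_def)
          next
            case False
            then show ?thesis unfolding e IH using evenj True n by (simp add: std_cyc_def)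
          qed
        qed
      next
        case False
        define z where "z = (if odd j then if Suc n + j \<le> 2 * k then Suc n + j else Suc n + j - 2 * k
          else if Suc n < j then j - Suc n else j + 2 * k - Suc n)"
        have "?c (d (n + 1 + 1)) = std_cyc 2 (?c (d (n + 1)))" using step_even[of "n + 1"] False n by simp
        also have "std_cyc 2 (?c (d (n + 1))) = ?c z"
        proof (cases "odd j")
          case odd: True
          consider "n + j < 2 * k" | "n + j = 2 * k" | "n + j > 2 * k" by linarith
          then show ?thesis
          proof cases
            case 1
            then have "Suc n + j < 2 * k" using odd False by presburger
            then show ?thesis unfolding IH z_def using odd False 1 j by (simp add: std_cyc_def shift_def)
          next
            case 2
            then show ?thesis unfolding IH z_def using odd False n k by (simp add: std_cyc_def shift_def)
          next
            case 3
            then have "n + j - 2 * k + 1 < 2 * k" "even (n + j - 2 * k)" "n + j - 2 * k \<ge> 1"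
              "Suc n + j - 2 * k = n + j - 2 * k + 1"
              using odd False j n by auto
            then show ?thesis unfolding IH z_def using odd False 3 by (simp add: std_cyc_def shift_def)
          qed
        next
          case evenj: False
          have "n \<noteq> j" using evenj False by auto
          then consider "Suc n < j" | "Suc n = j" | "n > j" by linarith
          then show ?thesis
          proof cases
            case 1
            define r where "r = j - Suc n"
            have r: "j = Suc n + r" "r \<ge> 1" using 1 by (auto simp: r_def)
            have "even r" using evenj False r by simp
            moreover have "r + 1 < 2 * k" using j False r odd_pos[OF False] by auto
            moreover have "j - n = r + 1" "j - Suc n = r" using r by auto
            ultimately show ?thesis unfolding IH z_def using evenj False 1 r(2)
              by (simp add: std_cyc_def shift_def)
          next
            case 2
            then have "j - n = 1" by simp
            then show ?thesis unfolding IH z_def using evenj False 2 k by (simp add: std_cyc_def shift_def)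
          next
            case 3
            define r where "r = j + 2 * k - Suc n"
            have r: "j + 2 * k = Suc n + r" using n by (simp add: r_def)
            have "even (j + 2 * k)" using evenj by simp
            then have "even r" using False unfolding r by simp
            moreover have "r + 1 < 2 * k" "r \<ge> 1" using n 3 r j by auto
            moreover have "j + 2 * k - n = r + 1" "j + 2 * k - Suc n = r" using r by auto
            ultimately show ?thesis unfolding IH z_def using evenj False 3
              by (simp add: std_cyc_def shift_def)
          qed
        qed
        finally show ?thesis using cinj by (simp add: z_def)
      qed
    qed
  qed
  note * = this
  obtain n where n: "i = n + 1" using i by (cases i) auto
  then have "n + 1 \<le> 2 * k" using i by simp
  with *[of n] have "d (n + 1) = (if odd j then if n + j \<le> 2 * k then n + j else n + j - 2 * k
    else if n < j then j - n else j + 2 * k - n)" by simp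
  moreover have "n + 1 + j - 1 = n + j" "j + 1 - (n + 1) = j - n" "j + 1 + 2 * k - (n + 1) = j + 2 * k - n"
    "n + 1 \<le> j \<longleftrightarrow> n < j" by auto
  ultimately show ?thesis unfolding n j_def[symmetric] by presburger
qed

text \<open>Counts conjugating permutations rather than conjugates, because the pairs
  \<open>(v, w)\<close> in the double coset are what has to be counted.\<close>

definition conj_count :: "nat \<Rightarrow> (nat \<Rightarrow> nat) set \<Rightarrow> (nat \<Rightarrow> nat) \<Rightarrow> nat"
  where "conj_count k H t = card {s. s permutes {1..k} \<and> inv' s \<circ> t \<circ> s \<in> H}"

text \<open>The reflection sending \<open>i\<close> to \<open>2 * e + 1 - i\<close> sends edge
  \<open>p\<close> to edge \<open>e + 1 - p\<close> modulo \<open>k\<close>. Conjugating it by the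
  shift raises the parameter \<open>e\<close> by one, and \<open>k\<close> wraps to 1.\<close>

lemma pair_perm_refl:
  assumes d: "d \<in> W2 k" and h: "shift (2 * k) \<circ> d \<circ> inv' (shift (2 * k)) \<in> W2 k"
    and e: "d 1 = 2 * e" "e \<in> {1..k}"
  shows "pair_perm k d = refl_perm k e"
    "pair_perm k (shift (2 * k) \<circ> d \<circ> inv' (shift (2 * k))) = refl_perm k (if e = k then 1 else e + 1)"
proof -
  let ?c = "shift (2 * k)" let ?h = "?c \<circ> d \<circ> inv' ?c"
  have k: "k \<ge> 1" using e by auto
  have c: "?c permutes {1..2 * k}" using k by (intro shift_permutes) simp
  have hc: "?h (?c i) = ?c (d i)" for i using permutes_inverses(2)[OF c] by simp
  have dv: "d i = (if i \<le> 2 * e then 2 * e + 1 - i else 2 * e + 1 + 2 * k - i)" if "i \<in> {1..2 * k}" for i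
    using shift_centralizer[OF d h that] e by simp
  show "pair_perm k d = refl_perm k e"
  proof
    fix p
    show "pair_perm k d p = refl_perm k e p"
    proof (cases "p \<in> {1..k}")
      case True
      then have "2 * p \<in> {1..2 * k}" by auto
      from dv[OF this] have "d (2 * p) + 1 = 2 * (if p \<le> e then e + 1 - p else e + 1 + k - p)"
        using True by auto
      then show ?thesis using True by (simp add: pair_perm_def refl_perm_def)
    qed (auto simp: pair_perm_def refl_perm_def)
  qed
  show "pair_perm k ?h = refl_perm k (if e = k then 1 else e + 1)"
  proof
    fix p
    show "pair_perm k ?h p = refl_perm k (if e = k then 1 else e + 1) p"
    proof (cases "p \<in> {1..k}")
      case True
      then have p: "1 \<le> p" "p \<le> k" by auto
      have "?c (2 * p - 1) = 2 * p" using p by (auto simp: shift_def)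
      then have "?h (2 * p) = ?c (d (2 * p - 1))" using hc by metis
      also have "d (2 * p - 1) = (if p \<le> e then 2 * (e + 1 - p) else 2 * (e + 1 + k - p))"
      proof -
        have "2 * p - 1 \<in> {1..2 * k}" using p by auto
        from dv[OF this] show ?thesis using p e by auto
      qed
      also have "(?c \<dots> + 1) div 2 = refl_perm k (if e = k then 1 else e + 1) p"
      proof -
        have cv: "(?c (2 * v) + 1) div 2 = (if v = k then 1 else v + 1)" if "v \<in> {1..k}" for v
          using that by (auto simp: shift_def)
        show ?thesis
        proof (cases "p \<le> e")
          case True
          then have "e + 1 - p \<in> {1..k}" using p e by auto
          then show ?thesis using True p e cv[of "e + 1 - p"] by (auto simp: refl_perm_def)
        next
          case False
          then have "e + 1 + k - p \<in> {1..k}" using p e by auto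
          then show ?thesis using False p e cv[of "e + 1 + k - p"] by (auto simp: refl_perm_def)
        qed
      qed
      finally show ?thesis using True by (simp add: pair_perm_def)
    qed (auto simp: pair_perm_def refl_perm_def)
  qed
qed

text \<open>The half turn of the polygon commutes with the shift, so both actions agree. It
  preserves each matching only for even \<open>k\<close>, as \<open>d 1 = k + 1\<close> must be
  odd.\<close>

lemma pair_perm_half_turn:
  assumes d: "d \<in> W2 k" and h: "shift (2 * k) \<circ> d \<circ> inv' (shift (2 * k)) \<in> W2 k"
    and k: "even k" "k > 0" and e: "d 1 = k + 1"
  shows "pair_perm k d = half_turn k"
    "pair_perm k (shift (2 * k) \<circ> d \<circ> inv' (shift (2 * k))) = half_turn k"
proof -
  let ?c = "shift (2 * k)" let ?h = "?c \<circ> d \<circ> inv' ?c"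
  have c: "?c permutes {1..2 * k}" using k by (intro shift_permutes) simp
  have hc: "?h (?c i) = ?c (d i)" for i using permutes_inverses(2)[OF c] by simp
  have dv: "d i = (if i \<le> k then i + k else i - k)" if "i \<in> {1..2 * k}" for i
    using shift_centralizer[OF d h that] e k that by auto
  obtain q where q: "k = 2 * q" using k by auto
  show "pair_perm k d = half_turn k"
  proof
    fix p
    show "pair_perm k d p = half_turn k p"
      using dv[of "2 * p"] q by (auto simp: pair_perm_def half_turn_def)
  qed
  show "pair_perm k ?h = half_turn k"
  proof
    fix p
    show "pair_perm k ?h p = half_turn k p"
    proof (cases "p \<in> {1..k}")
      case True
      then have p: "1 \<le> p" "p \<le> k" by auto
      have "?c (2 * p - 1) = 2 * p" using p by (auto simp: shift_def)
      then have "?h (2 * p) = ?c (d (2 * p - 1))" using hc by metis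
      also have "\<dots> = (if p \<le> q then 2 * (p + q) else 2 * (p - q))"
      proof -
        have "2 * p - 1 \<in> {1..2 * k}" using p by auto
        from dv[OF this] have "d (2 * p - 1) = (if p \<le> q then 2 * (p + q) - 1 else 2 * (p - q) - 1)"
          using p q by auto
        moreover have "1 \<le> d (2 * p - 1)" "d (2 * p - 1) < 2 * k" using calculation p q by auto
        ultimately show ?thesis using p q by (simp add: shift_def)
      qed
      finally show ?thesis using True q by (simp add: pair_perm_def half_turn_def)
    qed (auto simp: pair_perm_def half_turn_def)
  qed
qed

text \<open>In the double coset of the cyclic shift, the element \<open>v \<circ> c \<circ> w\<close> fails to be good only if some
  involution of the dihedral group above, conjugated by \<open>v\<close> and by \<open>w\<close>, lies in \<open>wreath k H\<close> on both sides;
  the loss is therefore a product of two counts of conjugates in \<open>H\<close>.\<close>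

lemma card_good_even:
  assumes H: "subgroup H (sym_group k)" and k: "k > 0"
    and Y: "\<And>e. e \<in> {1..k} \<Longrightarrow>
      conj_count k H (refl_perm k e) * conj_count k H (refl_perm k (if e = k then 1 else e + 1)) \<le> Y"
    and Z: "even k \<Longrightarrow> (conj_count k H (half_turn k))\<^sup>2 \<le> Z"
  shows "4 ^ k * (fact k)\<^sup>2 \<le> 2 * k * card (good (2 * k) (wreath k H)) + 4 ^ k * (k * Y + (if even k then Z else 0))"
proof -
  let ?c = "shift (2 * k)" and ?W = "W2 k" and ?V = "wreath k H" and ?P = "{s. s permutes {1..k}}"
  let ?h = "\<lambda>d. ?c \<circ> d \<circ> inv' ?c"
  note Wd = subgroup_sym_groupD[OF subgroup_W2[of k]] and Hd = subgroup_sym_groupD[OF H]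
  have c: "?c permutes {1..2 * k}" using k by (intro shift_permutes) simp
  have finW: "finite ?W" by (rule finite_cent) simp
  define D where "D = {d \<in> ?W. ?h d \<in> ?W}"
  define J where "J = {d \<in> D. d \<noteq> id \<and> d ^^ 2 = id}"
  \<comment> \<open>The image of vertex 1 determines a symmetry, so \<open>D\<close> has at most
    \<open>2 * k\<close> elements; this bounds the fibres of the double coset.\<close>
  have inj1: "inj_on (\<lambda>d. d 1) D"
  proof (rule inj_onI)
    fix d d' assume dd: "d \<in> D" "d' \<in> D" "d 1 = d' 1"
    have "d i = d' i" if "i \<in> {1..2 * k}" for i
      using shift_centralizer[of d k i] shift_centralizer[of d' k i] dd that by (auto simp: D_def)
    then show "d = d'" using permutes_not_in[of d "{1..2 * k}"] permutes_not_in[of d' "{1..2 * k}"] dd Wd(1)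
      unfolding D_def by (metis (no_types, lifting) ext mem_Collect_eq)
  qed
  have D1: "d 1 \<in> {1..2 * k}" if "d \<in> D" for d
    using W2_mem(1)[of d k 1] that k by (auto simp: D_def)
  have finD: "finite D" using finW by (simp add: D_def)
  have "card D \<le> card {1..2 * k}" using inj1 D1 by (intro card_inj_on_le[of "\<lambda>d. d 1"]) auto
  then have cD: "card D \<le> 2 * k" by simp
  \<comment> \<open>\<open>w\<close> conjugates \<open>g\<close> to \<open>d\<close>, and
    \<open>v\<close> carries the conjugate \<open>?h d\<close> to the conjugate of \<open>g\<close>
    by \<open>v \<circ> ?c \<circ> w\<close>. So \<open>d\<close> restricts only \<open>w\<close>
    and \<open>?h d\<close> restricts only \<open>v\<close>, and for fixed \<open>d\<close> the
    number of bad pairs is a product.\<close>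
  define S1 where "S1 d = {s. s permutes {1..k} \<and> s \<circ> pair_perm k (?h d) \<circ> inv' s \<in> H}" for d
  define S2 where "S2 d = {s. s permutes {1..k} \<and> inv' s \<circ> pair_perm k d \<circ> s \<in> H}" for d
  define B where "B = (\<Union>d\<in>J. {v \<in> ?W. pair_perm k v \<in> S1 d} \<times> {w \<in> ?W. pair_perm k w \<in> S2 d})"
  have finJ: "finite J" using finD by (simp add: J_def)
  have finB: "finite B" using finW finJ by (simp add: B_def)
  have cS1: "card (S1 d) = conj_count k H (pair_perm k (?h d))" for d
  proof -
    have "bij_betw inv' (S1 d) {s. s permutes {1..k} \<and> inv' s \<circ> pair_perm k (?h d) \<circ> s \<in> H}"
      by (rule bij_betw_byWitness[where f' = "inv'"]) (auto simp: S1_def permutes_inv permutes_inv_inv)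
    then show ?thesis unfolding conj_count_def by (rule bij_betw_same_card)
  qed
  have cS2: "card (S2 d) = conj_count k H (pair_perm k d)" for d by (simp add: S2_def conj_count_def)
  have cBd: "card ({v \<in> ?W. pair_perm k v \<in> S1 d} \<times> {w \<in> ?W. pair_perm k w \<in> S2 d})
     = 4 ^ k * (conj_count k H (pair_perm k (?h d)) * conj_count k H (pair_perm k d))" for d
  proof -
    have "S1 d \<subseteq> ?P" "S2 d \<subseteq> ?P" by (auto simp: S1_def S2_def)
    moreover have "(4::nat) ^ k = 2 ^ k * 2 ^ k" by (simp flip: power_mult_distrib)
    ultimately show ?thesis using card_pair_perm[of "S1 d" k] card_pair_perm[of "S2 d" k]
      by (simp add: card_cartesian_product cS1 cS2)
  qed
  define Jr where "Jr = {d \<in> J. even (d 1)}"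
  define Jt where "Jt = {d \<in> J. odd (d 1)}"
  have "card B \<le> (\<Sum>d\<in>J. 4 ^ k * (conj_count k H (pair_perm k (?h d)) * conj_count k H (pair_perm k d)))"
    unfolding B_def cBd[symmetric] by (rule card_UN_le[OF finJ])
  also have "J = Jr \<union> Jt" by (auto simp: Jr_def Jt_def)
  also have "(\<Sum>d\<in>Jr \<union> Jt. 4 ^ k * (conj_count k H (pair_perm k (?h d)) * conj_count k H (pair_perm k d)))
    = (\<Sum>d\<in>Jr. 4 ^ k * (conj_count k H (pair_perm k (?h d)) * conj_count k H (pair_perm k d)))
    + (\<Sum>d\<in>Jt. 4 ^ k * (conj_count k H (pair_perm k (?h d)) * conj_count k H (pair_perm k d)))"
    using finJ by (intro sum.union_disjoint) (auto simp: Jr_def Jt_def)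
  also have "(\<Sum>d\<in>Jr. 4 ^ k * (conj_count k H (pair_perm k (?h d)) * conj_count k H (pair_perm k d)))
    \<le> (\<Sum>d\<in>Jr. 4 ^ k * Y)"
  proof (rule sum_mono)
    fix d assume d: "d \<in> Jr"
    then obtain e where e: "d 1 = 2 * e" by (auto simp: Jr_def)
    have dD: "d \<in> D" using d by (auto simp: Jr_def J_def)
    then have e2: "e \<in> {1..k}" using D1[OF dD] e by auto
    have "d \<in> ?W" "?h d \<in> ?W" using dD by (auto simp: D_def)
    note pp = pair_perm_refl[OF this e e2]
    have "conj_count k H (pair_perm k (?h d)) * conj_count k H (pair_perm k d) \<le> Y"
      unfolding pp using Y[OF e2] by (metis mult.commute)
    then show "4 ^ k * (conj_count k H (pair_perm k (?h d)) * conj_count k H (pair_perm k d)) \<le> 4 ^ k * Y"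
      by (rule mult_le_mono2)
  qed
  also have "(\<Sum>d\<in>Jr. 4 ^ k * Y) \<le> k * (4 ^ k * Y)"
  proof -
    have "inj_on (\<lambda>d. d 1 div 2) Jr"
    proof (rule inj_onI)
      fix d d' assume dd: "d \<in> Jr" "d' \<in> Jr" "d 1 div 2 = d' 1 div 2"
      then have "d 1 = d' 1" by (auto simp: Jr_def elim!: evenE)
      then show "d = d'" using inj1 dd by (auto simp: Jr_def J_def dest: inj_onD)
    qed
    moreover have "d 1 div 2 \<in> {1..k}" if "d \<in> Jr" for d
      using D1[of d] that by (auto simp: Jr_def J_def elim!: evenE)
    ultimately have "card Jr \<le> card {1..k}" by (intro card_inj_on_le[of "\<lambda>d. d 1 div 2"]) auto
    then show ?thesis by simp
  qed
  also have "(\<Sum>d\<in>Jt. 4 ^ k * (conj_count k H (pair_perm k (?h d)) * conj_count k H (pair_perm k d)))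
    \<le> (if even k then 4 ^ k * Z else 0)"
  proof -
    \<comment> \<open>A rotation that is a nontrivial involution must be the half turn.\<close>
    have turn: "d 1 = k + 1" if "d \<in> Jt" for d
    proof -
      have d: "d \<in> ?W" "?h d \<in> ?W" "odd (d 1)" "d \<noteq> id" "d ^^ 2 = id" "d 1 \<in> {1..2 * k}"
        using that D1[of d] by (auto simp: Jt_def J_def D_def)
      have "d (d 1) = 1" using fun_cong[OF d(5), of 1] by (simp add: numeral_2_eq_2)
      then have *: "(if d 1 + d 1 - 1 \<le> 2 * k then d 1 + d 1 - 1 else d 1 + d 1 - 1 - 2 * k) = 1"
        using shift_centralizer[OF d(1,2,6)] d(3) by simp
      have "d 1 \<noteq> 1"
      proof
        assume "d 1 = 1"
        then have "d i = i" if "i \<in> {1..2 * k}" for i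
          using shift_centralizer[OF d(1,2) that] that by simp
        then have "d = id" using permutes_not_in[OF Wd(1)[OF d(1)]] by (auto simp: fun_eq_iff)
        then show False using d(4) by simp
      qed
      then show ?thesis using * d(6) by (auto split: if_splits)
    qed
    show ?thesis
    proof (cases "even k")
      case False
      have "d \<notin> Jt" for d
      proof
        assume d: "d \<in> Jt"
        then have "odd (k + 1)" using turn[OF d] by (auto simp: Jt_def)
        then show False using False by simp
      qed
      then have "Jt = {}" by blast
      then show ?thesis by simp
    next
      case True
      have "Jt \<subseteq> D" by (auto simp: Jt_def J_def)
      then have "inj_on (\<lambda>d. d 1) Jt" using inj1 inj_on_subset by blast
      then have "card Jt \<le> card {k + 1}" using turn by (intro card_inj_on_le[of "\<lambda>d. d 1"]) auto
      then have c1: "card Jt \<le> 1" by simp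
      have "(\<Sum>d\<in>Jt. 4 ^ k * (conj_count k H (pair_perm k (?h d)) * conj_count k H (pair_perm k d)))
        \<le> (\<Sum>d\<in>Jt. 4 ^ k * Z)"
      proof (rule sum_mono)
        fix d assume d: "d \<in> Jt"
        then have "d \<in> ?W" "?h d \<in> ?W" by (auto simp: Jt_def J_def D_def)
        note pp = pair_perm_half_turn[OF this True k turn[OF d]]
        show "4 ^ k * (conj_count k H (pair_perm k (?h d)) * conj_count k H (pair_perm k d)) \<le> 4 ^ k * Z"
          unfolding pp using Z[OF True] unfolding power2_eq_square by (rule mult_le_mono2)
      qed
      also have "\<dots> \<le> 1 * (4 ^ k * Z)" using mult_le_mono1[OF c1, of "4 ^ k * Z"] by simp
      finally show ?thesis using True by simp
    qed
  qed
  finally have cB: "card B \<le> 4 ^ k * (k * Y + (if even k then Z else 0))"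
    by (simp add: algebra_simps split: if_splits)
  have "card (?W \<times> ?W - B) \<le> 2 * k * card (good (2 * k) ?V)"
  proof (rule card_double_coset_le[OF subgroup_W2 c _ _ _ finite_good])
    show "card {d \<in> ?W. ?h d \<in> ?W} \<le> 2 * k" using cD by (simp add: D_def)
    show "?W \<times> ?W - B \<subseteq> ?W \<times> ?W" by auto
    fix v w assume "(v, w) \<in> ?W \<times> ?W - B"
    then have vw: "v \<in> ?W" "w \<in> ?W" "(v, w) \<notin> B" by auto
    then have p: "v permutes {1..2 * k}" "w permutes {1..2 * k}" using Wd(1) by auto
    show "v \<circ> ?c \<circ> w \<in> good (2 * k) ?V"
      unfolding good_def bad_def
    proof (intro DiffI CollectI notI)
      show "v \<circ> ?c \<circ> w permutes {1..2 * k}" using p c by (intro permutes_compose)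
      assume "v \<circ> ?c \<circ> w \<in> {x. x permutes {1..2 * k} \<and>
        (\<exists>g\<in>?V. g \<noteq> id \<and> g ^^ 2 = id \<and> x \<circ> g \<circ> inv' x \<in> ?V)}"
      then obtain g where g: "g \<in> ?V" "g \<noteq> id" "g ^^ 2 = id"
        "v \<circ> ?c \<circ> w \<circ> g \<circ> inv' (v \<circ> ?c \<circ> w) \<in> ?V" by blast
      define d where "d = w \<circ> g \<circ> inv' w"
      let ?y = "v \<circ> ?c \<circ> w \<circ> g \<circ> inv' (v \<circ> ?c \<circ> w)"
      have gW: "g \<in> ?W" "?y \<in> ?W" using g by (auto simp: wreath_def)
      have hd: "?h d = inv' v \<circ> ?y \<circ> v"
        unfolding d_def by (rule conj_double_coset[OF p(1) c p(2)])
      have dW: "d \<in> ?W" using Wd(3,4) vw gW by (simp add: d_def)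
      have hW: "?h d \<in> ?W" unfolding hd by (rule Wd(3)[OF Wd(3)[OF Wd(4)[OF vw(1)] gW(2)] vw(1)])
      have "d \<noteq> id" using conj_eq_id[OF p(2)] g(2) by (auto simp: d_def)
      moreover have "d ^^ 2 = id"
        using conj_funpow[OF p(2), where g = g and i = 2] g(3) permutes_inv_o(1)[OF p(2)] by (simp add: d_def)
      ultimately have "d \<in> J" using dW hW by (auto simp: J_def D_def)
      moreover have "pair_perm k w \<in> S2 d"
      proof -
        have "g = inv' w \<circ> d \<circ> w" using permutes_inverses[OF p(2)] by (simp add: d_def fun_eq_iff)
        then have "pair_perm k g = inv' (pair_perm k w) \<circ> pair_perm k d \<circ> pair_perm k w"
          using pair_perm_comp[OF Wd(3)[OF W2_inv[OF vw(2)] dW] vw(2)] pair_perm_comp[OF W2_inv[OF vw(2)] dW]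
            pair_perm_permutes(2)[OF vw(2)] by simp
        then show ?thesis using g(1) pair_perm_permutes(1)[OF vw(2)] by (simp add: S2_def wreath_def)
      qed
      moreover have "pair_perm k v \<in> S1 d"
      proof -
        have "?y = v \<circ> ?h d \<circ> inv' v" unfolding hd using permutes_inverses[OF p(1)] by (simp add: fun_eq_iff)
        then have "pair_perm k ?y = pair_perm k v \<circ> pair_perm k (?h d) \<circ> inv' (pair_perm k v)"
          using pair_perm_comp[OF Wd(3)[OF vw(1) hW] W2_inv[OF vw(1)]] pair_perm_comp[OF vw(1) hW]
            pair_perm_permutes(2)[OF vw(1)] by simp
        then show ?thesis using g(4) pair_perm_permutes(1)[OF vw(1)] by (simp add: S1_def wreath_def)
      qed
      ultimately have "(v, w) \<in> B" using vw by (auto simp: B_def)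
      then show False using vw by simp
    qed
  qed
  moreover have "card (?W \<times> ?W - B) + card B \<ge> card (?W \<times> ?W)"
    using diff_card_le_card_Diff[OF finB, of "?W \<times> ?W"] by linarith
  moreover have "card (?W \<times> ?W) = 4 ^ k * (fact k)\<^sup>2"
  proof -
    have "(4::nat) ^ k = 2 ^ k * 2 ^ k" by (simp flip: power_mult_distrib)
    then show ?thesis using card_W2[of k] by (simp add: card_cartesian_product power2_eq_square)
  qed
  ultimately show ?thesis using cB by linarith
qed

section \<open>Choosing the group on the edges: odd k, k = 6, other even k\<close>

lemma card_prescribed_le:
  assumes "finite S" "distinct xs" "set xs \<subseteq> S"
  shows "card {s. s permutes S \<and> map s xs = ys} \<le> fact (card S - length xs)"
proof -
  have "card {s. s permutes S \<and> map s xs = ys} \<le> card {s. s permutes (S - set xs)}"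
  proof (rule coset_card_le[OF assms(1)])
    fix x y assume xy: "x \<in> {s. s permutes S \<and> map s xs = ys}" "y \<in> {s. s permutes S \<and> map s xs = ys}"
    then have p: "x permutes S" "y permutes S" by auto
    have "map x xs = map y xs" using xy by auto
    then have "x u = y u" if "u \<in> set xs" for u using that by simp
    then have "(inv' x \<circ> y) u = u" if "u \<in> set xs" for u
      using that permutes_inverses(2)[OF p(1)] by (metis comp_apply)
    then show "inv' x \<circ> y \<in> {s. s permutes (S - set xs)}"
      using permutes_superset[OF permutes_compose[OF p(2) permutes_inv[OF p(1)]], of "S - set xs"] by auto
  qed (use assms(1) in \<open>auto intro: finite_permutations\<close>)
  also have "\<dots> = fact (card S - length xs)"
    using assms by (simp add: card_permutations card_Diff_subset distinct_card)
  finally show ?thesis .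
qed

lemma refl_perm_fixed:
  assumes "p \<in> {1..k}" "e \<in> {1..k}"
  shows "refl_perm k e p = p \<longleftrightarrow> 2 * p = e + 1 \<or> 2 * p = e + 1 + k"
  using assms by (auto simp: refl_perm_def)

lemma half_turn_not_fixed:
  assumes "p \<in> {1..k}" "even k"
  shows "half_turn k p \<noteq> p"
  using assms by (auto simp: half_turn_def elim!: evenE)

text \<open>For odd \<open>k\<close> the stabilizer of one edge has odd index \<open>k\<close>.
  Every reflection fixes exactly one edge, to which \<open>s\<close> must send 1, so
  \<open>fact (k - 1)\<close> conjugators remain; there is no half turn.\<close>

lemma card_good_2_mod_4:
  assumes k: "odd k"
  shows "4 ^ k * (fact k)\<^sup>2 \<le> 2 * k * card (good (2 * k) (wreath k {s. s permutes {2..k}})) + 4 ^ k * (k * (fact (k - 1))\<^sup>2)"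
    "subgroup {s. s permutes {2..k}} (sym_group k)" "odd (fact k div card {s. s permutes {2..k}})"
proof -
  let ?H = "{s. s permutes {2..k}}"
  have k1: "k \<ge> 1" using k by (cases k) auto
  show H: "subgroup ?H (sym_group k)"
    by (rule subgroup_sym_groupI) (auto intro: permutes_subset permutes_compose permutes_inv)
  have "card ?H = fact (k - 1)" by (simp add: card_permutations)
  moreover have "fact k = k * fact (k - 1)" using k1 by (simp add: fact_reduce)
  ultimately show "odd (fact k div card ?H)" using k by simp
  have "conj_count k ?H (refl_perm k e) \<le> fact (k - 1)" if e: "e \<in> {1..k}" for e
  proof -
    \<comment> \<open>The fixed edge solves \<open>2 * q = e + 1\<close> modulo the odd
      \<open>k\<close>; for even \<open>e\<close> the representative \<open>e + 1 + k\<close> is the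
      even one.\<close>
    define q where "q = (if even e then (e + 1 + k) div 2 else (e + 1) div 2)"
    have uniq: "p = q" if "p \<in> {1..k}" "refl_perm k e p = p" for p
      using refl_perm_fixed[OF that(1) e] that(2) k unfolding q_def by (cases "even e") (auto, presburger+)
    have "conj_count k ?H (refl_perm k e) \<le> card {s. s permutes {1..k} \<and> map s [1] = [q]}"
      unfolding conj_count_def
    proof (rule card_mono)
      show "finite {s. s permutes {1..k} \<and> map s [1] = [q]}" by (simp add: finite_permutations)
      show "{s. s permutes {1..k} \<and> inv' s \<circ> refl_perm k e \<circ> s \<in> ?H} \<subseteq> {s. s permutes {1..k} \<and> map s [1] = [q]}"
      proof
        fix s assume s: "s \<in> {s. s permutes {1..k} \<and> inv' s \<circ> refl_perm k e \<circ> s \<in> ?H}"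
        then have p: "s permutes {1..k}" and g: "(inv' s \<circ> refl_perm k e \<circ> s) permutes {2..k}" by auto
        have "(inv' s \<circ> refl_perm k e \<circ> s) 1 = 1" by (rule permutes_not_in[OF g]) simp
        then have "refl_perm k e (s 1) = s 1" using permutes_inverses(1)[OF p] by (metis comp_apply)
        moreover have "s 1 \<in> {1..k}" using permutes_in_image[OF p] k1 by simp
        ultimately show "s \<in> {s. s permutes {1..k} \<and> map s [1] = [q]}" using uniq p by simp
      qed
    qed
    also have "\<dots> \<le> fact (k - 1)" using card_prescribed_le[of "{1..k}" "[1]" "[q]"] k1 by simp
    finally show ?thesis .
  qed
  then have "conj_count k ?H (refl_perm k e) * conj_count k ?H (refl_perm k (if e = k then 1 else e + 1))
    \<le> (fact (k - 1))\<^sup>2" if "e \<in> {1..k}" for e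
    using that unfolding power2_eq_square by (intro mult_mono) auto
  from card_good_even[OF H _ this, of 0] k k1
  show "4 ^ k * (fact k)\<^sup>2 \<le> 2 * k * card (good (2 * k) (wreath k ?H)) + 4 ^ k * (k * (fact (k - 1))\<^sup>2)"
    by simp
qed

lemma card_stab_set_ge:
  assumes "finite U" "S \<subseteq> U"
  shows "card {x. x permutes U \<and> x ` S = S} = fact (card S) * fact (card U - card S)"
proof -
  have "fact (card S) * fact (card U - card S) = card ({x. x permutes S} \<times> {x. x permutes (U - S)})"
    using assms by (simp add: card_cartesian_product card_permutations finite_subset card_Diff_subset)
  also have "\<dots> \<le> card {x. x permutes U \<and> x ` S = S}"
  proof (rule card_inj_on_le[of "\<lambda>(a, b). a \<circ> b"])
    show "inj_on (\<lambda>(a, b). a \<circ> b) ({x. x permutes S} \<times> {x. x permutes (U - S)})"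
    proof (rule inj_onI, clarify)
      fix a b a' b' assume p: "a permutes S" "b permutes (U - S)" "a' permutes S" "b' permutes (U - S)"
        and e: "a \<circ> b = a' \<circ> b'"
      have "a u = a' u" for u
      proof (cases "u \<in> S")
        case True
        then have "b u = u" "b' u = u" using permutes_not_in[OF p(2)] permutes_not_in[OF p(4)] by auto
        then show ?thesis using fun_cong[OF e, of u] by simp
      next
        case False
        then show ?thesis using permutes_not_in[OF p(1)] permutes_not_in[OF p(3)] by simp
      qed
      moreover have "b u = b' u" for u
      proof (cases "u \<in> U - S")
        case True
        then have "b u \<in> U - S" "b' u \<in> U - S"
          using permutes_in_image[OF p(2)] permutes_in_image[OF p(4)] by blast+
        then have "a (b u) = b u" "a' (b' u) = b' u"
          using permutes_not_in[OF p(1)] permutes_not_in[OF p(3)] by auto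
        then show ?thesis using fun_cong[OF e, of u] by simp
      next
        case False
        then show ?thesis using permutes_not_in[OF p(2)] permutes_not_in[OF p(4)] by simp
      qed
      ultimately show "a = a' \<and> b = b'" by auto
    qed
    show "(\<lambda>(a, b). a \<circ> b) ` ({x. x permutes S} \<times> {x. x permutes (U - S)}) \<subseteq> {x. x permutes U \<and> x ` S = S}"
    proof (rule image_subsetI, clarify, intro conjI)
      fix a b assume p: "a permutes S" "b permutes (U - S)"
      show "a \<circ> b permutes U"
        using p assms(2) by (intro permutes_compose) (auto intro: permutes_subset)
      have "b ` S = S" using permutes_not_in[OF p(2)] by (auto simp: image_def)
      then show "(a \<circ> b) ` S = S" using permutes_image[OF p(1)] by (metis image_comp)
    qed
  qed (use assms in \<open>simp add: finite_permutations\<close>)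
  finally show ?thesis using card_map_set_le[OF assms, of S] by simp
qed

text \<open>The general choice for even \<open>k\<close> would guarantee only about 8 per cent of
  all permutations here, less than the 18 per cent that \<open>mid_count 3 12\<close> alone takes
  up. The stabilizer of a pair of edges, also of odd index (15), loses less: 144 is
  \<open>6 * fact 4\<close>, and 7 counts six reflections and the half turn.\<close>

lemma card_good_12:
  defines "H \<equiv> {s. s permutes {1..6::nat} \<and> s ` {1,2} = {1,2}}"
  shows "4 ^ 6 * (fact 6)\<^sup>2 \<le> 12 * card (good 12 (wreath 6 H)) + 4 ^ 6 * (7 * 144\<^sup>2)"
    "subgroup H (sym_group 6)" "odd (fact 6 div card H)"
proof -
  show H: "subgroup H (sym_group 6)"
  proof (rule subgroup_sym_groupI)
    show "id \<in> H" by (simp add: H_def)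
    show "v \<circ> w \<in> H" if "v \<in> H" "w \<in> H" for v w
    proof -
      have "(v \<circ> w) ` {1,2} = v ` (w ` {1,2})" by (simp only: image_comp)
      also have "\<dots> = {1,2}" using that by (simp add: H_def)
      finally show ?thesis using that permutes_compose[of w "{1..6}" v] unfolding H_def by blast
    qed
    show "inv' w \<in> H" if "w \<in> H" for w
    proof -
      have p: "w permutes {1..6}" "w ` {1,2} = {1,2}" using that by (auto simp: H_def)
      have "inv' w ` (w ` {1,2}) = {1,2}" using permutes_inj[OF p(1)] by (simp only: image_inv_f_f)
      then show ?thesis using p permutes_inv by (simp add: H_def del: image_insert)
    qed
  qed (auto simp: H_def)
  have "card H = fact (card {1,2::nat}) * fact (card {1..6::nat} - card {1,2::nat})"
    unfolding H_def by (rule card_stab_set_ge) auto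
  then have "card H = 48" by (simp add: fact_numeral)
  then show "odd (fact 6 div card H)" by (simp add: fact_numeral)
  have count: "conj_count 6 H t \<le> 144" if two: "\<And>p. p \<in> {1..6} \<Longrightarrow> t p = p \<Longrightarrow> p = a \<or> p = b" for t a b
  proof -
    \<comment> \<open>A pair of edges preserved by \<open>t\<close> is either exchanged by
      \<open>t\<close> or consists of the two fixed edges \<open>a\<close> and \<open>b\<close>. In
      both cases \<open>s 1 = u\<close> forces \<open>s 2\<close>.\<close>
    define v where "v u = (if t u \<noteq> u then t u else if u = a then b else a)" for u
    have "conj_count 6 H t \<le> card (\<Union>u\<in>{1..6}. {s. s permutes {1..6} \<and> map s [1,2] = [u, v u]})"
      unfolding conj_count_def
    proof (rule card_mono)
      show "finite (\<Union>u\<in>{1..6}. {s. s permutes {1..6::nat} \<and> map s [1,2] = [u, v u]})"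
        by (simp add: finite_permutations)
      show "{s. s permutes {1..6} \<and> inv' s \<circ> t \<circ> s \<in> H} \<subseteq> (\<Union>u\<in>{1..6}. {s. s permutes {1..6} \<and> map s [1,2] = [u, v u]})"
      proof
        fix s assume "s \<in> {s. s permutes {1..6} \<and> inv' s \<circ> t \<circ> s \<in> H}"
        then have s: "s permutes {1..6}" and h: "inv' s \<circ> t \<circ> s \<in> H" by auto
        let ?g = "inv' s \<circ> t \<circ> s"
        have g: "?g permutes {1..6}" "?g ` {1,2} = {1,2}" using h by (auto simp: H_def)
        have sg: "s (?g u) = t (s u)" for u using permutes_inverses(1)[OF s] by simp
        have g12: "?g 1 \<in> {1,2}" "?g 2 \<in> {1,2}"
          using imageI[of 1 "{1,2}" ?g] imageI[of 2 "{1,2}" ?g] unfolding g(2) by blast+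
        have mem: "s 1 \<in> {1..6}" "s 2 \<in> {1..6}" using permutes_in_image[OF s] by auto
        have ne: "s 1 \<noteq> s 2" "?g 1 \<noteq> ?g 2"
          using inj_eq[OF permutes_inj[OF s], of 1 2] inj_eq[OF permutes_inj[OF g(1)], of 1 2] by simp_all
        have "s 2 = v (s 1)"
        proof (cases "?g 1 = 2")
          case True
          then have "t (s 1) = s 2" using sg[of 1] by simp
          then show ?thesis using ne by (simp add: v_def)
        next
          case False
          then have 1: "?g 1 = 1" using g12(1) by blast
          then have "?g 2 = 2" using g12(2) ne(2) by (metis insertE singletonD)
          with 1 have "t (s 1) = s 1" "t (s 2) = s 2" using sg[of 1] sg[of 2] by auto
          then show ?thesis using two[OF mem(1)] two[OF mem(2)] ne by (auto simp: v_def)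
        qed
        then show "s \<in> (\<Union>u\<in>{1..6}. {s. s permutes {1..6} \<and> map s [1,2] = [u, v u]})"
          using mem s by auto
      qed
    qed
    also have "\<dots> \<le> (\<Sum>u\<in>{1..6}. card {s. s permutes {1..6::nat} \<and> map s [1,2] = [u, v u]})"
      by (rule card_UN_le) simp
    also have "\<dots> \<le> (\<Sum>u\<in>{1..6::nat}. 24)"
    proof (rule sum_mono)
      fix u
      show "card {s. s permutes {1..6::nat} \<and> map s [1,2] = [u, v u]} \<le> 24"
        using card_prescribed_le[of "{1..6::nat}" "[1,2]" "[u, v u]"] by (simp add: fact_numeral)
    qed
    finally show ?thesis by simp
  qed
  have 1: "conj_count 6 H (refl_perm 6 e) \<le> 144" if e: "e \<in> {1..6}" for e
    by (rule count[of _ "(e + 1) div 2" "(e + 1 + 6) div 2"]) (use refl_perm_fixed[OF _ e] in auto)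
  have 2: "conj_count 6 H (half_turn 6) \<le> 144"
    by (rule count[of _ 1 1]) (use half_turn_not_fixed[of _ 6] in auto)
  have "conj_count 6 H (refl_perm 6 e) * conj_count 6 H (refl_perm 6 (if e = 6 then 1 else e + 1)) \<le> 144\<^sup>2"
    if "e \<in> {1..6}" for e
    using that unfolding power2_eq_square by (intro mult_mono 1) auto
  moreover have "(conj_count 6 H (half_turn 6))\<^sup>2 \<le> 144\<^sup>2" using 2 by (intro power_mono) auto
  ultimately have "4 ^ 6 * (fact 6)\<^sup>2 \<le> 2 * 6 * card (good (2 * 6) (wreath 6 H)) + 4 ^ 6 * (6 * 144\<^sup>2 + (if even (6::nat) then 144\<^sup>2 else 0))"
    by (intro card_good_even[OF H]) auto
  then show "4 ^ 6 * (fact 6)\<^sup>2 \<le> 12 * card (good 12 (wreath 6 H)) + 4 ^ 6 * (7 * 144\<^sup>2)" by simp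
qed

definition free_count :: "nat \<Rightarrow> nat"
  where "free_count k = k * fact (k - 2) + k * (k - 2)\<^sup>2 * fact (k - 4)"

lemma std_cyc_2_facts:
  assumes "even k" "a \<in> {1..k}"
  shows "std_cyc 2 a \<in> {1..k}" "std_cyc 2 a \<noteq> a" "std_cyc 2 (std_cyc 2 a) = a"
proof -
  have "a + 1 \<le> k" if "odd a" using assms that unfolding atLeastAtMost_iff by presburger
  then show "std_cyc 2 a \<in> {1..k}" "std_cyc 2 a \<noteq> a" "std_cyc 2 (std_cyc 2 a) = a"
    using assms by (cases "even a"; auto simp: std_cyc_def elim!: evenE)+
qed

text \<open>Let \<open>a\<close> and \<open>b\<close> be the preimages under \<open>s\<close> of 1
  and \<open>t 1\<close>. The conjugate of \<open>t\<close> sends \<open>a\<close> to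
  \<open>b\<close> and hence the partner of \<open>a\<close> to the partner of \<open>b\<close>.
  Either \<open>a\<close> and \<open>b\<close> are partners, which prescribes two values of
  \<open>s\<close> for each \<open>a\<close>, or four values are prescribed once \<open>a\<close>,
  \<open>b\<close> and the image \<open>f\<close> of the partner of \<open>a\<close> are chosen.
  These are the two summands of \<open>free_count\<close>.\<close>

lemma conj_count_free:
  assumes k: "even k" "k \<ge> 4" and free: "\<And>p. p \<in> {1..k} \<Longrightarrow> t p \<noteq> p"
  shows "conj_count k (std_cent 2 k) t \<le> free_count k"
proof -
  let ?\<nu> = "std_cyc 2" and ?K = "{1..k}"
  have H: "std_cent 2 k = cent ?K ?\<nu>" using k by (simp add: std_cent_def)
  define u where "u = t 1"
  define A where "A = (\<Union>a\<in>?K. {s. s permutes ?K \<and> map s [a, ?\<nu> a] = [1, u]})"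
  define B where "B = (\<Union>a\<in>?K. \<Union>f\<in>?K - {1, u}. \<Union>b\<in>?K - {a, ?\<nu> a}.
    {s. s permutes ?K \<and> map s [a, ?\<nu> a, b, ?\<nu> b] = [1, f, u, t f]})"
  show ?thesis
  proof (cases "u \<in> ?K")
    case False
    have "\<not> (s permutes ?K \<and> inv' s \<circ> t \<circ> s \<in> std_cent 2 k)" for s
    proof
      assume s: "s permutes ?K \<and> inv' s \<circ> t \<circ> s \<in> std_cent 2 k"
      then have g: "inv' s \<circ> t \<circ> s permutes ?K" using centD(1) unfolding H by blast
      have "inv' s 1 \<in> ?K" using s permutes_in_image[OF permutes_inv, of s ?K 1] k by simp
      then have "s ((inv' s \<circ> t \<circ> s) (inv' s 1)) \<in> ?K" using permutes_in_image g s by metis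
      then show False using False s permutes_inverses(1)[of s ?K] by (simp add: u_def)
    qed
    then have "{s. s permutes ?K \<and> inv' s \<circ> t \<circ> s \<in> std_cent 2 k} = {}" by blast
    then have "conj_count k (std_cent 2 k) t = 0" by (simp only: conj_count_def card.empty)
    then show ?thesis by simp
  next
    case uK: True
    have u1: "u \<noteq> 1" using free[of 1] k by (simp add: u_def)
    have fin: "finite A" "finite B" by (auto simp: A_def B_def finite_permutations)
    have "{s. s permutes ?K \<and> inv' s \<circ> t \<circ> s \<in> std_cent 2 k} \<subseteq> A \<union> B"
    proof
      fix s assume "s \<in> {s. s permutes ?K \<and> inv' s \<circ> t \<circ> s \<in> std_cent 2 k}"
      then have s: "s permutes ?K" and h: "inv' s \<circ> t \<circ> s \<in> cent ?K ?\<nu>" by (auto simp: H)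
      note si = permutes_inverses[OF s]
      have sinj: "s x = s y \<longleftrightarrow> x = y" for x y using permutes_inj[OF s] by (auto simp: inj_eq)
      define a where "a = inv' s 1"
      define b where "b = inv' s u"
      define f where "f = s (?\<nu> a)"
      have aK: "a \<in> ?K" using permutes_in_image[OF permutes_inv[OF s], of 1] k by (simp add: a_def)
      have bK: "b \<in> ?K" using permutes_in_image[OF permutes_inv[OF s], of u] uK by (simp add: b_def)
      have sa: "s a = 1" "s b = u" using si by (auto simp: a_def b_def)
      note na = std_cyc_2_facts[OF k(1) aK] and nb = std_cyc_2_facts[OF k(1) bK]
      have fK: "f \<in> ?K" using permutes_in_image[OF s] na(1) by (simp add: f_def)
      have f1: "f \<noteq> 1" using na(2) sa sinj by (metis f_def)
      show "s \<in> A \<union> B"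
      proof (cases "f = u")
        case True
        then have "map s [a, ?\<nu> a] = [1, u]" using sa by (simp add: f_def)
        then show ?thesis using s aK by (auto simp: A_def)
      next
        case False
        have "(inv' s \<circ> t \<circ> s) (?\<nu> a) = ?\<nu> ((inv' s \<circ> t \<circ> s) a)" using centD(2)[OF h aK] .
        then have "inv' s (t f) = ?\<nu> b" using sa by (simp add: f_def b_def u_def)
        then have "s (?\<nu> b) = t f" using si(1) by metis
        then have m: "map s [a, ?\<nu> a, b, ?\<nu> b] = [1, f, u, t f]" using sa by (simp add: f_def)
        have "b \<noteq> a" "b \<noteq> ?\<nu> a" using sa u1 False by (auto simp: f_def)
        then have "f \<in> ?K - {1, u}" "b \<in> ?K - {a, ?\<nu> a}" using bK fK f1 False by auto
        then have "s \<in> B" unfolding B_def using s m aK by (intro UN_I CollectI conjI)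
        then show ?thesis by simp
      qed
    qed
    then have "conj_count k (std_cent 2 k) t \<le> card (A \<union> B)"
      unfolding conj_count_def using fin by (intro card_mono) auto
    also have "\<dots> \<le> card A + card B" by (rule card_Un_le)
    also have "card A \<le> k * fact (k - 2)"
    proof -
      have "card A \<le> (\<Sum>a\<in>?K. card {s. s permutes ?K \<and> map s [a, ?\<nu> a] = [1, u]})"
        unfolding A_def by (rule card_UN_le) simp
      also have "\<dots> \<le> (\<Sum>a\<in>?K. fact (k - 2))"
      proof (rule sum_mono)
        fix a assume a: "a \<in> ?K"
        note na = std_cyc_2_facts[OF k(1) a]
        show "card {s. s permutes ?K \<and> map s [a, ?\<nu> a] = [1, u]} \<le> fact (k - 2)"
          using card_prescribed_le[of ?K "[a, ?\<nu> a]" "[1, u]"] a na by (auto simp: numeral_2_eq_2)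
      qed
      finally show ?thesis by simp
    qed
    also have "card B \<le> k * ((k - 2) * ((k - 2) * fact (k - 4)))"
    proof -
      have "card B \<le> (\<Sum>a\<in>?K. card (\<Union>f\<in>?K - {1, u}. \<Union>b\<in>?K - {a, ?\<nu> a}.
        {s. s permutes ?K \<and> map s [a, ?\<nu> a, b, ?\<nu> b] = [1, f, u, t f]}))"
        unfolding B_def by (rule card_UN_le) simp
      also have "\<dots> \<le> (\<Sum>a\<in>?K. (k - 2) * ((k - 2) * fact (k - 4)))"
      proof (rule sum_mono)
        fix a assume a: "a \<in> ?K"
        note na = std_cyc_2_facts[OF k(1) a]
        have "card (\<Union>f\<in>?K - {1, u}. \<Union>b\<in>?K - {a, ?\<nu> a}.
          {s. s permutes ?K \<and> map s [a, ?\<nu> a, b, ?\<nu> b] = [1, f, u, t f]}) \<le>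
          (\<Sum>f\<in>?K - {1, u}. card (\<Union>b\<in>?K - {a, ?\<nu> a}.
          {s. s permutes ?K \<and> map s [a, ?\<nu> a, b, ?\<nu> b] = [1, f, u, t f]}))"
          by (rule card_UN_le) simp
        also have "\<dots> \<le> (\<Sum>f\<in>?K - {1, u}. (k - 2) * fact (k - 4))"
        proof (rule sum_mono)
          fix f
          have "card (\<Union>b\<in>?K - {a, ?\<nu> a}.
            {s. s permutes ?K \<and> map s [a, ?\<nu> a, b, ?\<nu> b] = [1, f, u, t f]}) \<le>
            (\<Sum>b\<in>?K - {a, ?\<nu> a}. card {s. s permutes ?K \<and> map s [a, ?\<nu> a, b, ?\<nu> b] = [1, f, u, t f]})"
            by (rule card_UN_le) simp
          also have "\<dots> \<le> (\<Sum>b\<in>?K - {a, ?\<nu> a}. fact (k - 4))"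
          proof (rule sum_mono)
            fix b assume b: "b \<in> ?K - {a, ?\<nu> a}"
            then have bK: "b \<in> ?K" by simp
            note nb = std_cyc_2_facts[OF k(1) bK]
            have "?\<nu> b \<noteq> a" "?\<nu> b \<noteq> ?\<nu> a" using b na(3) nb(3) by (metis DiffD2 insertCI)+
            then have "distinct [a, ?\<nu> a, b, ?\<nu> b]" "set [a, ?\<nu> a, b, ?\<nu> b] \<subseteq> ?K"
              using b na nb a by auto
            from card_prescribed_le[OF _ this, of "[1, f, u, t f]"]
            show "card {s. s permutes ?K \<and> map s [a, ?\<nu> a, b, ?\<nu> b] = [1, f, u, t f]} \<le> fact (k - 4)"
              by (simp add: numeral_eq_Suc)
          qed
          also have "\<dots> = (k - 2) * fact (k - 4)"
          proof -
            have "card (?K - {a, ?\<nu> a}) = k - 2" using a na by (simp add: card_Diff_subset)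
            then show ?thesis by simp
          qed
          finally show "card (\<Union>b\<in>?K - {a, ?\<nu> a}.
            {s. s permutes ?K \<and> map s [a, ?\<nu> a, b, ?\<nu> b] = [1, f, u, t f]}) \<le> (k - 2) * fact (k - 4)" .
        qed
        also have "\<dots> = (k - 2) * ((k - 2) * fact (k - 4))"
        proof -
          have "card (?K - {1, u}) = k - 2" using uK u1 k by (simp add: card_Diff_subset)
          then show ?thesis by simp
        qed
        finally show "card (\<Union>f\<in>?K - {1, u}. \<Union>b\<in>?K - {a, ?\<nu> a}.
          {s. s permutes ?K \<and> map s [a, ?\<nu> a, b, ?\<nu> b] = [1, f, u, t f]}) \<le> (k - 2) * ((k - 2) * fact (k - 4))" .
      qed
      finally show ?thesis by simp
    qed
    finally show ?thesis by (simp add: free_count_def power2_eq_square mult.assoc)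
  qed
qed

text \<open>Let \<open>c\<close> be the preimage of \<open>a\<close>. The conjugate of
  \<open>t\<close> fixes \<open>c\<close>, hence also the partner of \<open>c\<close>, which must be
  the preimage of the second fixed point \<open>b\<close>. So \<open>c\<close> prescribes two values
  of \<open>s\<close>.\<close>

lemma conj_count_two_fixed:
  assumes k: "even k" and ab: "t a = a" "a \<in> {1..k}"
    and two: "\<And>p. p \<in> {1..k} \<Longrightarrow> t p = p \<Longrightarrow> p = a \<or> p = b"
  shows "conj_count k (std_cent 2 k) t \<le> k * fact (k - 2)"
proof -
  let ?\<nu> = "std_cyc 2" and ?K = "{1..k}"
  have H: "std_cent 2 k = cent ?K ?\<nu>" using k by (simp add: std_cent_def)
  have "conj_count k (std_cent 2 k) t \<le> card (\<Union>c\<in>?K. {s. s permutes ?K \<and> map s [c, ?\<nu> c] = [a, b]})"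
    unfolding conj_count_def
  proof (rule card_mono)
    show "finite (\<Union>c\<in>?K. {s. s permutes ?K \<and> map s [c, ?\<nu> c] = [a, b]})" by (simp add: finite_permutations)
    show "{s. s permutes ?K \<and> inv' s \<circ> t \<circ> s \<in> std_cent 2 k} \<subseteq> (\<Union>c\<in>?K. {s. s permutes ?K \<and> map s [c, ?\<nu> c] = [a, b]})"
    proof
      fix s assume "s \<in> {s. s permutes ?K \<and> inv' s \<circ> t \<circ> s \<in> std_cent 2 k}"
      then have s: "s permutes ?K" and h: "inv' s \<circ> t \<circ> s \<in> cent ?K ?\<nu>" by (auto simp: H)
      note si = permutes_inverses[OF s]
      define c where "c = inv' s a"
      have cK: "c \<in> ?K" using permutes_in_image[OF permutes_inv[OF s], of a] ab by (simp add: c_def)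
      have sc: "s c = a" using si by (simp add: c_def)
      note nc = std_cyc_2_facts[OF k cK]
      have "(inv' s \<circ> t \<circ> s) (?\<nu> c) = ?\<nu> ((inv' s \<circ> t \<circ> s) c)" using centD(2)[OF h cK] .
      then have "inv' s (t (s (?\<nu> c))) = ?\<nu> c" using sc ab by (simp add: c_def)
      then have "t (s (?\<nu> c)) = s (?\<nu> c)" using si(1) by metis
      moreover have "s (?\<nu> c) \<in> ?K" using permutes_in_image[OF s] nc(1) by simp
      moreover have "s (?\<nu> c) \<noteq> a" using nc(2) sc permutes_inj[OF s] by (metis injD)
      ultimately have "s (?\<nu> c) = b" using two by blast
      then show "s \<in> (\<Union>c\<in>?K. {s. s permutes ?K \<and> map s [c, ?\<nu> c] = [a, b]})" using s sc cK by auto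
    qed
  qed
  also have "\<dots> \<le> (\<Sum>c\<in>?K. card {s. s permutes ?K \<and> map s [c, ?\<nu> c] = [a, b]})"
    by (rule card_UN_le) simp
  also have "\<dots> \<le> (\<Sum>c\<in>?K. fact (k - 2))"
  proof (rule sum_mono)
    fix c assume c: "c \<in> ?K"
    note nc = std_cyc_2_facts[OF k c]
    show "card {s. s permutes ?K \<and> map s [c, ?\<nu> c] = [a, b]} \<le> fact (k - 2)"
      using card_prescribed_le[of ?K "[c, ?\<nu> c]" "[a, b]"] c nc by (auto simp: numeral_2_eq_2)
  qed
  finally show ?thesis by simp
qed

text \<open>For even \<open>k\<close> the edges are themselves matched in pairs, and
  \<open>H\<close> is the stabilizer of that matching. A reflection with odd \<open>e\<close> fixes
  two edges; the others and the half turn fix none.\<close>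

lemma card_good_0_mod_4:
  assumes k: "even k" "k \<ge> 4"
  shows "4 ^ k * (fact k)\<^sup>2 \<le> 2 * k * card (good (2 * k) (wreath k (std_cent 2 k)))
    + 4 ^ k * (k * (k * fact (k - 2) * free_count k) + (free_count k)\<^sup>2)"
proof -
  let ?H = "std_cent 2 k"
  have H: "subgroup ?H (sym_group k)" using std_cent_index(1)[of 2 k] by simp
  have odd: "conj_count k ?H (refl_perm k e) \<le> k * fact (k - 2)" if e: "e \<in> {1..k}" "odd e" for e
  proof (rule conj_count_two_fixed[OF k(1), of _ "(e + 1) div 2" "(e + 1 + k) div 2"])
    show a: "(e + 1) div 2 \<in> {1..k}" using e by (auto elim!: oddE)
    show "refl_perm k e ((e + 1) div 2) = (e + 1) div 2"
      using refl_perm_fixed[OF a e(1)] e(2) by simp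
    show "p = (e + 1) div 2 \<or> p = (e + 1 + k) div 2" if "p \<in> {1..k}" "refl_perm k e p = p" for p
      using refl_perm_fixed[OF that(1) e(1)] that(2) by auto
  qed
  have even: "conj_count k ?H (refl_perm k e) \<le> free_count k" if e: "e \<in> {1..k}" "even e" for e
  proof (rule conj_count_free[OF k])
    fix p assume p: "p \<in> {1..k}"
    show "refl_perm k e p \<noteq> p" using refl_perm_fixed[OF p e(1)] e(2) k(1) by presburger
  qed
  have half: "conj_count k ?H (half_turn k) \<le> free_count k"
    by (rule conj_count_free[OF k]) (rule half_turn_not_fixed[OF _ k(1)])
  \<comment> \<open>Neighbouring parameters have opposite parity, also across the wrap from the even
    \<open>k\<close> to 1, so each product has one factor of either kind.\<close>
  have "conj_count k ?H (refl_perm k e) * conj_count k ?H (refl_perm k (if e = k then 1 else e + 1))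
    \<le> k * fact (k - 2) * free_count k" if e: "e \<in> {1..k}" for e
  proof (cases "even e")
    case True
    then have "conj_count k ?H (refl_perm k (if e = k then 1 else e + 1)) \<le> k * fact (k - 2)"
      using e by (intro odd) auto
    from mult_le_mono[OF even[OF e True] this] show ?thesis by (simp add: mult.commute)
  next
    case False
    then have "e \<noteq> k" using k(1) by auto
    then have "conj_count k ?H (refl_perm k (if e = k then 1 else e + 1)) \<le> free_count k"
      using e False by (intro even) auto
    from mult_le_mono[OF odd[OF e False] this] show ?thesis .
  qed
  moreover have "(conj_count k ?H (half_turn k))\<^sup>2 \<le> (free_count k)\<^sup>2" using half by (intro power_mono) auto
  ultimately show ?thesis using card_good_even[OF H] k by simp
qed

section \<open>Numerical estimates\<close>

definition odd_bound :: "nat \<Rightarrow> nat \<Rightarrow> nat"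
  where "odd_bound p m = mid_count p m +
    ((p ^ (m div p) * fact (m div p) - 1)\<^sup>2 * (p ^ (m div p) * fact (m div p) * fact (m mod p))) div (p - 1)"

text \<open>For \<open>m = 6\<close> the general bound, 288, is too weak.\<close>

definition three_bound :: "nat \<Rightarrow> nat"
  where "three_bound m = (if m = 6 then 72 else mid_count 3 m +
    ((free3_count (m div 3))\<^sup>2 * (3 ^ (m div 3) * fact (m div 3) * fact (m mod 3))) div 2)"

text \<open>The factor 2 pays for the alternating group: for \<open>p \<ge> 5\<close> all bad
  permutations are charged against the even half of the good ones. The sum runs over all odd numbers
  from 5 to \<open>m\<close>, which avoids primality in the computation.\<close>

definition total_bound :: "nat \<Rightarrow> nat"
  where "total_bound m = three_bound m + 2 * (\<Sum>j=2..<(m + 1) div 2. odd_bound (2 * j + 1) m)"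

text \<open>The correction terms of \<open>card_good_even\<close> without the factor
  \<open>4 ^ k\<close>, for the three choices of \<open>H\<close>.\<close>

definition pair_loss :: "nat \<Rightarrow> nat"
  where "pair_loss k = (if odd k then k * (fact (k - 1))\<^sup>2 else if k = 6 then 7 * 144\<^sup>2
    else k * (k * fact (k - 2) * free_count k) + (free_count k)\<^sup>2)"

text \<open>The exceptional 8192 is \<open>128 ^ 2 div 2\<close>: a double coset of a group of order
  128 with fibres of size at most two.\<close>

definition good_bound :: "nat \<Rightarrow> nat"
  where "good_bound m = (let k = m div 2 in if odd m then (2 ^ k * fact k)\<^sup>2 else if m = 8 then 8192
    else (4 ^ k * ((fact k)\<^sup>2 - pair_loss k)) div (2 * k))"

section \<open>Binomial inequalities\<close>

text \<open>The left-hand side is a single term of Vandermonde's sum.\<close>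

lemma binomial_mult_le: "(a choose i) * (b choose j) \<le> (a + b) choose (i + j)"
proof -
  have "(a choose i) * (b choose (i + j - i)) \<le> (\<Sum>k\<le>i + j. (a choose k) * (b choose (i + j - k)))"
    by (rule member_le_sum) auto
  then show ?thesis by (simp add: vandermonde)
qed

lemma binomial_left_mono: "n \<le> m \<Longrightarrow> (n choose j) \<le> (m choose j)"
  using binomial_mult_le[of n j "m - n" 0] by simp

lemma binomial_central_mono:
  assumes "i \<le> j" "i + j \<le> n"
  shows "(n choose i) \<le> (n choose j)"
proof (cases "2 * j \<le> n")
  case True
  then show ?thesis using assms by (intro binomial_mono) auto
next
  case False
  then have "(n choose i) \<le> (n choose (n - j))" using assms by (intro binomial_mono) auto
  then show ?thesis using assms binomial_symmetric[of j n] by simp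
qed

lemma choose_2_eq: "2 * ((n + 2) choose 2) = (n + 2) * (n + 1)"
  using Suc_times_binomial_eq[of "Suc n" "Suc 0"] by (simp add: numeral_2_eq_2)

lemma choose_3_eq: "6 * ((n + 3) choose 3) = (n + 3) * (n + 2) * (n + 1)"
proof -
  have "Suc (n + 2) * ((n + 2) choose 2) = (Suc (n + 2) choose Suc 2) * Suc 2"
    by (rule Suc_times_binomial_eq)
  moreover have "Suc (n + 2) = n + 3" "Suc 2 = (3::nat)" by simp_all
  ultimately have "(n + 3) * ((n + 2) choose 2) = ((n + 3) choose 3) * 3" by metis
  then have "6 * ((n + 3) choose 3) = (n + 3) * (2 * ((n + 2) choose 2))" by simp
  then show ?thesis unfolding choose_2_eq by (simp only: mult.assoc)
qed

lemma choose_4_eq: "24 * ((n + 4) choose 4) = (n + 4) * (n + 3) * (n + 2) * (n + 1)"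
proof -
  have "Suc (n + 3) * ((n + 3) choose 3) = (Suc (n + 3) choose Suc 3) * Suc 3"
    by (rule Suc_times_binomial_eq)
  moreover have "Suc (n + 3) = n + 4" "Suc 3 = (4::nat)" by simp_all
  ultimately have "(n + 4) * ((n + 3) choose 3) = ((n + 4) choose 4) * 4" by metis
  then have "24 * ((n + 4) choose 4) = (n + 4) * (6 * ((n + 3) choose 3))" by simp
  then show ?thesis unfolding choose_3_eq by (simp only: mult.assoc)
qed

lemma choose_2_real: "n \<ge> 2 \<Longrightarrow> real (n choose 2) = real n * (real n - 1) / 2"
proof -
  assume "n \<ge> 2"
  then obtain q where q: "n = q + 2" by (metis add.commute le_Suc_ex)
  have "real (2 * ((q + 2) choose 2)) = real ((q + 2) * (q + 1))" by (simp only: choose_2_eq)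
  then show ?thesis using q by (simp add: algebra_simps)
qed

lemma choose_3_real: "n \<ge> 3 \<Longrightarrow> real (n choose 3) = real n * (real n - 1) * (real n - 2) / 6"
proof -
  assume "n \<ge> 3"
  then obtain q where q: "n = q + 3" by (metis add.commute le_Suc_ex)
  have "real (6 * ((q + 3) choose 3)) = real ((q + 3) * (q + 2) * (q + 1))" by (simp only: choose_3_eq)
  then show ?thesis using q by (simp add: algebra_simps)
qed

lemma choose_4_real:
  "n \<ge> 4 \<Longrightarrow> real (n choose 4) = real n * (real n - 1) * (real n - 2) * (real n - 3) / 24"
proof -
  assume "n \<ge> 4"
  then obtain q where q: "n = q + 4" by (metis add.commute le_Suc_ex)
  have "real (24 * ((q + 4) choose 4)) = real ((q + 4) * (q + 3) * (q + 2) * (q + 1))" by (simp only: choose_4_eq)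
  then show ?thesis using q by (simp add: algebra_simps)
qed

section \<open>Estimates for the prime three\<close>

lemma mid_count_real:
  assumes "p > 0"
  shows "real (mid_count p m) / fact m = (\<Sum>l=1..<m div p. (real (m div p choose l))\<^sup>2 / real (m choose (p * l)))"
proof -
  have "real ((m div p choose l)\<^sup>2 * fact (p * l) * fact (m - p * l)) / fact m
      = (real (m div p choose l))\<^sup>2 / real (m choose (p * l))" if "l \<in> {1..<m div p}" for l
  proof -
    have "p * l \<le> p * (m div p)" using that by simp
    then have le: "p * l \<le> m" using times_div_less_eq_dividend[of p m] by linarith
    have "real (m choose (p * l)) = fact m / (fact (p * l) * fact (m - p * l))"
      by (rule binomial_fact[OF le])
    then show ?thesis by simp
  qed
  then show ?thesis unfolding mid_count_def of_nat_sum sum_divide_distrib by (intro sum.cong) auto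
qed

text \<open>Vandermonde applied twice. The cube absorbs the square in the numerator of a term of
  \<open>mid_count\<close> and leaves the reciprocal of a binomial coefficient.\<close>

lemma choose_cube_le:
  "(k choose l) ^ 3 \<le> (3 * k) choose (3 * l)"
proof -
  have "(k choose l) * ((k choose l) * (k choose l)) \<le> (k choose l) * ((k + k) choose (l + l))"
    by (intro mult_le_mono2 binomial_mult_le)
  also have "\<dots> \<le> (k + (k + k)) choose (l + (l + l))" by (rule binomial_mult_le)
  finally show ?thesis by (simp add: numeral_3_eq_3 mult.assoc)
qed

lemma mid_term_le:
  assumes "l \<in> {1..<m div 3}"
  shows "(real (m div 3 choose l))\<^sup>2 / real (m choose (3 * l)) \<le> 1 / real (m div 3 choose l)"
proof -
  let ?k = "m div 3"
  have pos: "(?k choose l) > 0" using assms by simp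
  have "(?k choose l) ^ 3 \<le> m choose (3 * l)"
    using choose_cube_le[of ?k l] binomial_left_mono[of "3 * ?k" m "3 * l"] by simp
  then have "real (?k choose l) ^ 3 \<le> real (m choose (3 * l))" by (metis of_nat_le_iff of_nat_power)
  then have "(real (?k choose l))\<^sup>2 / real (m choose (3 * l)) \<le> (real (?k choose l))\<^sup>2 / real (?k choose l) ^ 3"
    using pos by (intro divide_left_mono) (auto intro!: mult_pos_pos zero_less_power)
  then show ?thesis using pos by (simp add: power2_eq_square power3_eq_cube)
qed

text \<open>The end terms \<open>l = 1\<close> and \<open>l = k - 1\<close> have order
  \<open>1 / k\<close> and are computed with \<open>3 * k\<close> in place of \<open>m\<close>. The
  terms next to them are at most the reciprocal of \<open>k choose 2\<close>, all others at most
  that of \<open>k choose 3\<close>.\<close>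

lemma mid_3_le:
  assumes "k = m div 3" "k \<ge> 14"
  shows "real (mid_count 3 m) / fact m \<le> 4 * k / ((3 * k - 1) * (3 * k - 2)) + 4 / (k * (k - 1))
    + 6 * (k - 5) / (k * (k - 1) * (real k - 2))"
proof -
  define t1 where "t1 = 2 * real k / ((3 * k - 1) * (3 * k - 2))"
  define t2 where "t2 = 2 / (real k * (k - 1))"
  define t3 where "t3 = 6 / (real k * (k - 1) * (real k - 2))"
  let ?f = "\<lambda>l. (real (k choose l))\<^sup>2 / real (m choose (3 * l))"
  have C3: "real (3 * k choose 3) = real k * (3 * k - 1) * (3 * k - 2) / 2"
    using choose_3_real[of "3 * k"] assms(2) by (simp add: of_nat_diff)
  have e1: "(real k)\<^sup>2 / real (3 * k choose 3) = t1"
  proof -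
    have "(real k)\<^sup>2 / (real k * a * b / 2) = 2 * real k / (a * b)" for a b
      using assms(2) by (simp add: power2_eq_square)
    then show ?thesis unfolding C3 t1_def by simp
  qed
  have mono: "real (3 * k choose j) \<le> real (m choose j)" for j
    using assms(1) by (auto intro!: binomial_left_mono)
  have C3pos: "0 < real (3 * k choose 3)" using assms(2) by simp
  have b1: "?f 1 \<le> t1"
  proof -
    have "0 < real (m choose 3)" using mono[of 3] C3pos by linarith
    then have "(real k)\<^sup>2 / real (m choose 3) \<le> (real k)\<^sup>2 / real (3 * k choose 3)"
      using mono[of 3] C3pos by (intro divide_left_mono mult_pos_pos zero_le_power2)
    then show ?thesis unfolding e1[symmetric] by simp
  qed
  have bk: "?f (k - 1) \<le> t1"
  proof -
    have "(3 * k choose (3 * (k - 1))) = (3 * k choose 3)"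
      using binomial_symmetric[of 3 "3 * k"] assms(2) by (simp add: algebra_simps diff_mult_distrib2)
    then have "real (3 * k choose 3) \<le> real (m choose (3 * (k - 1)))" using mono[of "3 * (k - 1)"] by simp
    moreover have "(k choose (k - 1)) = k" using binomial_symmetric[of 1 k] assms(2) by simp
    moreover have "0 < real (m choose (3 * (k - 1)))" using calculation(1) C3pos by linarith
    ultimately show ?thesis unfolding e1[symmetric] using C3pos
      by (simp only:) (intro divide_left_mono mult_pos_pos zero_le_power2)
  qed
  have inv: "?f l \<le> 1 / real (k choose j)" if "l \<in> {1..<k}" "j \<le> l" "j + l \<le> k" for l j
  proof -
    have "(k choose j) \<le> (k choose l)" by (rule binomial_central_mono[OF that(2,3)])
    then have "1 / real (k choose l) \<le> 1 / real (k choose j)"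
      using that by (intro divide_left_mono) auto
    moreover have "?f l \<le> 1 / real (k choose l)" using mid_term_le[of l m] that assms(1) by simp
    ultimately show ?thesis by linarith
  qed
  have c2: "1 / real (k choose 2) = t2" and c3: "1 / real (k choose 3) = t3"
  proof -
    have r: "real (k choose 2) = real k * (real k - 1) / 2"
      "real (k choose 3) = real k * (real k - 1) * (real k - 2) / 6"
      using choose_2_real[of k] choose_3_real[of k] assms(2) by linarith+
    show "1 / real (k choose 2) = t2" "1 / real (k choose 3) = t3"
      unfolding r t2_def t3_def using assms(2) by (simp_all add: of_nat_diff)
  qed
  have split: "{1..<k} = insert 1 (insert (k - 1) (insert 2 (insert (k - 2) {3..<k - 2})))"
    using assms(2) by auto
  have "(\<Sum>l=1..<k. ?f l) = ?f 1 + (?f (k - 1) + (?f 2 + (?f (k - 2) + (\<Sum>l=3..<k - 2. ?f l))))"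
  proof -
    have n: "1 \<notin> insert (k - 1) (insert 2 (insert (k - 2) {3..<k - 2}))"
      "k - 1 \<notin> insert 2 (insert (k - 2) {3..<k - 2})" "2 \<notin> insert (k - 2) {3..<k - 2}"
      "k - 2 \<notin> {3..<k - 2}"
      using assms(2) by auto
    show ?thesis unfolding split
      by (simp only: sum.insert n finite_insert finite_atLeastLessThan not_False_eq_True)
  qed
  also have "\<dots> \<le> t1 + (t1 + (t2 + (t2 + (\<Sum>l=3..<k - 2. t3))))"
  proof (intro add_mono b1 bk sum_mono)
    show "?f 2 \<le> t2" "?f (k - 2) \<le> t2" unfolding c2[symmetric] using assms(2) by (intro inv; auto)+
    show "?f l \<le> t3" if "l \<in> {3..<k - 2}" for l unfolding c3[symmetric] using that by (intro inv) auto
  qed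
  also have "\<dots> = 2 * t1 + 2 * t2 + (k - 5) * t3" using assms(2) by simp
  finally show ?thesis using mid_count_real[of 3 m] assms
    by (simp add: t1_def t2_def t3_def mult.commute)
qed

lemma free3_count_values: "free3_count 1 = 2" "free3_count 2 = 4" "free3_count 3 = 26" "free3_count 4 = 160" "free3_count 5 = 752" "free3_count 6 = 6184"
  "free3_count 7 = 55568" "free3_count 8 = 395392" "free3_count 9 = 3907520" "free3_count 10 = 43823104"
proof -
  note s = free3_count.simps(2) and d[simp del] = free3_count.simps(2)
  show v1: "free3_count 1 = 2" using s[of 0] by simp
  show v2: "free3_count 2 = 4" using s[of 1] v1 by (simp add: numeral_2_eq_2)
  show v3: "free3_count 3 = 26" using s[of 2] v2 by simp
  show v4: "free3_count 4 = 160" using s[of 3] v3 v1 by simp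
  show v5: "free3_count 5 = 752" using s[of 4] v4 v2 by simp
  show v6: "free3_count 6 = 6184" using s[of 5] v5 v3 by simp
  show v7: "free3_count 7 = 55568" using s[of 6] v6 v4 by simp
  show v8: "free3_count 8 = 395392" using s[of 7] v7 v5 by simp
  show v9: "free3_count 9 = 3907520" using s[of 8] v8 v6 by simp
  show v10: "free3_count 10 = 43823104" using s[of 9] v9 v7 by simp
qed

text \<open>From \<open>k = 11\<close> on the recursion sustains itself, as
  \<open>2 + 9 = 11 \<le> k\<close>. Up to \<open>k = 10\<close> the values are computed; the
  largest ratio to the factorial, about 12.08 at \<open>k = 10\<close>, leads to 13.\<close>

lemma free3_count_le: "free3_count k \<le> 13 * fact k"
proof (induction k rule: less_induct)
  case (less k)
  show ?case
  proof (cases "k \<le> 10")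
    case True
    then have "k = 0 \<or> k = 1 \<or> k = 2 \<or> k = 3 \<or> k = 4 \<or> k = 5 \<or> k = 6 \<or> k = 7 \<or> k = 8 \<or> k = 9 \<or> k = 10"
      by presburger
    then show ?thesis
      by (elim disjE) (simp_all only: free3_count_values free3_count.simps(1) fact_0 fact_1 fact_2, simp_all add: fact_numeral)
  next
    case False
    define q where "q = k - 3"
    have q: "k = Suc (Suc (Suc q))" "q \<ge> 8" using False by (auto simp: q_def)
    have "free3_count k = 2 * free3_count (q + 2) + 9 * (q + 2) * (q + 1) * free3_count q"
      using free3_count.simps(2)[of "q + 2"] q(1) by (simp del: free3_count.simps)
    also have "\<dots> \<le> 2 * (13 * fact (q + 2)) + 9 * (q + 2) * (q + 1) * (13 * fact q)"
    proof (intro add_mono mult_le_mono2)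
      show "free3_count (q + 2) \<le> 13 * fact (q + 2)" "free3_count q \<le> 13 * fact q"
        using q(1) by (auto intro!: less.IH simp del: free3_count.simps fact_Suc)
    qed
    also have "\<dots> = 143 * fact (q + 2)" by (simp add: algebra_simps)
    also have "\<dots> \<le> 13 * (k * fact (q + 2))"
    proof -
      have "11 * fact (q + 2) \<le> k * fact (q + 2)" using q by (intro mult_le_mono1) simp
      then show ?thesis by linarith
    qed
    also have "k * fact (q + 2) = fact k" using q by simp
    finally show ?thesis .
  qed
qed

text \<open>Equality holds at \<open>k = 1\<close>, and the right-hand side grows at least as fast.
  The factor \<open>4 ^ k\<close> makes the contribution of fixed-point-free elements geometrically
  small.\<close>

lemma fact_cube_le: "k \<ge> 1 \<Longrightarrow> 4 ^ k * (3 ^ k * (fact k) ^ 3) \<le> 2 * (fact (3 * k) :: real)"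
proof (induction k rule: nat_induct_at_least)
  case base
  then show ?case by (simp add: fact_numeral)
next
  case (Suc k)
  have f: "fact (3 * Suc k) = real (3 * k + 3) * real (3 * k + 2) * real (3 * k + 1) * fact (3 * k)"
    by (simp add: numeral_3_eq_3 algebra_simps)
  have "4 ^ Suc k * (3 ^ Suc k * (fact (Suc k)) ^ 3 :: real)
    = 12 * real (k + 1) ^ 3 * (4 ^ k * (3 ^ k * (fact k) ^ 3))"
    by (simp add: power_mult_distrib)
  also have "\<dots> \<le> 12 * real (k + 1) ^ 3 * (2 * fact (3 * k))"
    using Suc.IH by (intro mult_left_mono) auto
  also have "\<dots> \<le> real (3 * k + 3) * real (3 * k + 2) * real (3 * k + 1) * (2 * fact (3 * k))"
  proof (intro mult_right_mono)
    define y where "y = real k - 1"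
    have y: "y \<ge> 0" "real k = y + 1" using Suc.hyps by (auto simp: y_def)
    have "4 * ((y + 2) * (y + 2)) \<le> (3 * y + 5) * (3 * y + 4)" using y(1) by (simp add: algebra_simps)
    then have "3 * (y + 2) * (4 * ((y + 2) * (y + 2))) \<le> 3 * (y + 2) * ((3 * y + 5) * (3 * y + 4))"
      using y(1) by (intro mult_left_mono) auto
    then show "12 * real (k + 1) ^ 3 \<le> real (3 * k + 3) * real (3 * k + 2) * real (3 * k + 1)"
      by (simp add: power3_eq_cube y(2) algebra_simps)
  qed simp
  finally show ?case unfolding f by simp
qed

text \<open>169 is the square of the 13 in \<open>free3_count_le\<close>; the 2 of
  \<open>fact_cube_le\<close> cancels the division by \<open>p - 1 = 2\<close>.\<close>

lemma full_3_le:
  assumes "k = m div 3" "k \<ge> 1"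
  shows "real ((free3_count k)\<^sup>2 * (3 ^ k * fact k * fact (m mod 3)) div 2) / fact m \<le> 169 / 4 ^ k"
proof -
  have m: "m = 3 * k + m mod 3" using assms(1) by simp
  have "(fact (3 * k) * fact (m mod 3) :: nat) dvd fact m"
    using fact_fact_dvd_fact[of "3 * k" "m mod 3", where 'a = nat] m by simp
  then have "fact (3 * k) * fact (m mod 3) \<le> (fact m :: nat)" by (rule dvd_imp_le) simp
  then have fm: "fact (3 * k) * fact (m mod 3) \<le> (fact m :: real)"
    by (metis of_nat_fact of_nat_le_iff of_nat_mult)
  have "real ((free3_count k)\<^sup>2 * (3 ^ k * fact k * fact (m mod 3)) div 2) \<le> real ((free3_count k)\<^sup>2 * (3 ^ k * fact k * fact (m mod 3))) / 2"
  proof -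
    have "2 * (N div 2) \<le> N" for N :: nat by simp
    then have "real (2 * (N div 2)) \<le> real N" for N :: nat by (simp only: of_nat_le_iff)
    then have "real (N div 2) \<le> real N / 2" for N :: nat by simp
    then show ?thesis .
  qed
  also have "\<dots> = (real (free3_count k))\<^sup>2 * (3 ^ k * fact k * fact (m mod 3)) / 2" by simp
  also have "\<dots> \<le> (13 * fact k)\<^sup>2 * (3 ^ k * fact k * fact (m mod 3)) / 2"
  proof -
    have "real (free3_count k) \<le> 13 * fact k" using free3_count_le[of k] by (metis of_nat_fact of_nat_le_iff of_nat_mult of_nat_numeral)
    then show ?thesis by (intro divide_right_mono mult_right_mono power_mono) auto
  qed
  also have "\<dots> = 169 / 2 * (3 ^ k * (fact k) ^ 3) * fact (m mod 3)"
    by (simp add: power2_eq_square power3_eq_cube)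
  also have "\<dots> \<le> 169 / 2 * (2 * fact (3 * k) / 4 ^ k) * fact (m mod 3)"
    using fact_cube_le[OF assms(2)] by (intro mult_right_mono mult_left_mono) (auto simp: field_simps)
  also have "\<dots> = 169 / 4 ^ k * (fact (3 * k) * fact (m mod 3))" by simp
  also have "\<dots> \<le> 169 / 4 ^ k * fact m" using fm by (intro mult_left_mono) auto
  finally show ?thesis by (simp add: field_simps)
qed

lemma three_bound_large:
  assumes "m \<ge> 44"
  shows "real (three_bound m) / fact m \<le> 3.7 / m"
proof -
  define k where "k = m div 3"
  have k: "k \<ge> 14" "m \<le> 3 * k + 2" using assms by (auto simp: k_def)
  define x where "x = real k"
  have x: "x \<ge> 14" and mx: "real m \<le> 3 * x + 2" using k by (auto simp: x_def)
  have m0: "0 < real m" using assms by simp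
  have "4 ^ n \<ge> (100000::real) * (n + 1)" if "n \<ge> 14" for n :: nat
    using that by (induction n rule: nat_induct_at_least) auto
  then have p4: "(4::real) ^ k \<ge> 100000 * (x + 1)" using k(1) by (simp add: x_def algebra_simps)
  have "real (three_bound m) / fact m = real (mid_count 3 m) / fact m +
    real ((free3_count k)\<^sup>2 * (3 ^ k * fact k * fact (m mod 3)) div 2) / fact m"
    using assms by (simp add: three_bound_def k_def add_divide_distrib)
  also have "\<dots> \<le> (4 * k / ((3 * k - 1) * (3 * k - 2)) + 4 / (k * (k - 1))
    + 6 * (k - 5) / (k * (k - 1) * (real k - 2))) + 169 / 4 ^ k"
    using mid_3_le[OF k_def k(1)] full_3_le[OF k_def] k(1) by (intro add_mono) auto
  also have "\<dots> = (4 * x / ((3 * x - 1) * (3 * x - 2)) + 4 / (x * (x - 1))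
    + 6 * (x - 5) / (x * (x - 1) * (x - 2))) + 169 / 4 ^ k"
    using k by (simp add: x_def of_nat_diff)
  finally have main: "real (three_bound m) / fact m * m \<le> (4 * x / ((3 * x - 1) * (3 * x - 2)) + 4 / (x * (x - 1))
    + 6 * (x - 5) / (x * (x - 1) * (x - 2)) + 169 / 4 ^ k) * m" using m0 by (intro mult_right_mono) auto
  also have "\<dots> \<le> (4 * x / ((3 * x - 1) * (3 * x - 2)) + 4 / (x * (x - 1))
    + 6 * (x - 5) / (x * (x - 1) * (x - 2)) + 169 / 4 ^ k) * (3 * x + 2)"
    using mx x by (intro mult_left_mono add_nonneg_nonneg divide_nonneg_nonneg) auto
  also have "\<dots> = 4 * x * (3 * x + 2) / ((3 * x - 1) * (3 * x - 2)) + 4 * (3 * x + 2) / (x * (x - 1))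
    + 6 * (x - 5) * (3 * x + 2) / (x * (x - 1) * (x - 2)) + 169 * (3 * x + 2) / 4 ^ k"
    by (simp add: distrib_right)
  \<comment> \<open>The first three numbers lie just above the values of the summands at
    \<open>x = 14\<close>. Substituting \<open>x = y + 14\<close> leaves polynomials in
    \<open>y\<close> with nonnegative coefficients. The four numbers add up to 3.7.\<close>
  also have "\<dots> \<le> 1.52 + 0.98 + 1.1 + 0.1"
  proof (intro add_mono)
    define y where "y = x - 14"
    have y: "y \<ge> 0" "x = y + 14" using x by (auto simp: y_def)
    show "4 * x * (3 * x + 2) / ((3 * x - 1) * (3 * x - 2)) \<le> 1.52"
    proof -
      have "1.52 * ((3 * x - 1) * (3 * x - 2)) - 4 * x * (3 * x + 2) = 1.68 * (y * y) + 25.36 * y + 28.8"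
        unfolding y(2) by (simp add: algebra_simps)
      moreover have "1.68 * (y * y) + 25.36 * y + 28.8 \<ge> 0" using y(1) by simp
      ultimately have "4 * x * (3 * x + 2) \<le> 1.52 * ((3 * x - 1) * (3 * x - 2))" by linarith
      then show ?thesis using x by (simp add: pos_divide_le_eq)
    qed
    show "4 * (3 * x + 2) / (x * (x - 1)) \<le> 0.98"
    proof -
      have "0.98 * (x * (x - 1)) - 4 * (3 * x + 2) = 0.98 * (y * y) + 14.46 * y + 2.36"
        unfolding y(2) by (simp add: algebra_simps)
      moreover have "0.98 * (y * y) + 14.46 * y + 2.36 \<ge> 0" using y(1) by simp
      ultimately have "4 * (3 * x + 2) \<le> 0.98 * (x * (x - 1))" by linarith
      then show ?thesis using x by (simp add: pos_divide_le_eq)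
    qed
    show "6 * (x - 5) * (3 * x + 2) / (x * (x - 1) * (x - 2)) \<le> 1.1"
    proof -
      have "1.1 * (x * (x - 1) * (x - 2)) - 6 * (x - 5) * (3 * x + 2)
          = 1.1 * (y * y * y) + 24.9 * (y * y) + 130.6 * y + 26.4"
        unfolding y(2) by (simp add: algebra_simps)
      moreover have "1.1 * (y * y * y) + 24.9 * (y * y) + 130.6 * y + 26.4 \<ge> 0" using y(1) by simp
      ultimately have "6 * (x - 5) * (3 * x + 2) \<le> 1.1 * (x * (x - 1) * (x - 2))" by linarith
      then show ?thesis using x by (simp add: pos_divide_le_eq)
    qed
    show "169 * (3 * x + 2) / 4 ^ k \<le> 0.1"
    proof -
      have "169 * (3 * x + 2) \<le> 0.1 * (100000 * (x + 1))" using x by simp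
      also have "\<dots> \<le> 0.1 * 4 ^ k" using p4 by simp
      finally show ?thesis by (simp add: pos_divide_le_eq)
    qed
  qed
  finally show ?thesis using m0 by (simp add: field_simps)
qed

section \<open>Estimates for the primes from five on\<close>

text \<open>Splitting \<open>p\<close> as \<open>3 + (p - 3)\<close> keeps the cube needed for one
  term of \<open>mid_count\<close> and leaves a second binomial, which supplies the decay for larger
  \<open>p\<close>.\<close>

lemma choose_mult_cube_le:
  assumes "p \<ge> 3"
  shows "(k choose l) ^ 3 * (((p - 3) * k) choose ((p - 3) * l)) \<le> (p * k) choose (p * l)"
proof -
  have "(k choose l) ^ 3 * (((p - 3) * k) choose ((p - 3) * l))
    \<le> ((3 * k) choose (3 * l)) * (((p - 3) * k) choose ((p - 3) * l))"
    by (intro mult_le_mono1 choose_cube_le)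
  also have "\<dots> \<le> (3 * k + (p - 3) * k) choose (3 * l + (p - 3) * l)" by (rule binomial_mult_le)
  also have "\<dots> = (p * k) choose (p * l)"
    using assms by (simp flip: distrib_right)
  finally show ?thesis .
qed

text \<open>After cancelling the square, one factor \<open>k choose l \<ge> k\<close> is left over
  and absorbs the number of terms, which is \<open>k - 1\<close>.\<close>

lemma mid_count_le:
  assumes p: "p \<ge> 3" and k: "k = m div p" and j: "j \<le> p - 3"
  shows "real (mid_count p m) / fact m \<le> 1 / real (((p - 3) * k) choose j)"
proof (cases "k \<le> 1")
  case True
  then have "mid_count p m = 0" using k by (simp add: mid_count_def)
  then show ?thesis by simp
next
  case False
  define q where "q = (p - 3) * k"
  have "2 * j \<le> 2 * (p - 3)" using j by simp
  also have "\<dots> \<le> k * (p - 3)" using False by (intro mult_le_mono1) simp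
  also have "\<dots> = q" by (simp add: q_def)
  finally have jq: "2 * j \<le> q" .
  then have q0: "0 < real (q choose j)" by simp
  have "(real (k choose l))\<^sup>2 / real (m choose (p * l)) \<le> 1 / (real k * real (q choose j))" if l: "l \<in> {1..<k}" for l
  proof -
    have jl: "j \<le> (p - 3) * l" and lq: "(p - 3) * l + (p - 3) \<le> q"
    proof -
      have "p - 3 \<le> (p - 3) * l" using l by simp
      then show "j \<le> (p - 3) * l" using j by (rule le_trans[rotated])
      have "(p - 3) * (l + 1) \<le> (p - 3) * k" using l by (intro mult_le_mono2) simp
      then show "(p - 3) * l + (p - 3) \<le> q" by (simp add: q_def)
    qed
    then have c1: "(q choose j) \<le> (q choose ((p - 3) * l))" using j by (intro binomial_central_mono jl) linarith
    have c2: "k \<le> (k choose l)" using binomial_central_mono[of 1 l k] l by simp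
    have "(k choose l)\<^sup>2 * (k * (q choose j)) \<le> (k choose l)\<^sup>2 * ((k choose l) * (q choose ((p - 3) * l)))"
      by (intro mult_le_mono2 mult_le_mono c1 c2)
    also have "\<dots> = (k choose l) ^ 3 * (q choose ((p - 3) * l))" by (simp add: power3_eq_cube power2_eq_square)
    also have "\<dots> \<le> (p * k) choose (p * l)" unfolding q_def by (rule choose_mult_cube_le[OF p])
    also have "\<dots> \<le> m choose (p * l)" using k by (intro binomial_left_mono) simp
    finally have "real ((k choose l)\<^sup>2 * (k * (q choose j))) \<le> real (m choose (p * l))" by (simp only: of_nat_le_iff)
    then have le: "(real (k choose l))\<^sup>2 * (real k * real (q choose j)) \<le> real (m choose (p * l))" by simp
    have pos: "0 < (real (k choose l))\<^sup>2" "0 < real k * real (q choose j)" using l q0 by auto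
    have "0 < real (m choose (p * l))" using le mult_pos_pos[OF pos] by linarith
    then show ?thesis using le pos by (simp add: field_simps)
  qed
  then have "(\<Sum>l=1..<k. (real (k choose l))\<^sup>2 / real (m choose (p * l))) \<le> (\<Sum>l=1..<k. 1 / (real k * real (q choose j)))"
    by (intro sum_mono)
  also have "\<dots> = (real k - 1) / real k * (1 / real (q choose j))" using False by (simp add: of_nat_diff)
  also have "\<dots> \<le> 1 * (1 / real (q choose j))"
    using False by (intro mult_right_mono) (auto simp: pos_divide_le_eq)
  finally show ?thesis using mid_count_real[of p m] p k by (simp add: q_def)
qed

lemma prod_top_le:
  assumes "p \<ge> Suc r" "k \<ge> 1"
  shows "fact (p * (k - 1)) * (\<Prod>i\<le>r. real (p * k - i)) \<le> fact (p * k)"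
proof -
  have le: "p * (k - 1) + Suc r \<le> p * k"
    using assms by (cases k) (auto simp: algebra_simps)
  have "fact n * (\<Prod>i\<le>r. real (n + Suc r - i)) = fact (n + Suc r)" for n
  proof (induction r)
    case (Suc r)
    have "(\<Prod>i\<le>Suc r. real (n + Suc (Suc r) - i)) = real (n + Suc (Suc r)) * (\<Prod>i\<le>r. real (n + Suc r - i))"
      by (subst prod.atMost_Suc_shift) simp
    then show ?case using Suc by (simp add: mult.assoc mult.left_commute)
  qed simp
  note * = this[of "p * k - Suc r"]
  have "p * k - Suc r + Suc r = p * k" using le by simp
  with * have "fact (p * k - Suc r) * (\<Prod>i\<le>r. real (p * k - i)) = fact (p * k)" by (simp only:)
  moreover have "(fact (p * (k - 1)) :: real) \<le> fact (p * k - Suc r)" using le by (intro fact_mono) simp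
  moreover have "0 \<le> (\<Prod>i\<le>r. real (p * k - i))" by (intro prod_nonneg) simp
  ultimately show ?thesis by (metis mult_right_mono)
qed

text \<open>Compares the cube of the order of the centralizer with \<open>fact (p * k)\<close>.
  Passing from \<open>k - 1\<close> to \<open>k\<close> multiplies the cube by
  \<open>(p * k) ^ 3\<close> and the factorial by more than three factors of about that size. The
  surplus \<open>d\<close> is 1 in the inductions and of order \<open>m ^ 2\<close> in one final
  step.\<close>

lemma wreath_cube_step:
  fixes c d :: real
  assumes "p \<ge> Suc r" "k \<ge> 1" "(real p ^ (k - 1) * fact (k - 1)) ^ 3 \<le> c * fact (p * (k - 1))"
    and "real (p * k) ^ 3 * d \<le> (\<Prod>i\<le>r. real (p * k - i))" "d \<ge> 0" "c \<ge> 0"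
  shows "d * (real p ^ k * fact k) ^ 3 \<le> c * fact (p * k)"
proof -
  have "real p ^ k * fact k = real (p * k) * (real p ^ (k - 1) * fact (k - 1))"
    using assms(2) by (cases k) (simp_all add: algebra_simps)
  then have "d * (real p ^ k * fact k) ^ 3 = (real (p * k) ^ 3 * d) * (real p ^ (k - 1) * fact (k - 1)) ^ 3"
    by (simp add: power_mult_distrib)
  also have "\<dots> \<le> (\<Prod>i\<le>r. real (p * k - i)) * (c * fact (p * (k - 1)))"
    using assms(3-6) by (intro mult_mono prod_nonneg) auto
  also have "\<dots> = c * (fact (p * (k - 1)) * (\<Prod>i\<le>r. real (p * k - i)))" by simp
  also have "\<dots> \<le> c * fact (p * k)" using prod_top_le[OF assms(1,2)] assms(6) by (intro mult_left_mono) auto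
  finally show ?thesis .
qed

lemma full_div_le:
  assumes p: "p \<ge> 2" and k: "k = m div p" and c: "(real p ^ k * fact k) ^ 3 * c \<le> (real p - 1) * fact (p * k)" "c > 0"
  shows "real ((p ^ k * fact k - 1)\<^sup>2 * (p ^ k * fact k * fact (m mod p)) div (p - 1)) / fact m \<le> 1 / c"
proof -
  define w where "w = p ^ k * fact k"
  have w1: "w \<ge> 1" using p by (simp add: w_def Suc_le_eq)
  have rw: "real w = real p ^ k * fact k" by (simp add: w_def)
  have m: "m = p * k + m mod p" using k by simp
  have "(fact (p * k) * fact (m mod p) :: nat) dvd fact m"
    using fact_fact_dvd_fact[of "p * k" "m mod p", where 'a = nat] m by simp
  then have "fact (p * k) * fact (m mod p) \<le> (fact m :: nat)" by (rule dvd_imp_le) simp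
  then have fm: "fact (p * k) * fact (m mod p) \<le> (fact m :: real)"
    by (metis of_nat_fact of_nat_le_iff of_nat_mult)
  define N where "N = (w - 1)\<^sup>2 * (w * fact (m mod p)) div (p - 1)"
  have "N * (p - 1) \<le> (w - 1)\<^sup>2 * (w * fact (m mod p))" unfolding N_def by simp
  also have "\<dots> \<le> w\<^sup>2 * (w * fact (m mod p))" by (intro mult_le_mono1 power_mono) auto
  also have "\<dots> = w ^ 3 * fact (m mod p)" by (simp add: power3_eq_cube power2_eq_square)
  finally have "real (N * (p - 1)) \<le> real (w ^ 3 * fact (m mod p))" by (simp only: of_nat_le_iff)
  then have "real N * (real p - 1) \<le> real w ^ 3 * fact (m mod p)" using p by (simp add: of_nat_diff)
  then have "real N * (real p - 1) * c \<le> (real w ^ 3 * c) * fact (m mod p)"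
    using c(2) by (simp add: mult.assoc mult.left_commute[of _ c] mult.commute[of _ c])
  also have "\<dots> \<le> ((real p - 1) * fact (p * k)) * fact (m mod p)"
    using c(1) unfolding rw by (intro mult_right_mono) auto
  also have "\<dots> \<le> (real p - 1) * fact m" using fm p by (simp add: mult.assoc mult_left_mono)
  finally have "(real p - 1) * (real N * c) \<le> (real p - 1) * fact m" by (simp add: mult_ac)
  then have "real N * c \<le> fact m" using p by simp
  then show ?thesis using c(2) by (simp add: N_def w_def field_simps)
qed

lemma wreath_cube_le_7:
  assumes "p \<ge> 7"
  shows "(real p ^ k * fact k) ^ 3 \<le> fact (p * k)"
proof (induction k)
  case (Suc k)
  define n where "n = p * Suc k"
  have n: "n \<ge> 7" using assms by (simp add: n_def)
  have P: "(\<Prod>i\<le>6. real (n - i)) = real n * (real n - 1) * (real n - 2) * (real n - 3) * (real n - 4) * (real n - 5) * (real n - 6)"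
    using n by (simp add: numeral_eq_Suc of_nat_diff mult_ac)
  define y where "y = real n - 7"
  have y: "y \<ge> 0" "real n = y + 7" using n by (auto simp: y_def)
  have a: "y + 7 \<le> 2 * (y + 6)" "y + 7 \<le> 2 * (y + 5)" using y by auto
  have "real n ^ 3 * 1 = (y + 7) * ((y + 7) * (y + 7))" by (simp add: y(2) power3_eq_cube)
  also have "\<dots> \<le> (y + 7) * ((2 * (y + 6)) * (2 * (y + 5)))"
    using a y by (intro mult_left_mono mult_mono) auto
  also have "\<dots> \<le> (y + 7) * (y + 6) * (y + 5) * (4 * 1 * 1 * 1)" by (simp add: algebra_simps)
  also have "\<dots> \<le> (y + 7) * (y + 6) * (y + 5) * ((y + 4) * (y + 3) * (y + 2) * (y + 1))"
    using y by (intro mult_left_mono mult_mono mult_nonneg_nonneg) auto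
  also have "\<dots> = (\<Prod>i\<le>6. real (n - i))" unfolding P by (simp add: y(2) mult_ac add_ac)
  finally have "1 * (real p ^ Suc k * fact (Suc k)) ^ 3 \<le> 1 * fact (p * Suc k)"
    using assms Suc.IH unfolding n_def by (intro wreath_cube_step[of 6]) auto
  then show ?case by simp
qed simp

text \<open>The constant is the case \<open>k = 1\<close>, where the quotient is
  \<open>125 / 120\<close>.\<close>

lemma wreath_cube_le_5:
  assumes "k \<ge> 1"
  shows "(5 ^ k * fact k) ^ 3 \<le> 25 / 24 * (fact (5 * k) :: real)"
  using assms
proof (induction k rule: nat_induct_at_least)
  case base
  show ?case by (simp add: fact_numeral)
next
  case (Suc k)
  define n where "n = 5 * Suc k"
  have n: "n \<ge> 10" using Suc.hyps by (simp add: n_def)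
  have P: "(\<Prod>i\<le>4. real (n - i)) = real n * (real n - 1) * (real n - 2) * (real n - 3) * (real n - 4)"
    using n by (simp add: numeral_eq_Suc of_nat_diff mult_ac)
  define y where "y = real n - 10"
  have y: "y \<ge> 0" "real n = y + 10" using n by (auto simp: y_def)
  have "real n ^ 3 * 1 = (y + 10) * ((y + 10) * (y + 10))" by (simp add: y(2) power3_eq_cube)
  also have "\<dots> \<le> (y + 10) * ((2 * (y + 9)) * (2 * (y + 8)))"
    using y by (intro mult_left_mono mult_mono) auto
  also have "\<dots> = (y + 10) * (y + 9) * (y + 8) * (4 * 1)" by (simp add: algebra_simps)
  also have "\<dots> \<le> (y + 10) * (y + 9) * (y + 8) * ((y + 7) * (y + 6))"
    using y by (intro mult_left_mono mult_mono mult_nonneg_nonneg) auto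
  also have "\<dots> = (\<Prod>i\<le>4. real (n - i))" unfolding P by (simp add: y(2) mult_ac add_ac)
  finally have "1 * (real 5 ^ Suc k * fact (Suc k)) ^ 3 \<le> 25 / 24 * fact (5 * Suc k)"
    using Suc.IH unfolding n_def by (intro wreath_cube_step[of 4]) auto
  then show ?case by simp
qed

lemma odd_bound_7_le:
  assumes p: "p \<ge> 7" "p \<le> m" and m: "m \<ge> 44"
  shows "real (odd_bound p m) / fact m \<le> 2 / (real m)\<^sup>2"
proof -
  define k where "k = m div p"
  define n where "n = p * k"
  have k1: "k \<ge> 1" using p by (simp add: k_def div_greater_zero_iff Suc_le_eq)
  have mn: "m < n + p" unfolding n_def k_def using p by (metis add.commute add_less_cancel_left
    mod_less_divisor mult_div_mod_eq not_less_iff_gr_or_eq not_numeral_le_zero zero_less_iff_neq_zero less_le_trans zero_less_numeral)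
  have pn: "p \<le> n" using k1 by (simp add: n_def)
  have n23: "n \<ge> 23" "m < 2 * n" using mn pn m by auto
  have full: "real ((p ^ k * fact k - 1)\<^sup>2 * (p ^ k * fact k * fact (m mod p)) div (p - 1)) / fact m \<le> 1 / (real m)\<^sup>2"
  proof (rule full_div_le[OF _ k_def])
    \<comment> \<open>The lost factor 6 is recovered from the division by
      \<open>p - 1 \<ge> 6\<close>.\<close>
    define d where "d = (real m)\<^sup>2 / 6"
    have "(real m)\<^sup>2 \<le> (2 * real n)\<^sup>2" using n23 by (intro power_mono) auto
    then have d: "d \<le> 2 / 3 * (real n)\<^sup>2" "d \<ge> 0" by (auto simp: d_def power_mult_distrib)
    have P: "(\<Prod>i\<le>6. real (n - i)) = real n * (real n - 1) * (real n - 2) * (real n - 3) * (real n - 4) * (real n - 5) * (real n - 6)"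
      using n23 by (simp add: numeral_eq_Suc of_nat_diff mult_ac)
    let ?n = "real n" and ?h = "real n / 2"
    have n': "?n \<ge> 23" using n23 by simp
    have "?n ^ 3 * d \<le> ?n ^ 3 * (2 / 3 * ?n\<^sup>2)" using d by (intro mult_left_mono) auto
    also have "\<dots> \<le> ?n * (?h * ?h * ?h * ?h) * (16 * 16)"
      using n' by (simp add: power3_eq_cube power2_eq_square)
    also have "\<dots> \<le> ?n * ((?n - 1) * (?n - 2) * (?n - 3) * (?n - 4)) * ((?n - 5) * (?n - 6))"
      using n' by (intro mult_mono mult_nonneg_nonneg) auto
    also have "\<dots> = (\<Prod>i\<le>6. real (n - i))" unfolding P by (simp only: mult_ac)
    finally have "d * (real p ^ k * fact k) ^ 3 \<le> 1 * fact (p * k)"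
      using p k1 d(2) wreath_cube_le_7[OF p(1), of "k - 1"] unfolding n_def
      by (intro wreath_cube_step[of 6]) auto
    then have "(real p ^ k * fact k) ^ 3 * (real m)\<^sup>2 \<le> 6 * fact (p * k)" by (simp add: d_def mult_ac)
    also have "\<dots> \<le> (real p - 1) * fact (p * k)" using p by (intro mult_right_mono) auto
    finally show "(real p ^ k * fact k) ^ 3 * (real m)\<^sup>2 \<le> (real p - 1) * fact (p * k)" .
  qed (use p m in auto)
  have mid: "real (mid_count p m) / fact m \<le> 1 / (real m)\<^sup>2"
  proof (cases "k \<le> 1")
    case True
    then have "mid_count p m = 0" using k_def by (simp add: mid_count_def)
    then show ?thesis by simp
  next
    case False
    \<comment> \<open>For \<open>k \<ge> 2\<close> the rest modulo \<open>p\<close> is less than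
      \<open>n / 2\<close>, so \<open>m < 3 / 2 * n\<close>; and
      \<open>p - 3 \<ge> 4 / 7 * p\<close>. Together \<open>q\<close> exceeds
      \<open>8 / 21 * m\<close>, and a binomial of lower index 4 beats \<open>m ^ 2\<close>.\<close>
    define q where "q = (p - 3) * k"
    have "2 * p \<le> n" using False by (simp add: n_def)
    then have "2 * m < 3 * n" using mn by simp
    moreover have "4 * n \<le> 7 * q"
    proof -
      have "4 * p * k \<le> 7 * (p - 3) * k" using p by (intro mult_le_mono1) simp
      then show ?thesis by (simp add: n_def q_def mult.assoc)
    qed
    ultimately have q: "8 * m < 21 * q" by linarith
    then have q17: "real q \<ge> 17" using m by simp
    define z where "z = real q - 17"
    have z: "z \<ge> 0" "real q = z + 17" using q17 by (auto simp: z_def)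
    have qm: "real m \<le> 21 / 8 * real q" using q by simp
    have "(real m)\<^sup>2 \<le> (21 / 8 * real q)\<^sup>2" using qm by (intro power_mono) auto
    also have "\<dots> \<le> real q * (real q - 1) * (real q - 2) * (real q - 3) / 24"
    proof -
      have "24 * (441 / 64) * (z + 17) \<le> (z + 16) * (z + 15) * (z + 14)"
      proof -
        have "(z + 16) * (z + 15) * (z + 14) - 24 * (441 / 64) * (z + 17)
          = z * z * z + 45 * (z * z) + (674 - 24 * (441 / 64)) * z + (3360 - 24 * (441 / 64) * 17)"
          by (simp add: field_simps)
        moreover have "z * z * z + 45 * (z * z) + (674 - 24 * (441 / 64)) * z + (3360 - 24 * (441 / 64) * 17) \<ge> 0"
          using z(1) by simp
        ultimately show ?thesis by linarith
      qed
      then have "(z + 17) * (24 * (441 / 64) * (z + 17)) \<le> (z + 17) * ((z + 16) * (z + 15) * (z + 14))"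
        using z(1) by (intro mult_left_mono) auto
      then have "(z + 17) * (24 * (441 / 64) * (z + 17)) / 24 \<le> (z + 17) * ((z + 16) * (z + 15) * (z + 14)) / 24"
        by (rule divide_right_mono) simp
      moreover have "(21 / 8 * (z + 17))\<^sup>2 = (z + 17) * (24 * (441 / 64) * (z + 17)) / 24"
        by (simp add: power2_eq_square field_simps)
      moreover have "z + 17 - 1 = z + 16" "z + 17 - 2 = z + 15" "z + 17 - 3 = z + 14" by simp_all
      ultimately show ?thesis unfolding z(2) by (simp only: mult.assoc)
    qed
    also have "\<dots> = real (q choose 4)" using choose_4_real[of q] q17 by simp
    finally have "(real m)\<^sup>2 \<le> real (q choose 4)" .
    then have "1 / real (q choose 4) \<le> 1 / (real m)\<^sup>2"
      using m q17 by (intro divide_left_mono mult_pos_pos) (auto simp: not_le)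
    moreover have "real (mid_count p m) / fact m \<le> 1 / real (q choose 4)"
      unfolding q_def by (rule mid_count_le[OF _ k_def]) (use p in auto)
    ultimately show ?thesis by linarith
  qed
  have "real (odd_bound p m) / fact m = real (mid_count p m) / fact m +
    real ((p ^ k * fact k - 1)\<^sup>2 * (p ^ k * fact k * fact (m mod p)) div (p - 1)) / fact m"
    by (simp add: odd_bound_def k_def add_divide_distrib)
  then show ?thesis using mid full by simp
qed

lemma odd_bound_5_le:
  assumes m: "m \<ge> 44"
  shows "real (odd_bound 5 m) / fact m \<le> 18 / (real m)\<^sup>2"
proof -
  define k where "k = m div 5"
  define n where "n = 5 * k"
  have k: "k \<ge> 8" "m \<le> n + 4" using m by (auto simp: k_def n_def)
  have n': "real n \<ge> 40" using k by (simp add: n_def)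
  have full: "real ((5 ^ k * fact k - 1)\<^sup>2 * (5 ^ k * fact k * fact (m mod 5)) div (5 - 1)) / fact m \<le> 1 / (real m)\<^sup>2"
  proof (rule full_div_le[OF _ k_def])
    \<comment> \<open>\<open>25 / 96\<close> is the constant \<open>25 / 24\<close> of
      \<open>wreath_cube_le_5\<close> divided by \<open>p - 1 = 4\<close>.\<close>
    define d where "d = 25 / 96 * (real m)\<^sup>2"
    have "real m \<le> 11 / 10 * real n" using k n' by simp
    then have "(real m)\<^sup>2 \<le> (11 / 10 * real n)\<^sup>2" by (intro power_mono) auto
    then have "(real m)\<^sup>2 \<le> 121 / 100 * (real n)\<^sup>2" by (simp add: power_mult_distrib power2_eq_square)
    moreover have "0 \<le> (real n)\<^sup>2" by (rule zero_le_power2)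
    ultimately have d: "d \<le> 1 / 2 * (real n)\<^sup>2" "d \<ge> 0" unfolding d_def by (linarith, simp)
    have P: "(\<Prod>i\<le>4. real (n - i)) = real n * (real n - 1) * (real n - 2) * (real n - 3) * (real n - 4)"
      using n' by (simp add: numeral_eq_Suc of_nat_diff mult_ac)
    let ?n = "real n" and ?h = "9 / 10 * real n"
    have "?n ^ 3 * d \<le> ?n ^ 3 * (1 / 2 * ?n\<^sup>2)" using d by (intro mult_left_mono) auto
    also have "\<dots> \<le> ?n * (?h * ?h * ?h * ?h)"
      using n' by (simp add: power3_eq_cube power2_eq_square)
    also have "\<dots> \<le> ?n * ((?n - 1) * (?n - 2) * (?n - 3) * (?n - 4))"
      using n' by (intro mult_mono mult_nonneg_nonneg) auto
    also have "\<dots> = (\<Prod>i\<le>4. real (n - i))" unfolding P by (simp only: mult_ac)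
    finally have "d * (real 5 ^ k * fact k) ^ 3 \<le> 25 / 24 * fact (5 * k)"
      using k d(2) wreath_cube_le_5[of "k - 1"] unfolding n_def
      by (intro wreath_cube_step[of 4]) auto
    then show "(real 5 ^ k * fact k) ^ 3 * (real m)\<^sup>2 \<le> (real 5 - 1) * fact (5 * k)"
      by (simp add: d_def mult_ac)
  qed (use m in auto)
  have mid: "real (mid_count 5 m) / fact m \<le> 17 / (real m)\<^sup>2"
  proof -
    define z where "z = real k - 8"
    have z: "z \<ge> 0" "real k = z + 8" using k by (auto simp: z_def)
    have "real m \<le> 5 * real k + 4" using k by (simp add: n_def)
    then have "(real m)\<^sup>2 \<le> (5 * real k + 4)\<^sup>2" by (intro power_mono) auto
    \<comment> \<open>At the smallest value \<open>k = 8\<close> this reads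
      \<open>1936 \<le> 2040\<close>. For \<open>p = 5\<close> only the lower index
      \<open>2 = p - 3\<close> is available, hence the larger constant.\<close>
    also have "\<dots> \<le> 17 * (real k * (2 * real k - 1))"
    proof -
      have "17 * (real k * (2 * real k - 1)) - (5 * real k + 4)\<^sup>2 = 9 * (z * z) + 87 * z + 104"
        unfolding z(2) by (simp add: power2_eq_square algebra_simps)
      moreover have "9 * (z * z) + 87 * z + 104 \<ge> 0" using z by simp
      ultimately show ?thesis by linarith
    qed
    also have "real k * (2 * real k - 1) = real (2 * k choose 2)" using choose_2_real[of "2 * k"] k by simp
    finally have le: "(real m)\<^sup>2 \<le> 17 * real (2 * k choose 2)" .
    have "real (mid_count 5 m) / fact m \<le> 1 / real (((5 - 3) * k) choose 2)"
      by (rule mid_count_le[OF _ k_def]) auto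
    also have "\<dots> \<le> 17 / (real m)\<^sup>2"
    proof -
      have "0 < real (2 * k choose 2)" using k by simp
      then show ?thesis using le m by (simp add: field_simps)
    qed
    finally show ?thesis .
  qed
  have "real (odd_bound 5 m) / fact m = real (mid_count 5 m) / fact m +
    real ((5 ^ k * fact k - 1)\<^sup>2 * (5 ^ k * fact k * fact (m mod 5)) div (5 - 1)) / fact m"
    by (simp add: odd_bound_def k_def add_divide_distrib)
  then show ?thesis using mid full by simp
qed

lemma total_bound_large:
  assumes m: "m \<ge> 44"
  shows "real (total_bound m) / fact m \<le> 6.5 / m"
proof -
  let ?M = "(m + 1) div 2"
  have split: "{2..<?M} = insert 2 {3..<?M}" using m by auto
  have "(\<Sum>j=2..<?M. real (odd_bound (2 * j + 1) m) / fact m) =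
    real (odd_bound 5 m) / fact m + (\<Sum>j=3..<?M. real (odd_bound (2 * j + 1) m) / fact m)"
    unfolding split by simp
  also have "\<dots> \<le> 18 / (real m)\<^sup>2 + (\<Sum>j=3..<?M. 2 / (real m)\<^sup>2)"
    using m by (intro add_mono odd_bound_5_le sum_mono odd_bound_7_le) auto
  also have "\<dots> = (18 + 2 * real (?M - 3)) / (real m)\<^sup>2" by (simp add: add_divide_distrib)
  \<comment> \<open>\<open>2 * ?M\<close> is at most \<open>m + 1\<close>; in the next step
    \<open>13 \<le> 0.3 * m\<close> because \<open>m \<ge> 44\<close>.\<close>
  also have "\<dots> \<le> (13 + real m) / (real m)\<^sup>2" by (intro divide_right_mono) (use m in auto)
  also have "\<dots> \<le> 1.3 / m" using m by (simp add: field_simps power2_eq_square)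
  finally have tail: "(\<Sum>j=2..<?M. real (odd_bound (2 * j + 1) m) / fact m) \<le> 1.3 / m" .
  have "real (total_bound m) / fact m = real (three_bound m) / fact m
    + 2 * (\<Sum>j=2..<?M. real (odd_bound (2 * j + 1) m) / fact m)"
    by (simp add: total_bound_def add_divide_distrib flip: sum_divide_distrib)
  also have "\<dots> \<le> 3.7 / m + 2 * (1.3 / m)" using three_bound_large[OF m] tail by simp
  also have "\<dots> \<le> 6.5 / m" using m by (simp add: field_simps)
  finally show ?thesis .
qed

section \<open>Size of the good sets and comparison for large degree\<close>

text \<open>The classical bound of the central binomial coefficient by
  \<open>4 ^ k / sqrt (3 * k + 1)\<close>, squared to avoid the root.\<close>

lemma central_ratio:
  assumes "k \<ge> 1"
  shows "(4 ^ k * (fact k)\<^sup>2)\<^sup>2 \<ge> (3 * real k + 1) * (fact (2 * k))\<^sup>2"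
  using assms
proof (induction k rule: nat_induct_at_least)
  case base
  then show ?case by (simp add: fact_numeral)
next
  case (Suc k)
  define x where "x = real k"
  have f: "fact (2 * Suc k) = (2 * x + 2) * (2 * x + 1) * fact (2 * k)"
    by (simp add: x_def algebra_simps)
  have g: "4 ^ Suc k * (fact (Suc k))\<^sup>2 = 4 * (x + 1)\<^sup>2 * (4 ^ k * (fact k)\<^sup>2)"
    by (simp add: x_def power2_eq_square algebra_simps)
  have x: "x \<ge> 1" using Suc.hyps by (simp add: x_def)
  have "(3 * x + 4) * (2 * x + 1)\<^sup>2 \<le> (2 * x + 2)\<^sup>2 * (3 * x + 1)"
    using x by (simp add: power2_eq_square algebra_simps)
  then have "(2 * x + 2)\<^sup>2 * ((3 * x + 4) * (2 * x + 1)\<^sup>2) * (fact (2 * k))\<^sup>2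
    \<le> (2 * x + 2)\<^sup>2 * ((2 * x + 2)\<^sup>2 * (3 * x + 1)) * (fact (2 * k))\<^sup>2"
    by (intro mult_left_mono mult_right_mono) auto
  then have "(3 * x + 4) * ((2 * x + 2) * (2 * x + 1) * fact (2 * k))\<^sup>2
    \<le> (4 * (x + 1)\<^sup>2)\<^sup>2 * ((3 * x + 1) * (fact (2 * k))\<^sup>2)"
  proof -
    have "(4 * (x + 1)\<^sup>2)\<^sup>2 = (2 * x + 2)\<^sup>2 * (2 * x + 2)\<^sup>2"
      by (simp add: power2_eq_square algebra_simps)
    then show ?thesis using \<open>(2 * x + 2)\<^sup>2 * ((3 * x + 4) * (2 * x + 1)\<^sup>2) * (fact (2 * k))\<^sup>2 \<le> _\<close>
      by (simp only: power_mult_distrib mult_ac)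
  qed
  also have "\<dots> \<le> (4 * (x + 1)\<^sup>2)\<^sup>2 * (4 ^ k * (fact k)\<^sup>2)\<^sup>2"
    using Suc.IH by (intro mult_left_mono) (auto simp: x_def)
  finally have "(3 * x + 4) * (fact (2 * Suc k))\<^sup>2 \<le> (4 ^ Suc k * (fact (Suc k))\<^sup>2)\<^sup>2"
    unfolding f g by (simp only: power_mult_distrib)
  then show ?case by (simp add: x_def algebra_simps)
qed

text \<open>\<open>8.15 ^ 2 = 66.4225\<close> is just below \<open>3 * 22 + 1 = 67\<close>.\<close>

lemma central_ratio_22:
  assumes "k \<ge> 22"
  shows "8.15 * (fact (2 * k) :: real) \<le> 4 ^ k * (fact k)\<^sup>2"
proof (rule power2_le_imp_le)
  have "(8.15 * (fact (2 * k) :: real))\<^sup>2 = 66.4225 * (fact (2 * k))\<^sup>2" by (simp add: power_mult_distrib power2_eq_square)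
  also have "\<dots> \<le> (3 * real k + 1) * (fact (2 * k))\<^sup>2" using assms by (intro mult_right_mono) auto
  also have "\<dots> \<le> (4 ^ k * (fact k)\<^sup>2)\<^sup>2" using assms by (intro central_ratio) auto
  finally show "(8.15 * (fact (2 * k) :: real))\<^sup>2 \<le> (4 ^ k * (fact k)\<^sup>2)\<^sup>2" .
qed simp

lemma pair_loss_large:
  assumes k: "k \<ge> 22"
  shows "real (pair_loss k) \<le> 0.2 * (fact k)\<^sup>2"
proof (cases "odd k")
  case True
  have "fact k = real k * fact (k - 1)" using k by (simp add: fact_reduce)
  then have "real (pair_loss k) * k = (fact k)\<^sup>2"
    using True by (simp add: pair_loss_def power2_eq_square)
  moreover have "real (pair_loss k) * 22 \<le> real (pair_loss k) * k" using k by (intro mult_left_mono) auto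
  ultimately have "22 * real (pair_loss k) \<le> (fact k)\<^sup>2" by simp
  then show ?thesis by simp
next
  case False
  define x where "x = real k"
  define F where "F = (fact (k - 4) :: real)"
  have x: "x \<ge> 22" using k by (simp add: x_def)
  have Fp: "F > 0" by (simp add: F_def)
  obtain q where q: "k = q + 4" using k by (metis add.commute le_Suc_ex le_trans numeral_le_iff semiring_norm(69) semiring_norm(71) semiring_norm(72) semiring_norm(68))
  have f2: "fact (k - 2) = (x - 2) * (x - 3) * F"
    unfolding q x_def F_def by (simp add: numeral_eq_Suc algebra_simps)
  have fk: "fact k = x * (x - 1) * ((x - 2) * (x - 3) * F)"
    unfolding q x_def F_def by (simp add: numeral_eq_Suc algebra_simps)
  have fc: "real (free_count k) = x * (x - 2) * F * (2 * x - 5)"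
  proof -
    have "real (free_count k) = x * fact (k - 2) + x * (x - 2)\<^sup>2 * F"
      using k by (simp add: free_count_def x_def F_def of_nat_diff)
    then show ?thesis unfolding f2 by (simp add: power2_eq_square algebra_simps)
  qed
  have pl: "real (pair_loss k) = x * (x * fact (k - 2) * real (free_count k)) + (real (free_count k))\<^sup>2"
    using False k by (simp add: pair_loss_def x_def)
  have "real (pair_loss k) = (x * (x - 2) * F)\<^sup>2 * (x * (x - 3) * (2 * x - 5) + (2 * x - 5)\<^sup>2)"
    unfolding pl f2 fc by (simp add: power2_eq_square algebra_simps)
  \<comment> \<open>The reflections take at most 0.12 and the half turn at most 0.04 of the
    total.\<close>
  also have "\<dots> \<le> (x * (x - 2) * F)\<^sup>2 * (0.2 * ((x - 1) * (x - 3))\<^sup>2)"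
  proof (intro mult_left_mono)
    define y where "y = x - 22"
    have y: "y \<ge> 0" "x = y + 22" using x by (auto simp: y_def)
    have "2 * x - 5 \<le> 2 * (x - 1)" by simp
    have "x * (x - 3) * (2 * x - 5) \<le> x * (x - 3) * (2 * (x - 1))" using x by (intro mult_left_mono) auto
    also have "\<dots> = (x - 1) * (x - 3) * (2 * x)" by (simp add: algebra_simps)
    also have "\<dots> \<le> (x - 1) * (x - 3) * (0.12 * ((x - 1) * (x - 3)))"
    proof (intro mult_left_mono)
      have "0.12 * ((x - 1) * (x - 3)) - 2 * x = 0.12 * (y * y) + 2.8 * y + 3.88"
        unfolding y(2) by (simp add: field_simps)
      moreover have "0.12 * (y * y) + 2.8 * y + 3.88 \<ge> 0" using y(1) by simp
      ultimately show "2 * x \<le> 0.12 * ((x - 1) * (x - 3))" by linarith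
    qed (use x in auto)
    finally have 1: "x * (x - 3) * (2 * x - 5) \<le> 0.12 * ((x - 1) * (x - 3))\<^sup>2"
      by (simp add: power2_eq_square mult_ac)
    have "(2 * x - 5)\<^sup>2 \<le> (0.2 * ((x - 1) * (x - 3)))\<^sup>2"
    proof (intro power_mono)
      have "0.2 * ((x - 1) * (x - 3)) - (2 * x - 5) = 0.2 * (y * y) + 6 * y + 40.8"
        unfolding y(2) by (simp add: field_simps)
      moreover have "0.2 * (y * y) + 6 * y + 40.8 \<ge> 0" using y(1) by simp
      ultimately show "2 * x - 5 \<le> 0.2 * ((x - 1) * (x - 3))" by linarith
    qed (use x in auto)
    then have 2: "(2 * x - 5)\<^sup>2 \<le> 0.04 * ((x - 1) * (x - 3))\<^sup>2" by (simp add: power_mult_distrib power2_eq_square)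
    have "a + b \<le> 0.2 * c" if "a \<le> 0.12 * c" "b \<le> 0.04 * c" "0 \<le> c" for a b c :: real
      using that by simp
    from this[OF 1 2 zero_le_power2]
    show "x * (x - 3) * (2 * x - 5) + (2 * x - 5)\<^sup>2 \<le> 0.2 * ((x - 1) * (x - 3))\<^sup>2" .
  qed simp
  also have "\<dots> = 0.2 * (fact k)\<^sup>2" unfolding fk by (simp add: power_mult_distrib mult_ac)
  finally show ?thesis .
qed

text \<open>The constants meet here: for even \<open>m\<close> at most a fifth is lost, and
  \<open>0.8 * 8.15 = 6.52\<close> still exceeds the 6.5 of
  \<open>total_bound_large\<close>.\<close>

lemma good_count_large:
  assumes m: "m \<ge> 44" and k: "k = m div 2"
    and odd: "odd m \<Longrightarrow> (2 ^ k * fact k)\<^sup>2 \<le> G"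
    and even: "even m \<Longrightarrow> 4 ^ k * (fact k)\<^sup>2 \<le> 2 * k * G + 4 ^ k * pair_loss k"
  shows "total_bound m < G"
proof -
  have k22: "k \<ge> 22" using m k by simp
  note cr = central_ratio_22[OF k22]
  have "real (total_bound m) \<le> 6.5 / m * fact m" using total_bound_large[OF m] by (simp add: field_simps)
  also have "\<dots> < real G"
  proof (cases "odd m")
    case True
    then have mk: "m = Suc (2 * k)" using k by simp
    have "6.5 / m * fact m = 6.5 * (fact (2 * k) :: real)" unfolding mk by (simp del: of_nat_Suc)
    also have "\<dots> < 8.15 * (fact (2 * k) :: real)" by simp
    also have "\<dots> \<le> 4 ^ k * (fact k)\<^sup>2" by (rule cr)
    also have "\<dots> = real ((2 ^ k * fact k)\<^sup>2)"
    proof -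
      have "(4::real) ^ k = (2 ^ k)\<^sup>2" by (simp add: power2_eq_square flip: power_mult_distrib)
      then show ?thesis by (simp add: power_mult_distrib)
    qed
    also have "\<dots> \<le> real G" using odd[OF True] by (simp only: of_nat_le_iff)
    finally show ?thesis .
  next
    case False
    then have mk: "m = 2 * k" using k by simp
    have "real (4 ^ k * (fact k)\<^sup>2) \<le> real (2 * k * G + 4 ^ k * pair_loss k)"
      using even False unfolding of_nat_le_iff by blast
    then have e: "4 ^ k * (fact k)\<^sup>2 \<le> 2 * real k * real G + 4 ^ k * real (pair_loss k)" by simp
    have "4 ^ k * real (pair_loss k) \<le> 4 ^ k * (0.2 * (fact k)\<^sup>2)"
      using pair_loss_large[OF k22] by (intro mult_left_mono) auto
    also have "\<dots> = 0.2 * (4 ^ k * (fact k)\<^sup>2)" by simp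
    finally have "0.8 * (4 ^ k * (fact k)\<^sup>2) \<le> 2 * real k * real G" using e by linarith
    moreover have "0.8 * (8.15 * fact (2 * k)) \<le> 0.8 * (4 ^ k * (fact k)\<^sup>2 :: real)" using cr by simp
    moreover have "6.5 * fact (2 * k) < 0.8 * (8.15 * (fact (2 * k) :: real))" by simp
    ultimately have "6.5 * fact (2 * k) < 2 * real k * real G" by linarith
    then show ?thesis using k22 unfolding mk by (simp add: field_simps)
  qed
  finally show ?thesis by simp
qed

text \<open>On eight points two Sylow 2-subgroups of the symmetric group never intersect trivially; the next
  best is an intersection generated by a transposition, which the alternating group does not contain.\<close>

definition good8 :: "(nat \<Rightarrow> nat) set \<Rightarrow> (nat \<Rightarrow> nat) set"
  where "good8 V = {x. x permutes {1..8} \<and> card {g \<in> V. x \<circ> g \<circ> inv' x \<in> V} \<le> 2 \<and>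
    (\<forall>g\<in>V. x \<circ> g \<circ> inv' x \<in> V \<longrightarrow> evenperm g \<longrightarrow> g = id)}"

section \<open>Degree eight\<close>

text \<open>A Sylow 2-subgroup, of order \<open>2 ^ 7\<close>: the iterated wreath product of three
  groups of order two.\<close>

abbreviation V8 :: "(nat \<Rightarrow> nat) set"
  where "V8 \<equiv> wreath 4 (std_cent 2 4)"

lemma V8_facts: "subgroup V8 (sym_group 8)" "odd (fact 8 div card V8)" "card V8 = 128"
proof -
  have H: "subgroup (std_cent 2 4) (sym_group 4)" "odd (fact 4 div card (std_cent 2 4))"
    using std_cent_index[of 2 4] by simp_all
  show "subgroup V8 (sym_group 8)" using subgroup_wreath[OF H(1)] by simp
  show "odd (fact 8 div card V8)" using wreath_index[OF H] by simp
  have "card (std_cent 2 4) = 8" using card_std_cent[of 2 4] by (simp add: fact_numeral)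
  moreover have "std_cent 2 4 \<subseteq> {s. s permutes {1..4}}" using subgroup_sym_groupD(1)[OF H(1)] by auto
  ultimately show "card V8 = 128" unfolding wreath_def using card_pair_perm[of "std_cent 2 4" 4] by simp
qed

text \<open>The four edges are matched in turn, so an element that preserves the edge
  \<open>{7, 8}\<close> preserves its partner edge \<open>{5, 6}\<close>.\<close>

lemma V8_mem:
  assumes "g \<in> V8" "g 7 \<in> {7, 8}"
  shows "g 5 \<in> {5, 6}" "g 6 \<in> {5, 6}"
proof -
  have g: "g \<in> W2 4" and h: "pair_perm 4 g \<in> cent {1..4} (std_cyc 2)"
    using assms(1) by (auto simp: wreath_def std_cent_def)
  have "pair_perm 4 g 4 = (g 7 + 1) div 2" using pair_perm_apply[OF g, of 7] by simp
  then have p4: "pair_perm 4 g 4 = 4" using assms(2) by auto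
  have "pair_perm 4 g (std_cyc 2 4) = std_cyc 2 (pair_perm 4 g 4)" by (rule centD(2)[OF h]) simp
  then have "pair_perm 4 g 3 = 3" using p4 by (simp add: std_cyc_def)
  then have 56: "(g 5 + 1) div 2 = 3" "(g 6 + 1) div 2 = 3"
    using pair_perm_apply[OF g, of 5] pair_perm_apply[OF g, of 6] by simp_all
  show "g 5 \<in> {5, 6}" using 56(1) unfolding insert_iff empty_iff by presburger
  show "g 6 \<in> {5, 6}" using 56(2) unfolding insert_iff empty_iff by presburger
qed

text \<open>The 6-cycle leaves \<open>{7, 8}\<close> as a common edge of the two matchings and makes
  a hexagon of the other edges. Preserving \<open>{7, 8}\<close> forces \<open>d\<close> and its
  conjugate to preserve \<open>{5, 6}\<close>, which pins down the point 5; the rest of the hexagon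
  follows edge by edge.\<close>

lemma V8_shift6:
  assumes d: "d \<in> V8" and h: "shift 6 \<circ> d \<circ> inv' (shift 6) \<in> V8"
  shows "d = id \<or> d = transpose 7 8"
proof -
  let ?c = "shift 6" let ?h = "?c \<circ> d \<circ> inv' ?c" let ?\<alpha> = "std_cyc 2"
  have c: "?c permutes {1..6}" by (rule shift_permutes) simp
  have hc: "?h (?c i) = ?c (d i)" for i using permutes_inverses(2)[OF c] by simp
  have cinj: "?c i = ?c j \<longleftrightarrow> i = j" for i j using permutes_inj[OF c] by (auto simp: inj_eq)
  have dW: "d \<in> W2 4" and hW: "?h \<in> W2 4" using d h by (auto simp: wreath_def)
  have dm: "d i \<in> {1..8}" if "i \<in> {1..8}" for i using W2_mem(1)[OF dW, of i] that by simp
  have da: "d (?\<alpha> i) = ?\<alpha> (d i)" and ha: "?h (?\<alpha> i) = ?\<alpha> (?h i)" if "i \<in> {1..8}" for i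
    using W2_mem(2)[OF dW, of i] W2_mem(2)[OF hW, of i] that by auto
  have cv: "?c 1 = 2" "?c 2 = 3" "?c 3 = 4" "?c 4 = 5" "?c 5 = 6" "?c 6 = 1" "?c 7 = 7" "?c 8 = 8"
    by (simp_all add: shift_def)
  have av: "?\<alpha> 1 = 2" "?\<alpha> 2 = 1" "?\<alpha> 3 = 4" "?\<alpha> 4 = 3" "?\<alpha> 5 = 6" "?\<alpha> 6 = 5" "?\<alpha> 7 = 8" "?\<alpha> 8 = 7"
    by (simp_all add: std_cyc_def)
  have h78: "?h 7 = ?c (d 7)" "?h 8 = ?c (d 8)" using hc[of 7] hc[of 8] unfolding cv by auto
  have d8: "d 8 = ?\<alpha> (d 7)" using da[of 7] unfolding av by simp
  have "?c (?\<alpha> (d 7)) = ?\<alpha> (?c (d 7))" using ha[of 7] h78 d8 unfolding av by simp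
  moreover have "d 7 \<in> {1,2,3,4,5,6,7,8}" using dm[of 7] by auto
  \<comment> \<open>Only the edge \<open>{7, 8}\<close> belongs to both matchings.\<close>
  ultimately have d7: "d 7 \<in> {7, 8}"
    by (elim insertE emptyE; simp only: cv av) simp_all
  have h7: "?h 7 \<in> {7, 8}" using h78 d7 cv by auto
  have "?h 6 = ?c (d 5)" using hc[of 5] unfolding cv by simp
  then have "?c (d 5) \<in> {5, 6}" using V8_mem(2)[OF h h7] by simp
  then have d5: "d 5 = 5" using V8_mem(1)[OF d d7] cv by auto
  have d6: "d 6 = 6" using da[of 5] unfolding av d5 by simp
  have h6: "?h 6 = 6" using \<open>?h 6 = ?c (d 5)\<close> d5 cv by simp
  have "?h 5 = 5" using ha[of 6] unfolding av h6 by simp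
  then have d4: "d 4 = 4" using hc[of 4] cinj[of "d 4" 4] unfolding cv by simp
  have d3: "d 3 = 3" using da[of 4] unfolding av d4 by simp
  have h4: "?h 4 = 4" using hc[of 3] unfolding cv d3 by simp
  have "?h 3 = 3" using ha[of 4] unfolding av h4 by simp
  then have d2: "d 2 = 2" using hc[of 2] cinj[of "d 2" 2] unfolding cv by simp
  have d1: "d 1 = 1" using da[of 2] unfolding av d2 by simp
  have out: "d i = i" if "i \<notin> {1..8}" for i using permutes_not_in[OF centD(1)[OF dW]] that by simp
  have fixed: "d i = i" if "i \<noteq> 7" "i \<noteq> 8" for i
  proof (cases "i \<in> {1..8}")
    case True
    then have "i = 1 \<or> i = 2 \<or> i = 3 \<or> i = 4 \<or> i = 5 \<or> i = 6" using that unfolding atLeastAtMost_iff by presburger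
    then show ?thesis using d1 d2 d3 d4 d5 d6 by auto
  qed (use out in auto)
  show ?thesis
  proof (cases "d 7 = 7")
    case True
    then have "d 8 = 8" using d8 unfolding True av by simp
    then have "d i = id i" for i using fixed[of i] True by (cases "i = 7"; cases "i = 8") auto
    then show ?thesis by auto
  next
    case False
    then have 7: "d 7 = 8" using d7 by auto
    then have "d 8 = 7" using d8 unfolding 7 av by simp
    then have "d i = transpose 7 8 i" for i using fixed[of i] 7 by (auto simp: transpose_def)
    then show ?thesis by auto
  qed
qed

lemma card_good8: "8192 \<le> card (good8 V8)"
proof -
  let ?c = "shift 6" and ?t = "transpose 7 (8::nat)"
  note Vd = subgroup_sym_groupD[OF V8_facts(1)]
  have c: "?c permutes {1..8}" using permutes_subset[OF shift_permutes[of 6], of "{1..8}"] by auto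
  have fin: "finite (good8 V8)"
    using finite_subset[OF _ finite_permutations[of "{1..8::nat}"], of "good8 V8"] by (auto simp: good8_def)
  have finV: "finite V8" using V8_facts(3) by (metis card.infinite zero_neq_numeral)
  have "card (V8 \<times> V8) \<le> 2 * card (good8 V8)"
  proof (rule card_double_coset_le[OF V8_facts(1) c _ order.refl _ fin])
    have "{d \<in> V8. ?c \<circ> d \<circ> inv' ?c \<in> V8} \<subseteq> {id, ?t}" using V8_shift6 by auto
    from card_mono[OF _ this] have "card {d \<in> V8. ?c \<circ> d \<circ> inv' ?c \<in> V8} \<le> card {id, ?t}" by simp
    also have "\<dots> \<le> 2" by (simp add: card_insert_if)
    finally show "card {d \<in> V8. ?c \<circ> d \<circ> inv' ?c \<in> V8} \<le> 2" .
    fix v w assume "(v, w) \<in> V8 \<times> V8"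
    then have vw: "v \<in> V8" "w \<in> V8" by auto
    then have p: "v permutes {1..8}" "w permutes {1..8}" using Vd(1) by auto
    let ?x = "v \<circ> ?c \<circ> w"
    let ?D = "{g \<in> V8. ?x \<circ> g \<circ> inv' ?x \<in> V8}"
    have conj_id: "w \<circ> g \<circ> inv' w = id \<or> w \<circ> g \<circ> inv' w = ?t" if "g \<in> ?D" for g
    proof (rule V8_shift6)
      show "w \<circ> g \<circ> inv' w \<in> V8" using that Vd(3,4) vw by blast
      have y: "?x \<circ> g \<circ> inv' ?x \<in> V8" using that by blast
      show "?c \<circ> (w \<circ> g \<circ> inv' w) \<circ> inv' ?c \<in> V8"
        unfolding conj_double_coset[OF p(1) c p(2)]
        by (rule Vd(3)[OF Vd(3)[OF Vd(4)[OF vw(1)] y] vw(1)])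
    qed
    have unconj: "g = inv' w \<circ> (w \<circ> g \<circ> inv' w) \<circ> w" for g
      using permutes_inverses[OF p(2)] by (simp add: fun_eq_iff)
    have "?D \<subseteq> {id, inv' w \<circ> ?t \<circ> w}"
    proof
      fix g assume g: "g \<in> ?D"
      from conj_id[OF g] show "g \<in> {id, inv' w \<circ> ?t \<circ> w}"
      proof
        assume "w \<circ> g \<circ> inv' w = id"
        then show ?thesis using conj_eq_id[OF p(2)] by blast
      next
        assume e: "w \<circ> g \<circ> inv' w = ?t"
        have "g = inv' w \<circ> ?t \<circ> w" using unconj[of g] unfolding e .
        then show ?thesis by blast
      qed
    qed
    from card_mono[OF _ this] have "card ?D \<le> card {id, inv' w \<circ> ?t \<circ> w}" by simp
    also have "\<dots> \<le> 2" by (simp add: card_insert_if)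
    finally have "card ?D \<le> 2" .
    moreover have "g = id" if g: "g \<in> ?D" "evenperm g" for g
    proof -
      have pp: "permutation w" "permutation g"
        using p(2) g(1) Vd(1) by (auto intro: permutes_imp_permutation[of "{1..8}"])
      have "evenperm (w \<circ> g \<circ> inv' w)"
        using pp g(2) by (simp add: evenperm_comp permutation_compose permutation_inverse evenperm_inv)
      moreover have "\<not> evenperm ?t" by (simp add: evenperm_swap)
      ultimately have "w \<circ> g \<circ> inv' w = id" using conj_id[OF g(1)] by metis
      then show ?thesis using conj_eq_id[OF p(2)] by blast
    qed
    moreover have "?x permutes {1..8}" using p c by (intro permutes_compose)
    ultimately show "?x \<in> good8 V8" unfolding good8_def by blast
  qed
  then show ?thesis using V8_facts(3) by (simp add: card_cartesian_product)
qed

lemma card_even_good8: "2 * card {x \<in> good8 V8. evenperm x} = card (good8 V8)"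
proof -
  let ?t = "transpose 1 (2::nat)"
  note V = subgroup_sym_groupD[OF V8_facts(1)]
  have tV: "?t \<in> V8"
    using transpose_12_wreath[of 4 "std_cent 2 4"] std_cent_index(1)[of 2 4] by simp
  have t: "?t permutes {1..8}" using V(1) tV by blast
  show ?thesis
  proof (rule card_even_half[of _ ?t])
    show "finite (good8 V8)"
      using finite_subset[OF _ finite_permutations[of "{1..8::nat}"], of "good8 V8"] by (auto simp: good8_def)
    fix x assume x: "x \<in> good8 V8"
    then have xp: "x permutes {1..8}" by (simp add: good8_def)
    then show "permutation x" by (intro permutes_imp_permutation) auto
    have iff: "?t \<circ> x \<circ> g \<circ> inv' (?t \<circ> x) \<in> V8 \<longleftrightarrow> x \<circ> g \<circ> inv' x \<in> V8" for g
    proof -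
      have "inv' (?t \<circ> x) = inv' x \<circ> ?t" using t xp by (simp add: o_inv_distrib permutes_bij)
      then have e: "?t \<circ> x \<circ> g \<circ> inv' (?t \<circ> x) = ?t \<circ> (x \<circ> g \<circ> inv' x) \<circ> ?t" by (simp add: comp_assoc)
      have "?t \<circ> (?t \<circ> y \<circ> ?t) \<circ> ?t = y" for y by (simp add: fun_eq_iff)
      then show ?thesis unfolding e using V(3) tV by metis
    qed
    show "?t \<circ> x \<in> good8 V8"
      using x permutes_compose[OF xp t] unfolding good8_def mem_Collect_eq iff by blast
  qed (auto simp: permutation_swap_id evenperm_swap)
qed

section \<open>Degrees below 44 by computation\<close>

text \<open>Turns sums over intervals into list sums, which \<open>code_simp\<close> can
  evaluate.\<close>

lemma sum_upt_code: "(\<Sum>i=a..<b. f i) = sum_list (map f [a..<b])"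
  by (simp add: interv_sum_list_conv_sum_set_nat)

lemma total_bound_small: "list_all (\<lambda>m. total_bound m < good_bound m) [5..<44]"
  unfolding total_bound_def odd_bound_def three_bound_def mid_count_def sum_upt_code
    good_bound_def pair_loss_def free_count_def
  by code_simp

lemma total_bound_less:
  assumes m: "m \<ge> 5" "m \<noteq> 8" and k: "k = m div 2"
    and odd: "odd m \<Longrightarrow> (2 ^ k * fact k)\<^sup>2 \<le> G"
    and even: "even m \<Longrightarrow> 4 ^ k * (fact k)\<^sup>2 \<le> 2 * k * G + 4 ^ k * pair_loss k"
  shows "total_bound m < G"
proof (cases "m \<ge> 44")
  case True
  then show ?thesis using good_count_large[OF True k odd even] by blast
next
  case False
  then have "m \<in> set [5..<44]" using m by (simp only: set_upt atLeastLessThan_iff) simp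
  then have "total_bound m < good_bound m" using total_bound_small unfolding list_all_iff by blast
  also have "good_bound m \<le> G"
  proof (cases "odd m")
    case True
    then show ?thesis using odd k by (simp add: good_bound_def Let_def)
  next
    case False
    have "4 ^ k * ((fact k)\<^sup>2 - pair_loss k) \<le> 2 * k * G"
      using even False by (simp add: diff_mult_distrib2)
    then have "4 ^ k * ((fact k)\<^sup>2 - pair_loss k) div (2 * k) \<le> 2 * k * G div (2 * k)" by (rule div_le_mono)
    also have "\<dots> = G" using m k by simp
    finally show ?thesis using False m k by (simp add: good_bound_def Let_def)
  qed
  finally show ?thesis .
qed

lemma ex_good_group:
  assumes m: "m \<ge> 5" "m \<noteq> 8"
  shows "\<exists>V. subgroup V (sym_group m) \<and> odd (fact m div card V) \<and> transpose 1 2 \<in> V \<and> total_bound m < card (good m V)"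
proof -
  define k where "k = m div 2"
  have k2: "k \<ge> 2" using m by (simp add: k_def)
  show ?thesis
  proof (cases "odd m")
    case True
    then have "m = 2 * k + 1" by (simp add: k_def)
    then have "total_bound m < card (good m (std_cent 2 m))"
      using total_bound_less[OF m k_def card_good_odd] True by blast
    then show ?thesis using std_cent_index[of 2 m] transpose_12_mem[of m] m by auto
  next
    case False
    then have mk: "m = 2 * k" by (simp add: k_def)
    then have k4: "k \<noteq> 4" "k \<noteq> 2" "k \<ge> 1" using m by auto
    have main: ?thesis if H: "subgroup H (sym_group k)" "odd (fact k div card H)"
      and "4 ^ k * (fact k)\<^sup>2 \<le> 2 * k * card (good (2 * k) (wreath k H)) + 4 ^ k * pair_loss k" for H
    proof -
      have "total_bound m < card (good m (wreath k H))"
        using total_bound_less[OF m k_def] that(3) False mk by auto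
      then show ?thesis using subgroup_wreath[OF H(1)] wreath_index[OF H] transpose_12_wreath[OF k4(3) H(1)] mk
        by blast
    qed
    consider "odd k" | "k = 6" | "even k" "k \<noteq> 6" by blast
    then show ?thesis
    proof cases
      case 1
      then show ?thesis using card_good_2_mod_4[OF 1] by (intro main[of "{s. s permutes {2..k}}"]) (auto simp: pair_loss_def)
    next
      case 2
      let ?H = "{s. s permutes {1..6::nat} \<and> s ` {1,2} = {1,2}}"
      show ?thesis
      proof (rule main[of ?H])
        show "subgroup ?H (sym_group k)" unfolding 2 by (rule card_good_12(2))
        show "odd (fact k div card ?H)" unfolding 2 by (rule card_good_12(3))
        have "pair_loss 6 = 7 * 144\<^sup>2" by (simp add: pair_loss_def)
        then show "4 ^ k * (fact k)\<^sup>2 \<le> 2 * k * card (good (2 * k) (wreath k ?H)) + 4 ^ k * pair_loss k"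
          using card_good_12(1) unfolding 2 by (simp only: mult_numeral_1 arith_simps)
      qed
    next
      case 3
      then have k4': "k \<ge> 4" using k2 k4 by presburger
      have "pair_loss k = k * (k * fact (k - 2) * free_count k) + (free_count k)\<^sup>2"
        using 3 by (simp add: pair_loss_def)
      then show ?thesis using card_good_0_mod_4[OF 3(1) k4'] std_cent_index[of 2 k] by (intro main[of "std_cent 2 k"]) auto
    qed
  qed
qed

section \<open>The union bound\<close>

definition big_primes :: "nat \<Rightarrow> nat set"
  where "big_primes m = {p. Factorial_Ring.prime p \<and> 5 \<le> p \<and> p \<le> m}"

lemma prime_cases:
  assumes "Factorial_Ring.prime (p::nat)" "p \<le> m"
  shows "p = 2 \<or> p = 3 \<or> p \<in> big_primes m"
proof -
  have "p \<noteq> 4" using prime_odd_nat[OF assms(1)] by auto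
  moreover have "p \<ge> 2" using assms(1) prime_ge_2_nat by blast
  ultimately show ?thesis using assms unfolding big_primes_def by fastforce
qed

lemma sum_card_bad_le:
  assumes "m \<ge> 3"
  shows "card (bad 3 {1..m} (std_cent 3 m)) + 2 * (\<Sum>p\<in>big_primes m. card (bad p {1..m} (std_cent p m))) \<le> total_bound m"
proof -
  have "card (bad 3 {1..m} (std_cent 3 m)) \<le> three_bound m"
    using card_bad_3_le[OF assms] card_bad_3_6 by (auto simp: three_bound_def)
  moreover have "(\<Sum>p\<in>big_primes m. card (bad p {1..m} (std_cent p m))) \<le> (\<Sum>p\<in>big_primes m. odd_bound p m)"
    using card_bad_odd_le by (intro sum_mono) (auto simp: big_primes_def odd_bound_def)
  moreover have "(\<Sum>p\<in>big_primes m. odd_bound p m) \<le> (\<Sum>p\<in>(\<lambda>j. 2 * j + 1) ` {2..<(m + 1) div 2}. odd_bound p m)"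
  proof (rule sum_mono2)
    show "big_primes m \<subseteq> (\<lambda>j. 2 * j + 1) ` {2..<(m + 1) div 2}"
    proof
      fix p assume "p \<in> big_primes m"
      then have p: "Factorial_Ring.prime p" "5 \<le> p" "p \<le> m" by (auto simp: big_primes_def)
      then have "odd p" using prime_odd_nat[of p] by simp
      then obtain j where "p = 2 * j + 1" by (auto elim: oddE)
      then show "p \<in> (\<lambda>j. 2 * j + 1) ` {2..<(m + 1) div 2}" using p by (intro image_eqI[of _ _ j]) auto
    qed
  qed auto
  moreover have "(\<Sum>p\<in>(\<lambda>j. 2 * j + 1) ` {2..<(m + 1) div 2}. odd_bound p m) = (\<Sum>j=2..<(m + 1) div 2. odd_bound (2 * j + 1) m)"
    by (subst sum.reindex) (auto simp: inj_on_def)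
  ultimately show ?thesis unfolding total_bound_def by linarith
qed

text \<open>Each prime has its own conjugator \<open>z\<close>, whereas \<open>x\<close> is common
  to all of them. Conjugation changes neither sizes nor parity, so the counts for the standard
  groups apply to arbitrary Sylow subgroups.\<close>

lemma card_conj_perms:
  fixes m :: nat
  assumes z: "z permutes {1..m}" and B: "B \<subseteq> {x. x permutes {1..m}}"
  shows "card {x. x permutes {1..m} \<and> z \<circ> x \<circ> inv' z \<in> B} = card B"
    "card {x. x permutes {1..m} \<and> evenperm x \<and> z \<circ> x \<circ> inv' z \<in> B} = card {x \<in> B. evenperm x}"
proof -
  let ?f = "\<lambda>x. z \<circ> x \<circ> inv' z" and ?g = "\<lambda>x. inv' z \<circ> x \<circ> z"
  note zi = permutes_inverses[OF z]
  have fg: "?f (?g x) = x" "?g (?f x) = x" for x using zi by (auto simp: fun_eq_iff)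
  have pm: "?g x permutes {1..m}" if "x permutes {1..m}" for x
    using z that by (intro permutes_compose permutes_inv)
  have pz: "permutation z" using z by (intro permutes_imp_permutation[of "{1..m}"]) auto
  have ev: "evenperm (?f x) = evenperm x" if "x permutes {1..m}" for x
  proof -
    have "permutation x" using that by (intro permutes_imp_permutation[of "{1..m}"]) auto
    then show ?thesis using pz
      by (auto simp: evenperm_comp permutation_compose permutation_inverse evenperm_inv)
  qed
  have "bij_betw ?f {x. x permutes {1..m} \<and> ?f x \<in> B} B"
    by (rule bij_betw_byWitness[where f' = ?g]) (use fg pm B in auto)
  then show "card {x. x permutes {1..m} \<and> ?f x \<in> B} = card B" by (rule bij_betw_same_card)
  have "bij_betw ?f {x. x permutes {1..m} \<and> evenperm x \<and> ?f x \<in> B} {x \<in> B. evenperm x}"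
  proof (rule bij_betw_byWitness[where f' = ?g])
    show "?g ` {x \<in> B. evenperm x} \<subseteq> {x. x permutes {1..m} \<and> evenperm x \<and> ?f x \<in> B}"
    proof (rule image_subsetI)
      fix x assume x: "x \<in> {x \<in> B. evenperm x}"
      then have "?g x permutes {1..m}" using B pm by auto
      moreover have "evenperm (?g x)" using ev[OF calculation] x by (simp only: fg) simp
      ultimately show "?g x \<in> {x. x permutes {1..m} \<and> evenperm x \<and> ?f x \<in> B}" using x by (simp only: fg mem_Collect_eq)
    qed
  qed (use fg ev in auto)
  then show "card {x. x permutes {1..m} \<and> evenperm x \<and> ?f x \<in> B} = card {x \<in> B. evenperm x}"
    by (rule bij_betw_same_card)
qed

text \<open>Union bound among even permutations, doubled: the good set and the bad set for 3 lose
  exactly half their elements, while for \<open>p \<ge> 5\<close> the full bad set is charged,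
  twice.\<close>

lemma ex_even_avoiding:
  assumes m: "m \<ge> 3" and T: "T \<subseteq> {x. x permutes {1..m}}" "2 * card {x \<in> T. evenperm x} = card T"
    "total_bound m < card T" and z: "\<And>p. z p permutes {1..m}"
  shows "\<exists>x. x permutes {1..m} \<and> evenperm x \<and> z 2 \<circ> x \<circ> inv' (z 2) \<in> T \<and>
    (\<forall>p\<in>insert 3 (big_primes m). z p \<circ> x \<circ> inv' (z p) \<notin> bad p {1..m} (std_cent p m))"
proof (rule ccontr)
  assume neg: "\<not> ?thesis"
  let ?bad = "\<lambda>p. bad p {1..m} (std_cent p m)"
  let ?A = "{x. x permutes {1..m} \<and> evenperm x \<and> z 2 \<circ> x \<circ> inv' (z 2) \<in> T}"
  let ?B = "\<lambda>p. {x. x permutes {1..m} \<and> evenperm x \<and> z p \<circ> x \<circ> inv' (z p) \<in> ?bad p}"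
  have fin: "finite (big_primes m)" by (rule finite_subset[of _ "{..m}"]) (auto simp: big_primes_def)
  have sub: "?bad p \<subseteq> {x. x permutes {1..m}}" for p by (auto simp: bad_def)
  have finB: "finite (?B p)" for p
    by (rule finite_subset[OF _ finite_permutations[of "{1..m}"]]) auto
  have "?A \<subseteq> ?B 3 \<union> (\<Union>p\<in>big_primes m. ?B p)" using neg by auto
  then have "card ?A \<le> card (?B 3 \<union> (\<Union>p\<in>big_primes m. ?B p))"
    using finB fin by (intro card_mono) auto
  also have "\<dots> \<le> card (?B 3) + card (\<Union>p\<in>big_primes m. ?B p)" by (rule card_Un_le)
  also have "card (\<Union>p\<in>big_primes m. ?B p) \<le> (\<Sum>p\<in>big_primes m. card (?B p))" by (rule card_UN_le[OF fin])
  also have "\<dots> \<le> (\<Sum>p\<in>big_primes m. card (?bad p))"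
  proof (rule sum_mono)
    fix p
    have "card (?B p) = card {x \<in> ?bad p. evenperm x}" by (rule card_conj_perms(2)[OF z sub])
    also have "\<dots> \<le> card (?bad p)" by (intro card_mono finite_bad) auto
    finally show "card (?B p) \<le> card (?bad p)" .
  qed
  finally have "card ?A \<le> card (?B 3) + (\<Sum>p\<in>big_primes m. card (?bad p))" by (simp only: add_le_cancel_left)
  then have "2 * card ?A \<le> 2 * card (?B 3) + 2 * (\<Sum>p\<in>big_primes m. card (?bad p))" by linarith
  moreover have "2 * card (?B 3) = card (?bad 3)"
    using card_conj_perms(2)[OF z sub, of 3] card_even_bad_3[OF m] by simp
  moreover have "2 * card ?A = card T" using card_conj_perms(2)[OF z T(1), of 2] T(2) by simp
  ultimately show False using sum_card_bad_le[OF m] T(3) by linarith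
qed

text \<open>The version without parity, for a set \<open>T\<close> that need not split evenly; it
  serves the symmetric group in degree eight.\<close>

lemma ex_avoiding:
  assumes m: "m \<ge> 3" and T: "T \<subseteq> {x. x permutes {1..m}}" "total_bound m < card T" and z: "\<And>p. z p permutes {1..m}"
  shows "\<exists>x\<in>T. \<forall>p\<in>insert 3 (big_primes m). z p \<circ> x \<circ> inv' (z p) \<notin> bad p {1..m} (std_cent p m)"
proof (rule ccontr)
  assume neg: "\<not> ?thesis"
  let ?bad = "\<lambda>p. bad p {1..m} (std_cent p m)"
  let ?B = "\<lambda>p. {x. x permutes {1..m} \<and> z p \<circ> x \<circ> inv' (z p) \<in> ?bad p}"
  have fin: "finite (big_primes m)" by (rule finite_subset[of _ "{..m}"]) (auto simp: big_primes_def)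
  have sub: "?bad p \<subseteq> {x. x permutes {1..m}}" for p by (auto simp: bad_def)
  have finB: "finite (?B p)" for p
    by (rule finite_subset[OF _ finite_permutations[of "{1..m}"]]) auto
  have "T \<subseteq> ?B 3 \<union> (\<Union>p\<in>big_primes m. ?B p)" using neg T(1) by auto
  then have "card T \<le> card (?B 3 \<union> (\<Union>p\<in>big_primes m. ?B p))"
    using finB fin by (intro card_mono) auto
  also have "\<dots> \<le> card (?B 3) + card (\<Union>p\<in>big_primes m. ?B p)" by (rule card_Un_le)
  also have "card (\<Union>p\<in>big_primes m. ?B p) \<le> (\<Sum>p\<in>big_primes m. card (?B p))" by (rule card_UN_le[OF fin])
  also have "\<dots> = (\<Sum>p\<in>big_primes m. card (?bad p))" using card_conj_perms(1)[OF z sub] by simp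
  also have "card (?B 3) = card (?bad 3)" by (rule card_conj_perms(1)[OF z sub])
  finally show False using sum_card_bad_le[OF m] T(2) by simp
qed

section \<open>Intersections of conjugate Sylow subgroups\<close>

definition common :: "(nat \<Rightarrow> nat) set \<Rightarrow> (nat \<Rightarrow> nat) \<Rightarrow> (nat \<Rightarrow> nat) set"
  where "common P x = {g \<in> P. x \<circ> g \<circ> inv' x \<in> P}"

lemma common_eq:
  assumes G: "G = sym_group m \<or> G = alt_group m" and P: "P \<subseteq> carrier G" and x: "x \<in> carrier G"
  shows "P \<inter> conj_subgroup G P x = common P x"
proof -
  have xp: "x permutes {1..m}" using G x by (auto simp: sym_group_carrier alt_group_carrier)
  have i: "inv\<^bsub>G\<^esub> x = inv' x" using G x by (auto simp: alt_group_inv_equality)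
  have mu: "monoid.mult G = (\<circ>)" using G by (auto simp: sym_group_mult alt_group_mult)
  have "conj_subgroup G P x = {inv' x \<circ> (q \<circ> x) | q. q \<in> P}"
    unfolding conj_subgroup_def l_coset_def r_coset_def i mu by auto
  also have "\<dots> = {g. x \<circ> g \<circ> inv' x \<in> P}"
  proof (intro equalityI subsetI)
    fix g assume "g \<in> {inv' x \<circ> (q \<circ> x) | q. q \<in> P}"
    then obtain q where q: "q \<in> P" "g = inv' x \<circ> (q \<circ> x)" by auto
    then have "x \<circ> g \<circ> inv' x = q" using permutes_inverses[OF xp] by (simp add: fun_eq_iff)
    then show "g \<in> {g. x \<circ> g \<circ> inv' x \<in> P}" using q by simp
  next
    fix g assume g: "g \<in> {g. x \<circ> g \<circ> inv' x \<in> P}"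
    have "g = inv' x \<circ> ((x \<circ> g \<circ> inv' x) \<circ> x)" using permutes_inverses[OF xp] by (simp add: fun_eq_iff)
    then show "g \<in> {inv' x \<circ> (q \<circ> x) | q. q \<in> P}" using g by blast
  qed
  finally show ?thesis by (auto simp: common_def)
qed

lemma inclusion_minimalI:
  assumes G: "G = sym_group m \<or> G = alt_group m" and P: "P \<subseteq> carrier G" and x: "x \<in> carrier G"
    and min: "\<And>g. g \<in> carrier G \<Longrightarrow> common P g \<subseteq> common P x \<Longrightarrow> common P g = common P x"
  shows "inclusion_minimal (P \<inter> conj_subgroup G P x) {P \<inter> conj_subgroup G P g | g. g \<in> carrier G}"
proof -
  have fam: "{P \<inter> conj_subgroup G P g | g. g \<in> carrier G} = common P ` carrier G"
    using common_eq[OF G P] by (auto simp: image_def)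
  show ?thesis unfolding inclusion_minimal_def fam common_eq[OF G P x] using x min by blast
qed

lemma id_mem_common:
  assumes "subgroup P (sym_group m)" "x permutes {1..m}"
  shows "id \<in> common P x"
  using subgroup_sym_groupD(2)[OF assms(1)] permutes_inv_o(1)[OF assms(2)] by (simp add: common_def)

lemma common_conj_mem:
  assumes P: "\<forall>g\<in>P. z \<circ> g \<circ> inv' z \<in> W" and z: "z permutes U" and x: "x permutes U" and g: "g \<in> common P x"
  shows "z \<circ> g \<circ> inv' z \<in> W"
    "(z \<circ> x \<circ> inv' z) \<circ> (z \<circ> g \<circ> inv' z) \<circ> inv' (z \<circ> x \<circ> inv' z) \<in> W"
proof -
  show "z \<circ> g \<circ> inv' z \<in> W" using P g by (auto simp: common_def)
  have "inv' (z \<circ> x \<circ> inv' z) = z \<circ> inv' x \<circ> inv' z"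
    using z x by (simp add: o_inv_distrib permutes_bij bij_comp permutes_inv inv_inv_eq comp_assoc bij_imp_bij_inv)
  then have "(z \<circ> x \<circ> inv' z) \<circ> (z \<circ> g \<circ> inv' z) \<circ> inv' (z \<circ> x \<circ> inv' z) = z \<circ> (x \<circ> g \<circ> inv' x) \<circ> inv' z"
    using permutes_inverses[OF z] by (simp add: fun_eq_iff)
  then show "(z \<circ> x \<circ> inv' z) \<circ> (z \<circ> g \<circ> inv' z) \<circ> inv' (z \<circ> x \<circ> inv' z) \<in> W"
    using P g by (simp only: common_def mem_Collect_eq)
qed

lemma funpow_card_id:
  assumes P: "subgroup P (sym_group m)" and g: "g \<in> P"
  shows "g ^^ card P = id"
proof -
  let ?GP = "(sym_group m)\<lparr>carrier := P\<rparr>"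
  have gr: "group ?GP" by (rule group.subgroup_imp_group[OF sym_group_is_group P])
  interpret GP: group ?GP by (rule gr)
  have "g [^]\<^bsub>?GP\<^esub> n = g ^^ n" for n :: nat
    by (induction n) (simp_all add: sym_group_one sym_group_mult funpow_swap1 fun_eq_iff)
  then show ?thesis using GP.pow_order_eq_1[of g] g by (simp add: order_def sym_group_one)
qed

text \<open>A nontrivial common element \<open>h\<close> has \<open>p\<close>-power order; with
  \<open>j\<close> minimal such that \<open>h ^^ (p ^ j) = id\<close>, its power with exponent
  \<open>p ^ (j - 1)\<close> is a common element of order \<open>p\<close>. Conjugated by
  \<open>z\<close>, it witnesses that \<open>z \<circ> x \<circ> inv' z\<close> is bad.\<close>

lemma common_trivial:
  assumes p: "Factorial_Ring.prime p" and P: "subgroup P (sym_group m)" "card P = p ^ a"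
    and z: "z permutes {1..m}" "\<forall>g\<in>P. z \<circ> g \<circ> inv' z \<in> W"
    and x: "x permutes {1..m}" "z \<circ> x \<circ> inv' z \<notin> bad p {1..m} W"
  shows "common P x = {id}"
proof -
  note Pd = subgroup_sym_groupD[OF P(1)]
  have "h = id" if h: "h \<in> common P x" for h
  proof (rule ccontr)
    assume hid: "h \<noteq> id"
    have hP: "h \<in> P" using h by (simp add: common_def)
    have ex: "h ^^ (p ^ a) = id" using funpow_card_id[OF P(1) hP] P(2) by simp
    define j where "j = (LEAST j. h ^^ (p ^ j) = id)"
    have j: "h ^^ (p ^ j) = id" unfolding j_def by (rule LeastI[of _ a]) (rule ex)
    have j0: "j > 0" using j hid by (cases j) auto
    define g where "g = h ^^ (p ^ (j - 1))"
    have gne: "g \<noteq> id"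
    proof
      assume "g = id"
      then have "j \<le> j - 1" unfolding j_def g_def by (intro Least_le) (simp add: j_def)
      then show False using j0 by simp
    qed
    have gp: "g ^^ p = id" using j j0 by (cases j) (simp_all add: g_def funpow_mult mult.commute)
    have powP: "q ^^ n \<in> P" if "q \<in> P" for q and n :: nat
      using that Pd(2,3) by (induction n) (simp_all add: id_def[symmetric])
    have "g \<in> common P x"
    proof -
      have "x \<circ> g \<circ> inv' x = (x \<circ> h \<circ> inv' x) ^^ (p ^ (j - 1))" unfolding g_def by (rule conj_funpow[OF x(1), symmetric])
      then show ?thesis using powP[OF hP] powP[of "x \<circ> h \<circ> inv' x"] h by (simp add: common_def g_def)
    qed
    note w = common_conj_mem[OF z(2,1) x(1) this]
    have "z \<circ> g \<circ> inv' z \<noteq> id" using conj_eq_id[OF z(1)] gne by blast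
    moreover have "(z \<circ> g \<circ> inv' z) ^^ p = id"
      using conj_funpow[OF z(1), where g = g and i = p] gp permutes_inv_o(1)[OF z(1)] by simp
    moreover have "z \<circ> x \<circ> inv' z permutes {1..m}" using z(1) x(1) by (intro permutes_compose permutes_inv)
    ultimately have "z \<circ> x \<circ> inv' z \<in> bad p {1..m} W" using w unfolding bad_def by blast
    then show False using x(2) by simp
  qed
  then show ?thesis using id_mem_common[OF P(1) x(1)] by auto
qed

lemma sylow_facts:
  assumes G: "G = sym_group m \<or> G = alt_group m" and P: "sylow_subgroup p P G"
  shows "subgroup P (sym_group m)" "P \<subseteq> carrier G" "card P = p ^ multiplicity p (order G)"
proof -
  have sub: "subgroup P G" using P by (simp add: sylow_subgroup_def)
  show "card P = p ^ multiplicity p (order G)" using P by (simp add: sylow_subgroup_def)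
  show "P \<subseteq> carrier G" using subgroup.subset[OF sub] .
  have "alt_group m = (sym_group m)\<lparr>carrier := carrier (alt_group m)\<rparr>" by (simp add: alt_group_def)
  then show "subgroup P (sym_group m)"
    using G sub group.incl_subgroup[OF sym_group_is_group alt_group_is_subgroup, of P m] by metis
qed

lemma carrier_facts:
  assumes "G = sym_group m \<or> G = alt_group m"
  shows "x \<in> carrier G \<Longrightarrow> x permutes {1..m}" "x permutes {1..m} \<Longrightarrow> evenperm x \<Longrightarrow> x \<in> carrier G"
    "finite (carrier G)" "carrier G \<noteq> {}"
proof -
  show 1: "x \<in> carrier G \<Longrightarrow> x permutes {1..m}" for x
    using assms by (auto simp: sym_group_carrier alt_group_carrier)
  show 2: "x permutes {1..m} \<Longrightarrow> evenperm x \<Longrightarrow> x \<in> carrier G" for x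
    using assms by (auto simp: sym_group_carrier alt_group_carrier)
  show "finite (carrier G)" by (rule finite_subset[OF _ finite_permutations[of "{1..m}"]]) (use 1 in auto)
  show "carrier G \<noteq> {}" using 2[of id] by auto
qed

lemma ex_minimal_common:
  assumes "finite C" "C \<noteq> {}"
  shows "\<exists>x\<in>C. \<forall>g\<in>C. common P g \<subseteq> common P x \<longrightarrow> common P g = common P x"
proof -
  obtain A where "A \<in> common P ` C" "\<forall>B\<in>common P ` C. B \<subseteq> A \<longrightarrow> A = B"
    using finite_has_minimal[of "common P ` C"] assms by auto
  then show ?thesis by auto
qed

lemma common_left_mult:
  assumes P: "subgroup P (sym_group m)" and q: "q \<in> P" and x: "x permutes {1..m}"
  shows "common P (q \<circ> x) = common P x"
proof -
  note Pd = subgroup_sym_groupD[OF P]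
  have qp: "q permutes {1..m}" using Pd(1) q .
  have e: "(q \<circ> x) \<circ> g \<circ> inv' (q \<circ> x) = q \<circ> (x \<circ> g \<circ> inv' x) \<circ> inv' q" for g
    using qp x by (simp add: o_inv_distrib permutes_bij comp_assoc)
  have "q \<circ> y \<circ> inv' q \<in> P \<longleftrightarrow> y \<in> P" for y
  proof
    assume "q \<circ> y \<circ> inv' q \<in> P"
    then have "inv' q \<circ> (q \<circ> y \<circ> inv' q) \<circ> q \<in> P" using Pd(3,4) q by blast
    moreover have "inv' q \<circ> (q \<circ> y \<circ> inv' q) \<circ> q = y"
      using permutes_inverses[OF qp] by (simp add: fun_eq_iff)
    ultimately show "y \<in> P" by simp
  next
    assume "y \<in> P"
    then show "q \<circ> y \<circ> inv' q \<in> P" using Pd(3,4) q by blast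
  qed
  then show ?thesis unfolding common_def e by blast
qed

lemma ex_conjugators:
  assumes p: "\<And>i. i \<in> {1..n::nat} \<Longrightarrow> Factorial_Ring.prime (p i)" "inj_on p {1..n}"
    and P: "\<And>i. i \<in> {1..n} \<Longrightarrow> subgroup (P i) (sym_group m)" "\<And>i. i \<in> {1..n} \<Longrightarrow> card (P i) = p i ^ a i"
    and V: "subgroup V (sym_group m)" "odd (fact m div card V)"
  shows "\<exists>z. (\<forall>q. z q permutes {1..m}) \<and> (\<forall>i\<in>{1..n}. \<forall>g\<in>P i.
    z (p i) \<circ> g \<circ> inv' (z (p i)) \<in> (if p i = 2 then V else std_cent (p i) m))"
proof -
  have "\<exists>z. z permutes {1..m} \<and> (\<forall>i\<in>{1..n}. p i = q \<longrightarrow> (\<forall>g\<in>P i. z \<circ> g \<circ> inv' z \<in> (if q = 2 then V else std_cent q m)))"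
    for q
  proof (cases "\<exists>i\<in>{1..n}. p i = q")
    case True
    then obtain i where i: "i \<in> {1..n}" "p i = q" by auto
    have uniq: "j = i" if "j \<in> {1..n}" "p j = q" for j using p(2) i that by (auto dest: inj_onD)
    have W: "subgroup (if q = 2 then V else std_cent q m) (sym_group m)"
      "\<not> q dvd fact m div card (if q = 2 then V else std_cent q m)"
      using V std_cent_index[OF p(1)[OF i(1)], of m] i(2) by auto
    obtain z where "z permutes {1..m}" "\<forall>g\<in>P i. z \<circ> g \<circ> inv' z \<in> (if q = 2 then V else std_cent q m)"
      using p_subgroup_sym_conj_into[OF p(1)[OF i(1)] P(1)[OF i(1)] P(2)[OF i(1)], of "if q = 2 then V else std_cent q m"] W i(2)
      by metis
    then show ?thesis using uniq by blast
  next
    case False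
    \<comment> \<open>Primes that do not occur impose no condition; \<open>id\<close> is a default
      value.\<close>
    then show ?thesis by (intro exI[of _ id]) auto
  qed
  then obtain z where "\<forall>q. z q permutes {1..m} \<and> (\<forall>i\<in>{1..n}. p i = q \<longrightarrow>
      (\<forall>g\<in>P i. z q \<circ> g \<circ> inv' (z q) \<in> (if q = 2 then V else std_cent q m)))" by metis
  then show ?thesis by (intro exI[of _ z]) auto
qed

lemma std_cent_large:
  assumes "p > m"
  shows "bad p {1..m} (std_cent p m) = {}"
proof -
  have "std_cent p m \<subseteq> {id}" using assms by (auto simp: std_cent_def cent_def)
  then show ?thesis by (auto simp: bad_def)
qed

lemma inclusion_minimal_trivial:
  assumes "G = sym_group m \<or> G = alt_group m" "subgroup P (sym_group m)" "P \<subseteq> carrier G" "x \<in> carrier G" "common P x = {id}"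
  shows "inclusion_minimal (P \<inter> conj_subgroup G P x) {P \<inter> conj_subgroup G P g | g. g \<in> carrier G}"
proof (rule inclusion_minimalI[OF assms(1,3,4)])
  fix g assume g: "g \<in> carrier G" "common P g \<subseteq> common P x"
  have "id \<in> common P g" by (rule id_mem_common[OF assms(2) carrier_facts(1)[OF assms(1) g(1)]])
  then show "common P g = common P x" using g(2) unfolding assms(5) by (intro equalityI) auto
qed

lemma simultaneous_large:
  assumes m: "m \<ge> 5" and G: "G = sym_group m \<or> G = alt_group m"
    and p: "\<And>i. i \<in> {1..n::nat} \<Longrightarrow> Factorial_Ring.prime (p i)" "inj_on p {1..n}"
    and P: "\<And>i. i \<in> {1..n} \<Longrightarrow> sylow_subgroup (p i) (P i) G"
  shows "\<exists>x\<in>carrier G. \<forall>i\<in>{1..n}.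
    inclusion_minimal (P i \<inter> conj_subgroup G (P i) x) {P i \<inter> conj_subgroup G (P i) g | g. g \<in> carrier G}"
proof -
  note Ps = sylow_facts[OF G P]
  define V where "V = (if m = 8 then V8 else SOME V. subgroup V (sym_group m) \<and> odd (fact m div card V)
    \<and> transpose 1 2 \<in> V \<and> total_bound m < card (good m V))"
  have V: "subgroup V (sym_group m) \<and> odd (fact m div card V) \<and> transpose 1 2 \<in> V \<and> total_bound m < card (good m V)"
    if "m \<noteq> 8" using someI_ex[OF ex_good_group[OF m that]] that by (simp add: V_def)
  have V': "subgroup V (sym_group m)" "odd (fact m div card V)"
    using V V8_facts by (cases "m = 8"; simp add: V_def)+
  obtain z where z: "\<And>q. z q permutes {1..m}" and zP: "\<And>i. i \<in> {1..n} \<Longrightarrow> \<forall>g\<in>P i.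
      z (p i) \<circ> g \<circ> inv' (z (p i)) \<in> (if p i = 2 then V else std_cent (p i) m)"
    using ex_conjugators[OF p Ps(1,3) V'] by blast
  have odd_ok: "common (P i) x = {id}"
    if i: "i \<in> {1..n}" "p i \<noteq> 2" and x: "x permutes {1..m}"
      "\<forall>q\<in>insert 3 (big_primes m). z q \<circ> x \<circ> inv' (z q) \<notin> bad q {1..m} (std_cent q m)" for i x
  proof (rule common_trivial[OF p(1)[OF i(1)] Ps(1)[OF i(1)] Ps(3)[OF i(1)] z _ x(1)])
    show "\<forall>g\<in>P i. z (p i) \<circ> g \<circ> inv' (z (p i)) \<in> std_cent (p i) m" using zP[OF i(1)] i(2) by simp
    show "z (p i) \<circ> x \<circ> inv' (z (p i)) \<notin> bad (p i) {1..m} (std_cent (p i) m)"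
    proof (cases "p i \<le> m")
      case True
      then show ?thesis using prime_cases[OF p(1)[OF i(1)] True] i(2) x(2) by auto
    next
      case False
      then show ?thesis using std_cent_large[of m "p i"] by simp
    qed
  qed
  show ?thesis
  proof (cases "m = 8")
    case False
    note V = V[OF False]
    obtain x where x: "x permutes {1..m}" "evenperm x" "z 2 \<circ> x \<circ> inv' (z 2) \<in> good m V"
      "\<forall>q\<in>insert 3 (big_primes m). z q \<circ> x \<circ> inv' (z q) \<notin> bad q {1..m} (std_cent q m)"
      using ex_even_avoiding[of m "good m V" z] card_even_good[of V m] V z m by (auto simp: good_def)
    have xG: "x \<in> carrier G" using carrier_facts(2)[OF G x(1,2)] .
    have "common (P i) x = {id}" if i: "i \<in> {1..n}" for i
    proof (cases "p i = 2")
      case True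
      show ?thesis
      proof (rule common_trivial[OF p(1)[OF i] Ps(1)[OF i] Ps(3)[OF i] z _ x(1)])
        show "\<forall>g\<in>P i. z (p i) \<circ> g \<circ> inv' (z (p i)) \<in> V" using zP[OF i] True by simp
        show "z (p i) \<circ> x \<circ> inv' (z (p i)) \<notin> bad (p i) {1..m} V" using x(3) True by (simp add: good_def)
      qed
    qed (use odd_ok[OF i _ x(1,4)] in blast)
    then show ?thesis using inclusion_minimal_trivial[OF G Ps(1,2) xG] xG by blast
  next
    case True
    have VV: "V = V8" using True by (simp add: V_def)
    have "total_bound 8 < good_bound 8" using total_bound_small unfolding list_all_iff by simp
    then have tb: "total_bound 8 < 8192" by (simp add: good_bound_def)
    show ?thesis
    proof (cases "\<exists>i\<in>{1..n}. p i = 2 \<and> (\<exists>x\<in>carrier G. common (P i) x = {id}) \<and> G = sym_group m")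
      \<comment> \<open>Nonexistence of trivial intersections in the symmetric group of degree eight
        is not proved. If there is one, at \<open>x0\<close>, the double coset of \<open>x0\<close>
        has \<open>(card (P i)) ^ 2 \<ge> 128 ^ 2\<close> elements, all with trivial intersection,
        and the union bound applies to them.\<close>
      case T: True
      then obtain i x0 where i: "i \<in> {1..n}" "p i = 2" and x0: "x0 \<in> carrier G" "common (P i) x0 = {id}"
        and GS: "G = sym_group m" by blast
      let ?T = "{x. x permutes {1..m} \<and> common (P i) x = {id}}"
      note Pd = subgroup_sym_groupD[OF Ps(1)[OF i(1)]]
      have x0p: "x0 permutes {1..m}" using carrier_facts(1)[OF G x0(1)] .
      have "(2::nat) ^ 7 dvd fact 8" by (simp add: fact_numeral)
      then have "7 \<le> multiplicity 2 (fact 8 :: nat)" by (intro multiplicity_geI) auto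
      then have "2 ^ 7 \<le> (2::nat) ^ multiplicity 2 (fact 8 :: nat)" by (intro power_increasing) auto
      then have cP: "128 \<le> card (P i)" using Ps(3)[OF i(1)] i(2) GS True by (simp add: order_sym_group)
      have "card (P i \<times> P i) \<le> 1 * card ?T"
      proof (rule card_double_coset_le[OF Ps(1)[OF i(1)] x0p _ order.refl])
        have "{d \<in> P i. x0 \<circ> d \<circ> inv' x0 \<in> P i} = {id}" using x0(2) by (simp add: common_def)
        then show "card {d \<in> P i. x0 \<circ> d \<circ> inv' x0 \<in> P i} \<le> 1" by simp
        show "finite ?T" by (rule finite_subset[OF _ finite_permutations[of "{1..m}"]]) auto
        fix v w assume "(v, w) \<in> P i \<times> P i"
        then have vw: "v \<in> P i" "w \<in> P i" by auto
        then have pp: "v permutes {1..m}" "w permutes {1..m}" using Pd(1) by auto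
        have xp: "v \<circ> x0 \<circ> w permutes {1..m}" using pp x0p by (intro permutes_compose)
        have "g = id" if g: "g \<in> common (P i) (v \<circ> x0 \<circ> w)" for g
        proof -
          have gP: "g \<in> P i" "v \<circ> x0 \<circ> w \<circ> g \<circ> inv' (v \<circ> x0 \<circ> w) \<in> P i" using g by (auto simp: common_def)
          have "w \<circ> g \<circ> inv' w \<in> P i" using Pd(3,4) gP(1) vw by blast
          moreover have "x0 \<circ> (w \<circ> g \<circ> inv' w) \<circ> inv' x0 \<in> P i"
            unfolding conj_double_coset[OF pp(1) x0p pp(2)]
            by (rule Pd(3)[OF Pd(3)[OF Pd(4)[OF vw(1)] gP(2)] vw(1)])
          ultimately have "w \<circ> g \<circ> inv' w \<in> common (P i) x0" by (simp add: common_def)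
          then show ?thesis using x0(2) conj_eq_id[OF pp(2)] by blast
        qed
        then show "v \<circ> x0 \<circ> w \<in> ?T" using id_mem_common[OF Ps(1)[OF i(1)] xp] xp by blast
      qed
      then have "128 * 128 \<le> card ?T"
        using mult_le_mono[OF cP cP] by (simp only: card_cartesian_product mult_1)
      then have "total_bound m < card ?T" using tb True by simp
      then obtain x where x: "x \<in> ?T"
        "\<forall>q\<in>insert 3 (big_primes m). z q \<circ> x \<circ> inv' (z q) \<notin> bad q {1..m} (std_cent q m)"
        using ex_avoiding[of m ?T z] m z by auto
      have xG: "x \<in> carrier G" using x(1) GS by (simp add: sym_group_carrier)
      have "common (P j) x = {id}" if j: "j \<in> {1..n}" for j
      proof (cases "p j = 2")
        case True
        then have "j = i" using inj_onD[OF p(2) _ j i(1)] i(2) by simp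
        then show ?thesis using x(1) by simp
      qed (use odd_ok[OF j _ _ x(2)] x(1) in blast)
      then show ?thesis using inclusion_minimal_trivial[OF G Ps(1,2) xG] xG by blast
    next
      \<comment> \<open>Now no intersection is trivial in the symmetric group, so one with at most
        two elements is minimal. In the alternating group the condition on even elements in
        \<open>good8\<close> makes the intersection trivial.\<close>
      case T: False
      obtain x where x: "x permutes {1..m}" "evenperm x" "z 2 \<circ> x \<circ> inv' (z 2) \<in> good8 V8"
        "\<forall>q\<in>insert 3 (big_primes m). z q \<circ> x \<circ> inv' (z q) \<notin> bad q {1..m} (std_cent q m)"
      proof -
        have "good8 V8 \<subseteq> {x. x permutes {1..m}}" using True by (auto simp: good8_def)
        moreover have "total_bound m < card (good8 V8)" using tb card_good8 True by simp
        ultimately have "\<exists>x. x permutes {1..m} \<and> evenperm x \<and> z 2 \<circ> x \<circ> inv' (z 2) \<in> good8 V8 \<and>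
          (\<forall>q\<in>insert 3 (big_primes m). z q \<circ> x \<circ> inv' (z q) \<notin> bad q {1..m} (std_cent q m))"
          using m by (intro ex_even_avoiding card_even_good8 z) simp_all
        then show ?thesis using that by blast
      qed
      have xG: "x \<in> carrier G" using carrier_facts(2)[OF G x(1,2)] .
      have "inclusion_minimal (P i \<inter> conj_subgroup G (P i) x) {P i \<inter> conj_subgroup G (P i) g | g. g \<in> carrier G}"
        if i: "i \<in> {1..n}" for i
      proof (cases "p i = 2")
        case False
        then show ?thesis
          using inclusion_minimal_trivial[OF G Ps(1,2)[OF i] xG odd_ok[OF i False x(1,4)]] by blast
      next
        case two: True
        let ?y = "z 2 \<circ> x \<circ> inv' (z 2)"
        have zPi: "\<forall>g\<in>P i. z 2 \<circ> g \<circ> inv' (z 2) \<in> V8" using zP[OF i] two VV by simp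
        have y: "card {g \<in> V8. ?y \<circ> g \<circ> inv' ?y \<in> V8} \<le> 2"
          "\<And>g. g \<in> V8 \<Longrightarrow> ?y \<circ> g \<circ> inv' ?y \<in> V8 \<Longrightarrow> evenperm g \<Longrightarrow> g = id"
          using x(3) by (auto simp: good8_def)
        note mem = common_conj_mem[OF zPi z x(1)]
        have finV: "finite V8" using V8_facts(3) by (metis card.infinite zero_neq_numeral)
        have finc: "finite (common (P i) g)" for g
          using finite_subset[OF Ps(2)[OF i] carrier_facts(3)[OF G]] by (simp add: common_def)
        show ?thesis
        proof (rule disjE[OF G])
          assume GA: "G = alt_group m"
          have "g = id" if g: "g \<in> common (P i) x" for g
          proof -
            have "g \<in> carrier G" using g Ps(2)[OF i] by (auto simp: common_def)
            then have gp: "g permutes {1..m}" "evenperm g" using GA by (auto simp: alt_group_carrier)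
            have pp: "permutation (z 2)" "permutation g"
              using z[of 2] gp(1) by (auto intro: permutes_imp_permutation[of "{1..m}"])
            then have "evenperm (z 2 \<circ> g \<circ> inv' (z 2))"
              using gp(2) by (simp add: evenperm_comp permutation_compose permutation_inverse evenperm_inv)
            then have "z 2 \<circ> g \<circ> inv' (z 2) = id" using y(2) mem[OF g] by blast
            then show ?thesis using conj_eq_id[OF z] by blast
          qed
          then have "common (P i) x = {id}" using id_mem_common[OF Ps(1)[OF i] x(1)] by blast
          then show ?thesis using inclusion_minimal_trivial[OF G Ps(1,2)[OF i] xG] by blast
        next
          assume GS: "G = sym_group m"
          have "card (common (P i) x) \<le> card {g \<in> V8. ?y \<circ> g \<circ> inv' ?y \<in> V8}"
          proof (rule card_inj_on_le[of "\<lambda>g. z 2 \<circ> g \<circ> inv' (z 2)"])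
            show "inj_on (\<lambda>g. z 2 \<circ> g \<circ> inv' (z 2)) (common (P i) x)"
            proof (rule inj_onI)
              fix g h assume e: "z 2 \<circ> g \<circ> inv' (z 2) = z 2 \<circ> h \<circ> inv' (z 2)"
              have "inv' (z 2) \<circ> (z 2 \<circ> f \<circ> inv' (z 2)) \<circ> z 2 = f" for f
                using permutes_inverses[OF z[of 2]] by (simp add: fun_eq_iff)
              then show "g = h" using e by metis
            qed
          qed (use mem finV in auto)
          then have c2: "card (common (P i) x) \<le> 2" using y(1) by simp
          show ?thesis
          proof (rule inclusion_minimalI[OF G Ps(2)[OF i] xG])
            fix g assume g: "g \<in> carrier G" "common (P i) g \<subseteq> common (P i) x"
            have gp: "g permutes {1..m}" using carrier_facts(1)[OF G g(1)] .
            have ne: "common (P i) g \<noteq> {id}" using T i two g(1) GS by blast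
            obtain h where h: "h \<in> common (P i) g" "h \<noteq> id"
              using ne id_mem_common[OF Ps(1)[OF i] gp] by blast
            have "card {id, h} \<le> card (common (P i) g)"
              using h id_mem_common[OF Ps(1)[OF i] gp] finc by (intro card_mono) auto
            then have "card (common (P i) x) \<le> card (common (P i) g)" using c2 h(2) by simp
            then show "common (P i) g = common (P i) x" using card_seteq[OF finc g(2)] by blast
          qed
        qed
      qed
      then show ?thesis using xG by blast
    qed
  qed
qed

section \<open>Degrees at most four\<close>

lemma evenperm_conj:
  assumes "z permutes {1..m::nat}" "g permutes {1..m}"
  shows "evenperm (z \<circ> g \<circ> inv' z) = evenperm g"
proof -
  have "permutation z" "permutation g" using assms by (auto intro: permutes_imp_permutation[of "{1..m}"])
  then show ?thesis
    by (auto simp: evenperm_comp permutation_compose permutation_inverse evenperm_inv)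
qed

lemma order_alt_group: "m \<ge> 2 \<Longrightarrow> 2 * order (alt_group m) = fact m"
  unfolding order_def by (rule alt_group_card_carrier)

lemma common_trivial_large:
  assumes p: "Factorial_Ring.prime p" "p > m" and P: "subgroup P (sym_group m)" "card P = p ^ a"
    and x: "x permutes {1..m}"
  shows "common P x = {id}"
proof -
  obtain z where z: "z permutes {1..m}" "\<forall>g\<in>P. z \<circ> g \<circ> inv' z \<in> std_cent p m"
    using p_subgroup_sym_conj_into[OF p(1) P std_cent_index[OF p(1)]] by blast
  show ?thesis using common_trivial[OF p(1) P z x] std_cent_large[OF p(2)] by simp
qed

text \<open>In degree three the Sylow 3-subgroup is the alternating group, which is normal, so all
  intersections coincide.\<close>

lemma common_3:
  assumes G: "G = sym_group 3 \<or> G = alt_group 3" and P: "sylow_subgroup 3 P G" and x: "x permutes {1..3}"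
  shows "common P x = P"
proof -
  note Ps = sylow_facts[OF G P]
  have c3: "card (carrier (alt_group 3)) = 3" using alt_group_card_carrier[of 3] by (simp add: fact_numeral)
  have p3: "Factorial_Ring.prime (3::nat)" by simp
  have "\<not> 3 dvd fact 3 div card (carrier (alt_group 3))" unfolding c3 by (simp add: fact_numeral)
  from p_subgroup_sym_conj_into[OF p3 Ps(1,3) alt_group_is_subgroup this]
  obtain z where z: "z permutes {1..3}" "\<forall>g\<in>P. z \<circ> g \<circ> inv' z \<in> carrier (alt_group 3)" by blast
  have sub: "P \<subseteq> carrier (alt_group 3)"
  proof
    fix g assume g: "g \<in> P"
    then have gp: "g permutes {1..3}" using subgroup_sym_groupD(1)[OF Ps(1)] by blast
    then show "g \<in> carrier (alt_group 3)"
      using z(2) g evenperm_conj[OF z(1) gp] unfolding alt_group_carrier by blast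
  qed
  have "3 ^ 1 dvd order G"
    using G c3 by (auto simp: order_sym_group fact_numeral order_def[of "alt_group 3"])
  moreover have "order G \<noteq> 0" using G c3 by (auto simp: order_sym_group order_def[of "alt_group 3"])
  ultimately have "1 \<le> multiplicity 3 (order G)" by (intro multiplicity_geI) auto
  then have "3 ^ 1 \<le> card P" unfolding Ps(3) by (intro power_increasing) auto
  then have "P = carrier (alt_group 3)"
    using c3 sub by (intro card_seteq carrier_facts(3)[of _ 3]) auto
  then have "g \<in> P \<longleftrightarrow> g permutes {1..3} \<and> evenperm g" for g by (simp add: alt_group_carrier)
  moreover have "x \<circ> g \<circ> inv' x permutes {1..3}" if "g permutes {1..3}" for g
    using x that by (intro permutes_compose permutes_inv)
  ultimately show ?thesis using evenperm_conj[OF x] unfolding common_def by blast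
qed

text \<open>The \<open>x\<close> that are minimal for \<open>Q\<close> are closed under left
  multiplication by \<open>Q\<close>, so there are at least \<open>card Q\<close> of them: 8 in the
  symmetric and 4 in the alternating group. Nontrivial intersections for 3 occur for at most 6 and 3
  elements respectively.\<close>

lemma ex_common_4:
  assumes G: "G = sym_group 4 \<or> G = alt_group 4"
    and Q: "subgroup Q (sym_group 4)" "Q \<subseteq> carrier G" "2 ^ multiplicity 2 (order G) \<le> card Q"
    and R: "subgroup R (sym_group 4)" "card R = 3 ^ a"
  shows "\<exists>x\<in>carrier G. (\<forall>g\<in>carrier G. common Q g \<subseteq> common Q x \<longrightarrow> common Q g = common Q x) \<and> common R x = {id}"
proof (rule ccontr)
  assume neg: "\<not> ?thesis"
  let ?T = "{x \<in> carrier G. \<forall>g\<in>carrier G. common Q g \<subseteq> common Q x \<longrightarrow> common Q g = common Q x}"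
  let ?bad = "bad 3 {1..4} (std_cent 3 4)"
  note cf = carrier_facts[OF G]
  have p3: "Factorial_Ring.prime (3::nat)" by simp
  have gr: "group G" using G sym_group_is_group alt_group_is_group by auto
  have mu: "monoid.mult G = (\<circ>)" using G by (auto simp: sym_group_mult alt_group_mult)
  obtain x0 where x0: "x0 \<in> ?T" using ex_minimal_common[OF cf(3,4), of Q] by blast
  have x0p: "x0 permutes {1..4}" using cf(1) x0 by blast
  have "card Q \<le> card ?T"
  proof (rule card_inj_on_le[of "\<lambda>q. q \<circ> x0"])
    show "inj_on (\<lambda>q. q \<circ> x0) Q"
      by (rule inj_onI) (metis comp_assoc comp_id permutes_inv_o(1)[OF x0p])
    show "finite ?T" using cf(3) by simp
    show "(\<lambda>q. q \<circ> x0) ` Q \<subseteq> ?T"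
    proof (rule image_subsetI)
      fix q assume q: "q \<in> Q"
      have "q \<circ> x0 \<in> carrier G"
        using monoid.m_closed[OF group.is_monoid[OF gr], of q x0] q Q(2) x0 unfolding mu by blast
      then show "q \<circ> x0 \<in> ?T" using x0 common_left_mult[OF Q(1) q x0p] by simp
    qed
  qed
  moreover obtain z where z: "z permutes {1..4}" "\<forall>g\<in>R. z \<circ> g \<circ> inv' z \<in> std_cent 3 4"
    using p_subgroup_sym_conj_into[OF p3 R std_cent_index[OF p3]] by blast
  have bad: "z \<circ> x \<circ> inv' z \<in> ?bad" if "x \<in> ?T" for x
    using common_trivial[OF p3 R z cf(1)] that neg by blast
  have sub: "?bad \<subseteq> {x. x permutes {1..4}}" by (auto simp: bad_def)
  have b6: "card ?bad \<le> 6" using card_bad_3_le[of 4] by (simp add: mid_count_def)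
  have "card ?T < 2 ^ multiplicity 2 (order G)"
  proof (rule disjE[OF G])
    assume GS: "G = sym_group 4"
    have "card ?T \<le> card {x. x permutes {1..4} \<and> z \<circ> x \<circ> inv' z \<in> ?bad}"
      using bad cf(1) by (intro card_mono finite_subset[OF _ finite_permutations[of "{1..4}"]]) auto
    then have "card ?T \<le> 6" using card_conj_perms(1)[OF z(1) sub] b6 by linarith
    moreover have "(2::nat) ^ 3 dvd order G" "order G \<noteq> 0" unfolding GS order_sym_group by (simp_all add: fact_numeral)
    then have "3 \<le> multiplicity 2 (order G)" by (intro multiplicity_geI) auto
    then have "2 ^ 3 \<le> (2::nat) ^ multiplicity 2 (order G)" by (intro power_increasing) auto
    ultimately show ?thesis by simp
  next
    assume GA: "G = alt_group 4"
    have "card ?T \<le> card {x. x permutes {1..4} \<and> evenperm x \<and> z \<circ> x \<circ> inv' z \<in> ?bad}"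
      using bad by (intro card_mono finite_subset[OF _ finite_permutations[of "{1..4}"]]) (auto simp: GA alt_group_carrier)
    then have "2 * card ?T \<le> 6" using card_conj_perms(2)[OF z(1) sub] card_even_bad_3[of 4] b6 by linarith
    moreover have o: "order G = 12" using order_alt_group[of 4] unfolding GA by (simp add: fact_numeral)
    have "2 \<le> multiplicity 2 (order G)" unfolding o by (intro multiplicity_geI) auto
    then have "2 ^ 2 \<le> (2::nat) ^ multiplicity 2 (order G)" by (intro power_increasing) auto
    ultimately show ?thesis by simp
  qed
  then show False using calculation Q(3) by linarith
qed

text \<open>Below degree four the prime 3 is no obstacle: its Sylow subgroup is trivial for
  \<open>m < 3\<close> and normal for \<open>m = 3\<close>. Only degree four has to reconcile 2 and
  3.\<close>

lemma simultaneous_small: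
  assumes m: "m \<le> 4" and G: "G = sym_group m \<or> G = alt_group m"
    and p: "\<And>i. i \<in> {1..n::nat} \<Longrightarrow> Factorial_Ring.prime (p i)" "inj_on p {1..n}"
    and P: "\<And>i. i \<in> {1..n} \<Longrightarrow> sylow_subgroup (p i) (P i) G"
  shows "\<exists>x\<in>carrier G. \<forall>i\<in>{1..n}.
    inclusion_minimal (P i \<inter> conj_subgroup G (P i) x) {P i \<inter> conj_subgroup G (P i) g | g. g \<in> carrier G}"
proof -
  note Ps = sylow_facts[OF G P]
  note cf = carrier_facts[OF G]
  define minimal_at where "minimal_at Q x \<longleftrightarrow>
    (\<forall>g\<in>carrier G. common Q g \<subseteq> common Q x \<longrightarrow> common Q g = common Q x)" for Q x
  have uniq: "P i = P j" if "i \<in> {1..n}" "j \<in> {1..n}" "p i = p j" for i j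
    using inj_onD[OF p(2) that(3,1,2)] by simp
  have sG: "subgroup (carrier G) (sym_group m)"
    using G alt_group_is_subgroup group.subgroup_self[OF sym_group_is_group] by blast
  have sI: "subgroup {id} (sym_group m)"
    using group.triv_subgroup[OF sym_group_is_group, of m] by (simp only: sym_group_one)
  have "0 < order G" using cf(3,4) by (simp add: order_def card_gt_0_iff)
  then have oG: "2 ^ multiplicity 2 (order G) \<le> card (carrier G)"
    using dvd_imp_le[OF multiplicity_dvd] unfolding order_def by blast
  \<comment> \<open>If 2 is not among the primes, the whole group takes the place of its Sylow
    subgroup; it meets the size condition.\<close>
  obtain Q where Q: "subgroup Q (sym_group m)" "Q \<subseteq> carrier G" "2 ^ multiplicity 2 (order G) \<le> card Q"
    and Q2: "\<And>i. i \<in> {1..n} \<Longrightarrow> p i = 2 \<Longrightarrow> P i = Q"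
  proof (cases "\<exists>i\<in>{1..n}. p i = 2")
    case True
    then obtain i where i: "i \<in> {1..n}" "p i = 2" by blast
    show ?thesis
      by (rule that[OF Ps(1,2)[OF i(1)]]) (use Ps(3)[OF i(1)] i(2) uniq[OF _ i(1)] in auto)
  next
    case False
    then show ?thesis using that[OF sG subset_refl oG] by blast
  qed
  have "\<exists>x\<in>carrier G. minimal_at Q x \<and> (\<forall>i\<in>{1..n}. p i = 3 \<longrightarrow> minimal_at (P i) x)"
  proof -
    consider "m < 3" | "m = 3" | "m = 4" using m by linarith
    then show ?thesis
    proof cases
      case 1
      obtain x where x: "x \<in> carrier G" "minimal_at Q x" using ex_minimal_common[OF cf(3,4), of Q] unfolding minimal_at_def by blast
      have "common (P i) g = {id}" if "i \<in> {1..n}" "p i = 3" "g \<in> carrier G" for i g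
        using common_trivial_large[OF p(1)[OF that(1)] _ Ps(1,3)[OF that(1)] cf(1)[OF that(3)]] that(2) 1 by simp
      then have "\<forall>i\<in>{1..n}. p i = 3 \<longrightarrow> minimal_at (P i) x" using x(1) by (simp add: minimal_at_def)
      then show ?thesis using x by blast
    next
      case 2
      obtain x where x: "x \<in> carrier G" "minimal_at Q x" using ex_minimal_common[OF cf(3,4), of Q] unfolding minimal_at_def by blast
      have "common (P i) g = P i" if "i \<in> {1..n}" "p i = 3" "g \<in> carrier G" for i g
        using common_3[of G "P i" g] G P[OF that(1)] that(2) cf(1)[OF that(3)] 2 by simp
      then have "\<forall>i\<in>{1..n}. p i = 3 \<longrightarrow> minimal_at (P i) x" using x(1) by (simp add: minimal_at_def)
      then show ?thesis using x by blast
    next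
      case 3
      \<comment> \<open>If 3 is not among the primes, the trivial group takes the place of its Sylow
        subgroup.\<close>
      obtain R a where R: "subgroup R (sym_group m)" "card R = 3 ^ a"
        and R3: "\<And>i. i \<in> {1..n} \<Longrightarrow> p i = 3 \<Longrightarrow> P i = R"
      proof (cases "\<exists>i\<in>{1..n}. p i = 3")
        case True
        then obtain i where i: "i \<in> {1..n}" "p i = 3" by blast
        show ?thesis
          by (rule that[OF Ps(1)[OF i(1)] Ps(3)[OF i(1), unfolded i(2)]]) (use i(2) uniq[OF _ i(1)] in auto)
      next
        case False
        then show ?thesis using that[OF sI, of 0] by simp
      qed
      obtain x where x: "x \<in> carrier G" "minimal_at Q x" "common R x = {id}"
        using ex_common_4[of G Q R a] G Q R unfolding 3 minimal_at_def by blast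
      have "minimal_at R x" unfolding minimal_at_def x(3) using id_mem_common[OF R(1) cf(1)] by blast
      then show ?thesis using x(1,2) R3 by metis
    qed
  qed
  then obtain x where x: "x \<in> carrier G" "minimal_at Q x" "\<forall>i\<in>{1..n}. p i = 3 \<longrightarrow> minimal_at (P i) x" by blast
  have "inclusion_minimal (P i \<inter> conj_subgroup G (P i) x) {P i \<inter> conj_subgroup G (P i) g | g. g \<in> carrier G}"
    if i: "i \<in> {1..n}" for i
  proof -
    have "minimal_at (P i) x"
    proof (cases "p i \<le> m")
      case True
      have "p i = 2 \<or> p i = 3"
        using prime_cases[OF p(1)[OF i] True] True m by (auto simp: big_primes_def)
      then show ?thesis
      proof
        assume "p i = 2"
        then show ?thesis using x(2) Q2[OF i] by (simp only:)
      next
        assume "p i = 3"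
        then show ?thesis using x(3) i by blast
      qed
    next
      case False
      then have "common (P i) g = {id}" if "g \<in> carrier G" for g
        using common_trivial_large[OF p(1)[OF i] _ Ps(1,3)[OF i] cf(1)[OF that]] by simp
      then show ?thesis using x(1) by (simp add: minimal_at_def)
    qed
    then show ?thesis unfolding minimal_at_def by (intro inclusion_minimalI[OF G Ps(2)[OF i] x(1)]) simp
  qed
  then show ?thesis using x(1) by blast
qed

theorem mainTheorem5:
  fixes m n :: nat
    and G :: "(nat \<Rightarrow> nat) monoid"
    and p :: "nat \<Rightarrow> nat"
    and P :: "nat \<Rightarrow> (nat \<Rightarrow> nat) set"
  assumes "m \<ge> 1"
    and "G = sym_group m \<or> G = alt_group m"
    and "\<And>i. i \<in> {1..n} \<Longrightarrow> Factorial_Ring.prime (p i)"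
    and "inj_on p {1..n}"
    and "\<And>i. i \<in> {1..n} \<Longrightarrow> sylow_subgroup (p i) (P i) G"
  shows "\<exists>x\<in>carrier G. \<forall>i\<in>{1..n}.
    inclusion_minimal (P i \<inter> conj_subgroup G (P i) x)
      {P i \<inter> conj_subgroup G (P i) g | g. g \<in> carrier G}"
proof (cases "m \<le> 4")
  case True
  then show ?thesis using assms(2-5) by (rule simultaneous_small)
next
  case False
  then have "m \<ge> 5" by simp
  then show ?thesis using assms(2-5) by (rule simultaneous_large)
qed

end
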